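(* Let $F$ be a number field, let $1\to N\to\Gamma\xrightarrow{\lambda}G\to 1$ be an extension of finite groups with $N$ abelian, and let $[\beta]\in H^2(\Gamma,F^* )$ be inflated from $G$. Then $$F^\beta[\Gamma]\cong\bigoplus_{[\chi]\in\mathrm{Lin}(N,F)/G}(F(\chi)E_\chi)*G,$$ where $E_\chi=\sum_{\chi'\in[\chi]}e_{\chi'}$, $F(\chi)E_\chi$ denotes $FN E_\chi\cong\bigoplus_{\chi'\in[\chi]}F(\chi')e_{\chi'}$, and the crossed product $(F(\chi)E_\chi)*G$ has skewing given by $\sigma$ and twisting given by $E_\chi\cdot(\beta\cdot\alpha)$. In particular, if $\chi\in\mathrm{Lin}(N,F)$ is a $G$-invariant character, then $$(F(\chi)E_\chi)*G\cong F(\chi)^{\beta\cdot T_\alpha(\chi)}[G].$$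
   Context: Cohomology groups $H^2(\Gamma,F^* )$ and $H^2(G,F^* )$ are with respect to the trivial action. For a commutative ring $R$ and a $2$-cocycle $\gamma\in Z^2(H,R^* )$ of a group $H$, $R^\gamma[H]$ is the twisted group ring: free $R$-module with basis $\{u_x\}_{x\in H}$, $u_xu_y=\gamma(x,y)u_{xy}$, and $u_x$ commuting with $R$. Cocycles are normalized. "$[\beta]$ inflated from $G$" means $\beta(x,y)=\beta(\lambda(x),\lambda(y))$ for a $2$-cocycle of $G$ with values in $F^*$, again denoted $\beta$. Fix a section $\mu:G\to\Gamma$ of $\lambda$ (with $\mu(1)=1$); put $\alpha(g,h)=\mu(g)\mu(h)\mu(gh)^{-1}\in N$ and $\sigma_g(x)=\mu(g)x\mu(g)^{-1}$ for $x\in N$, extended linearly to $FN$. Let $K$ be a splitting field of $N$ containing $F$. $\mathrm{Lin}(N,F)$ is a set of (linear) $K$-characters of $N$ containing the character of exactly one composition factor of $V\otimes_FK$ for each simple $FN$-module $V$ up to isomorphism; it is in bijection $\chi\mapsto e_\chi$ with the primitive central idempotents of $FN$, and $FNe_\chi\cong F(\chi)$, the field generated by $F$ and the values of $\chi$, with $ne_\chi=\chi(n)e_\chi$. The group $G\cong\Gamma/N$ acts on the primitive central idempotents of $FN$ via $\sigma$, hence on $\mathrm{Lin}(N,F)$ through this bijection; $\mathrm{Lin}(N,F)/G$ is the orbit set and $[\chi]$ the orbit of $\chi$. $\chi$ is $G$-invariant if $\chi(\sigma_g(n))=\chi(n)$ for all $g\in G,n\in N$; then $T_\alpha(\chi)\in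 Z^2(G,F(\chi)^* )$ is $T_\alpha(\chi)(g,h)=\chi(\alpha(g,h))$, and $(\beta\cdot T_\alpha(\chi))(g,h)=\beta(g,h)\chi(\alpha(g,h))$. The crossed product $S*G$ with $S=FNE_\chi$ is the free left $S$-module with basis $\{v_g\}_{g\in G}$ and multiplication $v_gx=\sigma_g(x)v_g$ for $x\in S$ (skewing) and $v_gv_h=E_\chi\beta(g,h)\alpha(g,h)v_{gh}$ (twisting). *)

theory Defs
  imports
    "HOL-Algebra.Algebra"
    "Jordan_Normal_Form.VS_Connect"
begin

text \<open>
  The base field is a type 'f, the field K containing it is a type 'k, and the inclusion
  is a field homomorphism \<open>\<iota> :: 'f \<Rightarrow> 'k\<close>. Algebras are HOL-Algebra records of type \<open>module\<close>,
  i.e. rings with a scalar action. All groups whose elements index a basis are finite.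
\<close>

definition number_field :: "'f::field_char_0 itself \<Rightarrow> bool" where
  "number_field _ \<longleftrightarrow>
     (\<exists>B::'f set. finite B \<and> (\<forall>x. \<exists>q::'f \<Rightarrow> rat. x = (\<Sum>b\<in>B. of_rat (q b) * b)))"

text \<open>A subring A of 'k, regarded as an 'f-algebra through \<open>\<iota>\<close>.\<close>

definition scalar_algebra :: "('f \<Rightarrow> 'k::field) \<Rightarrow> 'k set \<Rightarrow> ('f, 'k) module" where
  "scalar_algebra \<iota> A =
     \<lparr>carrier = A, monoid.mult = (*), monoid.one = 1, ring.zero = 0, ring.add = (+), module.smult = (\<lambda>c x. \<iota> c * x)\<rparr>"

definition algebra_iso :: "('r, 's) module \<Rightarrow> ('r, 't) module \<Rightarrow> ('s \<Rightarrow> 't) set" where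
  "algebra_iso A B =
     {h \<in> ring_iso A B. \<forall>c. \<forall>x\<in>carrier A. h (c \<odot>\<^bsub>A\<^esub> x) = c \<odot>\<^bsub>B\<^esub> h x}"

definition algebra_isomorphic :: "('r, 's) module \<Rightarrow> ('r, 't) module \<Rightarrow> bool" where
  "algebra_isomorphic A B \<longleftrightarrow> algebra_iso A B \<noteq> {}"

text \<open>External direct sum over a finite index set, with componentwise operations.\<close>

definition external_direct_sum ::
    "'i set \<Rightarrow> ('i \<Rightarrow> ('r, 's) module) \<Rightarrow> ('r, 'i \<Rightarrow> 's) module" where
  "external_direct_sum I A =
     \<lparr>carrier = (\<Pi>\<^sub>E i\<in>I. carrier (A i)),
      monoid.mult = (\<lambda>f g. \<lambda>i\<in>I. f i \<otimes>\<^bsub>A i\<^esub> g i),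
      monoid.one = (\<lambda>i\<in>I. \<one>\<^bsub>A i\<^esub>),
      ring.zero = (\<lambda>i\<in>I. \<zero>\<^bsub>A i\<^esub>),
      ring.add = (\<lambda>f g. \<lambda>i\<in>I. f i \<oplus>\<^bsub>A i\<^esub> g i),
      module.smult = (\<lambda>c f. \<lambda>i\<in>I. c \<odot>\<^bsub>A i\<^esub> f i)\<rparr>"

definition normalized_2_cocycle :: "('g, 'x) monoid_scheme \<Rightarrow> ('g \<Rightarrow> 'g \<Rightarrow> 'f::field) \<Rightarrow> bool" where
  "normalized_2_cocycle H \<gamma> \<longleftrightarrow>
     (\<forall>x\<in>carrier H. \<forall>y\<in>carrier H. \<gamma> x y \<noteq> 0) \<and>
     (\<forall>x\<in>carrier H. \<gamma> \<one>\<^bsub>H\<^esub> x = 1 \<and> \<gamma> x \<one>\<^bsub>H\<^esub> = 1) \<and>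
     (\<forall>x\<in>carrier H. \<forall>y\<in>carrier H. \<forall>z\<in>carrier H.
        \<gamma> x y * \<gamma> (x \<otimes>\<^bsub>H\<^esub> y) z = \<gamma> y z * \<gamma> x (y \<otimes>\<^bsub>H\<^esub> z))"

text \<open>
  A function f stands for the sum of the \<open>f x v\<^sub>x\<close>, so that
  \<open>(a v\<^sub>x) (b v\<^sub>y) = a \<sigma>\<^sub>x(b) \<tau>(x,y) v\<^bsub>xy\<^esub>\<close>. The unit is \<open>1 v\<^sub>1\<close> because twistings are normalized.
  The twisted group algebra is the case of trivial skewing.
\<close>

definition crossed_product ::
    "('r, 's) module \<Rightarrow> ('g, 'x) monoid_scheme \<Rightarrow> ('g \<Rightarrow> 's \<Rightarrow> 's) \<Rightarrow> ('g \<Rightarrow> 'g \<Rightarrow> 's)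
      \<Rightarrow> ('r, 'g \<Rightarrow> 's) module" where
  "crossed_product S H \<sigma> \<tau> =
     \<lparr>carrier = {f. (\<forall>x\<in>carrier H. f x \<in> carrier S) \<and> (\<forall>x. x \<notin> carrier H \<longrightarrow> f x = \<zero>\<^bsub>S\<^esub>)},
      monoid.mult = (\<lambda>f g z. \<Oplus>\<^bsub>S\<^esub>p \<in> {(x, y). x \<in> carrier H \<and> y \<in> carrier H \<and> x \<otimes>\<^bsub>H\<^esub> y = z}.
                f (fst p) \<otimes>\<^bsub>S\<^esub> \<sigma> (fst p) (g (snd p)) \<otimes>\<^bsub>S\<^esub> \<tau> (fst p) (snd p)),
      monoid.one = (\<lambda>x. if x = \<one>\<^bsub>H\<^esub> then \<one>\<^bsub>S\<^esub> else \<zero>\<^bsub>S\<^esub>),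
      ring.zero = (\<lambda>x. \<zero>\<^bsub>S\<^esub>),
      ring.add = (\<lambda>f g x. f x \<oplus>\<^bsub>S\<^esub> g x),
      module.smult = (\<lambda>c f x. c \<odot>\<^bsub>S\<^esub> f x)\<rparr>"

definition twisted_group_algebra ::
    "('r, 's) module \<Rightarrow> ('g, 'x) monoid_scheme \<Rightarrow> ('g \<Rightarrow> 'g \<Rightarrow> 's) \<Rightarrow> ('r, 'g \<Rightarrow> 's) module" where
  "twisted_group_algebra R H \<gamma> = crossed_product R H (\<lambda>_ r. r) \<gamma>"

definition base_algebra :: "('f::field, 'f) module" where
  "base_algebra = scalar_algebra (\<lambda>c. c) UNIV"

definition group_algebra :: "('a, 'x) monoid_scheme \<Rightarrow> ('f::field, 'a \<Rightarrow> 'f) module" where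
  "group_algebra H = twisted_group_algebra base_algebra H (\<lambda>_ _. 1)"

definition basis_elem :: "'a \<Rightarrow> 'a \<Rightarrow> 'f::field" where
  "basis_elem n = (\<lambda>m. if m = n then 1 else 0)"

definition linear_extension :: "'a set \<Rightarrow> ('a \<Rightarrow> 'a) \<Rightarrow> ('a \<Rightarrow> 'f::field) \<Rightarrow> 'a \<Rightarrow> 'f" where
  "linear_extension N s x = (\<lambda>m. \<Sum>n | n \<in> N \<and> s n = m. x n)"

definition central_idempotent :: "('s, 'x) ring_scheme \<Rightarrow> 's \<Rightarrow> bool" where
  "central_idempotent R e \<longleftrightarrow>
     e \<in> carrier R \<and> e \<otimes>\<^bsub>R\<^esub> e = e \<and> (\<forall>x\<in>carrier R. e \<otimes>\<^bsub>R\<^esub> x = x \<otimes>\<^bsub>R\<^esub> e)"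

definition primitive_central_idempotent :: "('s, 'x) ring_scheme \<Rightarrow> 's \<Rightarrow> bool" where
  "primitive_central_idempotent R e \<longleftrightarrow>
     central_idempotent R e \<and> e \<noteq> \<zero>\<^bsub>R\<^esub> \<and>
     \<not> (\<exists>a b. central_idempotent R a \<and> central_idempotent R b \<and> a \<noteq> \<zero>\<^bsub>R\<^esub> \<and> b \<noteq> \<zero>\<^bsub>R\<^esub> \<and>
             a \<otimes>\<^bsub>R\<^esub> b = \<zero>\<^bsub>R\<^esub> \<and> e = a \<oplus>\<^bsub>R\<^esub> b)"

definition corner :: "('r, 's) module \<Rightarrow> 's \<Rightarrow> ('r, 's) module" where
  "corner R e = R\<lparr>carrier := (\<lambda>x. x \<otimes>\<^bsub>R\<^esub> e) ` carrier R, one := e\<rparr>"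

text \<open>
  Finite-dimensional modules over a group algebra are given by matrix representations, i.e. by
  the action on coordinate vectors. Extension of scalars then applies \<open>\<iota>\<close> to matrix entries.
\<close>

definition matrix_rep :: "('a, 'x) monoid_scheme \<Rightarrow> nat \<Rightarrow> ('a \<Rightarrow> 'c::field mat) \<Rightarrow> bool" where
  "matrix_rep H d \<rho> \<longleftrightarrow>
     (\<forall>x\<in>carrier H. \<rho> x \<in> carrier_mat d d) \<and> \<rho> \<one>\<^bsub>H\<^esub> = 1\<^sub>m d \<and>
     (\<forall>x\<in>carrier H. \<forall>y\<in>carrier H. \<rho> (x \<otimes>\<^bsub>H\<^esub> y) = \<rho> x * \<rho> y)"

definition invariant_subspace ::
    "('a, 'x) monoid_scheme \<Rightarrow> nat \<Rightarrow> ('a \<Rightarrow> 'c::field mat) \<Rightarrow> 'c vec set \<Rightarrow> bool" where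
  "invariant_subspace H d \<rho> W \<longleftrightarrow>
     subspace class_ring W (module_vec TYPE('c) d) \<and>
     (\<forall>x\<in>carrier H. \<forall>w\<in>W. \<rho> x *\<^sub>v w \<in> W)"

definition irreducible_rep :: "('a, 'x) monoid_scheme \<Rightarrow> nat \<Rightarrow> ('a \<Rightarrow> 'c::field mat) \<Rightarrow> bool" where
  "irreducible_rep H d \<rho> \<longleftrightarrow>
     matrix_rep H d \<rho> \<and> d \<noteq> 0 \<and>
     (\<forall>W. invariant_subspace H d \<rho> W \<longrightarrow> W = {0\<^sub>v d} \<or> W = carrier_vec d)"

text \<open>
  \<open>\<tau>\<close> is irreducible and isomorphic to a subquotient: multiplication by P maps the submodule W
  equivariantly onto the module of \<open>\<tau>\<close>, which is thus W modulo the kernel of P on W.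
\<close>

definition composition_factor ::
    "('a, 'x) monoid_scheme \<Rightarrow> nat \<Rightarrow> ('a \<Rightarrow> 'c::field mat) \<Rightarrow> nat \<Rightarrow> ('a \<Rightarrow> 'c mat) \<Rightarrow> bool" where
  "composition_factor H d \<rho> m \<tau> \<longleftrightarrow>
     irreducible_rep H m \<tau> \<and>
     (\<exists>W P. invariant_subspace H d \<rho> W \<and> P \<in> carrier_mat m d \<and>
            (\<lambda>w. P *\<^sub>v w) ` W = carrier_vec m \<and>
            (\<forall>x\<in>carrier H. \<forall>w\<in>W. P *\<^sub>v (\<rho> x *\<^sub>v w) = \<tau> x *\<^sub>v (P *\<^sub>v w)))"

text \<open>Characters are extensional, so that equal characters are equal functions.\<close>

definition rep_character :: "('a, 'x) monoid_scheme \<Rightarrow> ('a \<Rightarrow> 'c::field mat) \<Rightarrow> 'a \<Rightarrow> 'c" where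
  "rep_character H \<tau> = (\<lambda>x\<in>carrier H. \<Sum>i<dim_row (\<tau> x). \<tau> x $$ (i, i))"

definition linear_characters :: "('a, 'x) monoid_scheme \<Rightarrow> ('a \<Rightarrow> 'c::field) set" where
  "linear_characters H =
     {\<chi> \<in> extensional (carrier H).
        (\<forall>x\<in>carrier H. \<chi> x \<noteq> 0) \<and>
        (\<forall>x\<in>carrier H. \<forall>y\<in>carrier H. \<chi> (x \<otimes>\<^bsub>H\<^esub> y) = \<chi> x * \<chi> y)}"

text \<open>Splitting field: simple modules have only scalar endomorphisms.\<close>

definition splitting_field :: "'k::field itself \<Rightarrow> ('a, 'x) monoid_scheme \<Rightarrow> bool" where
  "splitting_field _ H \<longleftrightarrow>
     (\<forall>d (\<rho> :: 'a \<Rightarrow> 'k mat). irreducible_rep H d \<rho> \<longrightarrow>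
        (\<forall>A\<in>carrier_mat d d. (\<forall>x\<in>carrier H. A * \<rho> x = \<rho> x * A) \<longrightarrow> (\<exists>c. A = c \<cdot>\<^sub>m 1\<^sub>m d)))"

text \<open>\<open>\<chi>\<close> is the character of a composition factor of the module of \<open>\<rho>\<close> with scalars extended.\<close>

definition constituent_character ::
    "('f::field \<Rightarrow> 'k::field) \<Rightarrow> ('a, 'x) monoid_scheme \<Rightarrow> nat \<Rightarrow> ('a \<Rightarrow> 'f mat) \<Rightarrow> ('a \<Rightarrow> 'k) \<Rightarrow> bool"
  where
  "constituent_character \<iota> H d \<rho> \<chi> \<longleftrightarrow>
     (\<exists>m \<tau>. composition_factor H d (\<lambda>x. map_mat \<iota> (\<rho> x)) m \<tau> \<and> \<chi> = rep_character H \<tau>)"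

text \<open>
  Lin(H,F) depends on choices; this says that L is one admissible choice. Isomorphic modules have
  the same constituents, so quantifying over all simple modules rather than over isomorphism
  classes makes no difference.
\<close>

definition is_Lin ::
    "('f::field \<Rightarrow> 'k::field) \<Rightarrow> ('a, 'x) monoid_scheme \<Rightarrow> ('a \<Rightarrow> 'k) set \<Rightarrow> bool" where
  "is_Lin \<iota> H L \<longleftrightarrow>
     L \<subseteq> linear_characters H \<and>
     (\<forall>d (\<rho> :: 'a \<Rightarrow> 'f mat). irreducible_rep H d \<rho> \<longrightarrow>
        (\<exists>!\<chi>. \<chi> \<in> L \<and> constituent_character \<iota> H d \<rho> \<chi>))"

definition character_field ::
    "('f::field \<Rightarrow> 'k::field) \<Rightarrow> ('a, 'x) monoid_scheme \<Rightarrow> ('a \<Rightarrow> 'k) \<Rightarrow> ('f, 'k) module" where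
  "character_field \<iota> H \<chi> =
     scalar_algebra \<iota> (generate_field class_ring (range \<iota> \<union> \<chi> ` carrier H))"

text \<open>
  The primitive central idempotent \<open>e\<^sub>\<chi>\<close> belonging to \<open>\<chi>\<close>: under an isomorphism of its block with
  \<open>F(\<chi>)\<close>, the element \<open>n e\<^sub>\<chi>\<close> becomes \<open>\<chi>(n)\<close>. Such an idempotent is unique, since the map
  \<open>x \<mapsto> \<phi>(x e\<^sub>\<chi>)\<close> is then the linear extension of \<open>\<chi>\<close>, whose value at \<open>e\<^sub>\<chi>\<close> is 1.
\<close>

definition char_idempotent ::
    "('f::field \<Rightarrow> 'k::field) \<Rightarrow> ('a, 'x) monoid_scheme \<Rightarrow> ('a \<Rightarrow> 'k) \<Rightarrow> 'a \<Rightarrow> 'f" where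
  "char_idempotent \<iota> H \<chi> =
     (THE e. primitive_central_idempotent (group_algebra H) e \<and>
        (\<exists>\<phi>\<in>algebra_iso (corner (group_algebra H) e) (character_field \<iota> H \<chi>).
           \<forall>n\<in>carrier H. \<phi> (basis_elem n \<otimes>\<^bsub>group_algebra H\<^esub> e) = \<chi> n))"

text \<open>
  In the following, \<open>N\<close> is the kernel of a surjection \<open>\<Gamma> \<rightarrow> G\<close> with normalized section \<open>\<mu>\<close>.
\<close>

definition normalized_section ::
    "('a, 'x) monoid_scheme \<Rightarrow> ('g, 'y) monoid_scheme \<Rightarrow> ('a \<Rightarrow> 'g) \<Rightarrow> ('g \<Rightarrow> 'a) \<Rightarrow> bool" where
  "normalized_section \<Gamma> G p \<mu> \<longleftrightarrow>
     (\<forall>g\<in>carrier G. \<mu> g \<in> carrier \<Gamma> \<and> p (\<mu> g) = g) \<and> \<mu> \<one>\<^bsub>G\<^esub> = \<one>\<^bsub>\<Gamma>\<^esub>"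

definition section_cocycle ::
    "('a, 'x) monoid_scheme \<Rightarrow> ('g, 'y) monoid_scheme \<Rightarrow> ('g \<Rightarrow> 'a) \<Rightarrow> 'g \<Rightarrow> 'g \<Rightarrow> 'a" where
  "section_cocycle \<Gamma> G \<mu> g h = \<mu> g \<otimes>\<^bsub>\<Gamma>\<^esub> \<mu> h \<otimes>\<^bsub>\<Gamma>\<^esub> inv\<^bsub>\<Gamma>\<^esub> \<mu> (g \<otimes>\<^bsub>G\<^esub> h)"

definition section_conj :: "('a, 'x) monoid_scheme \<Rightarrow> ('g \<Rightarrow> 'a) \<Rightarrow> 'g \<Rightarrow> 'a \<Rightarrow> 'a" where
  "section_conj \<Gamma> \<mu> g n = \<mu> g \<otimes>\<^bsub>\<Gamma>\<^esub> n \<otimes>\<^bsub>\<Gamma>\<^esub> inv\<^bsub>\<Gamma>\<^esub> \<mu> g"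

text \<open>The action on L is transported from idempotents: g maps \<open>\<chi>\<close> to \<open>\<chi>'\<close> iff \<open>\<sigma>\<^sub>g(e\<^sub>\<chi>) = e\<^bsub>\<chi>'\<^esub>\<close>.\<close>

definition Lin_orbit ::
    "('f::field \<Rightarrow> 'k::field) \<Rightarrow> ('a, 'x) monoid_scheme \<Rightarrow> ('g, 'y) monoid_scheme \<Rightarrow> 'a set \<Rightarrow>
     ('g \<Rightarrow> 'a) \<Rightarrow> ('a \<Rightarrow> 'k) set \<Rightarrow> ('a \<Rightarrow> 'k) \<Rightarrow> ('a \<Rightarrow> 'k) set" where
  "Lin_orbit \<iota> \<Gamma> G N \<mu> L \<chi> =
     {\<chi>' \<in> L. \<exists>g\<in>carrier G.
        char_idempotent \<iota> (\<Gamma>\<lparr>carrier := N\<rparr>) \<chi>' =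
        linear_extension N (section_conj \<Gamma> \<mu> g) (char_idempotent \<iota> (\<Gamma>\<lparr>carrier := N\<rparr>) \<chi>)}"

definition orbit_idempotent ::
    "('f::field \<Rightarrow> 'k::field) \<Rightarrow> ('a, 'x) monoid_scheme \<Rightarrow> ('a \<Rightarrow> 'k) set \<Rightarrow> 'a \<Rightarrow> 'f" where
  "orbit_idempotent \<iota> H C = (\<Oplus>\<^bsub>group_algebra H\<^esub>\<chi>\<in>C. char_idempotent \<iota> H \<chi>)"

text \<open>The subalgebra \<open>FN E\<close> of \<open>FN\<close> for an orbit C.\<close>

definition orbit_algebra ::
    "('f::field \<Rightarrow> 'k::field) \<Rightarrow> ('a, 'x) monoid_scheme \<Rightarrow> ('a \<Rightarrow> 'k) set \<Rightarrow> ('f, 'a \<Rightarrow> 'f) module" where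
  "orbit_algebra \<iota> H C = corner (group_algebra H) (orbit_idempotent \<iota> H C)"

definition orbit_crossed_product ::
    "('f::field \<Rightarrow> 'k::field) \<Rightarrow> ('a, 'x) monoid_scheme \<Rightarrow> ('g, 'y) monoid_scheme \<Rightarrow> 'a set \<Rightarrow>
     ('g \<Rightarrow> 'a) \<Rightarrow> ('g \<Rightarrow> 'g \<Rightarrow> 'f) \<Rightarrow> ('a \<Rightarrow> 'k) set \<Rightarrow> ('f, 'g \<Rightarrow> 'a \<Rightarrow> 'f) module" where
  "orbit_crossed_product \<iota> \<Gamma> G N \<mu> \<beta> C =
     (let FN = group_algebra (\<Gamma>\<lparr>carrier := N\<rparr>); E = orbit_idempotent \<iota> (\<Gamma>\<lparr>carrier := N\<rparr>) C
      in crossed_product (orbit_algebra \<iota> (\<Gamma>\<lparr>carrier := N\<rparr>) C) G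
           (\<lambda>g. linear_extension N (section_conj \<Gamma> \<mu> g))
           (\<lambda>g h. E \<otimes>\<^bsub>FN\<^esub> (\<beta> g h \<odot>\<^bsub>FN\<^esub> basis_elem (section_cocycle \<Gamma> G \<mu> g h))))"

end

theory Submission
  imports Defs "HOL-Library.Function_Algebras"
begin

text \<open>
  The block of FN at a linear character \<open>\<chi>\<close> is cut out by an idempotent \<open>e\<^sub>\<chi>\<close> on which evaluation at
  \<open>\<chi>\<close> is 1 and which is annihilated by the kernel of this evaluation. A Maschke average of an
  F-linear section of the evaluation provides \<open>e\<^sub>\<chi>\<close>, and \<open>FN e\<^sub>\<chi>\<close> is isomorphic to \<open>F(\<chi>)\<close>. Two such
  idempotents are equal or orthogonal; those of the characters in Lin(N,F) are distinct, because
  characters with the same idempotent are constituents of the same simple module, and they sum up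
  to 1, because otherwise a simple submodule in the complement would have no constituent in
  Lin(N,F).

  Writing the elements of \<open>\<Gamma>\<close> as \<open>n \<mu>(g)\<close> turns \<open>F\<^sup>\<beta>[\<Gamma>]\<close> into a crossed product of G over FN.
  Conjugation permutes the \<open>e\<^sub>\<chi>\<close>, hence the orbit sums are central and orthogonal with sum 1, and
  they split this crossed product. If \<open>\<chi>\<close> is invariant, its orbit is a singleton and the
  isomorphism of \<open>FN e\<^sub>\<chi>\<close> with \<open>F(\<chi>)\<close>, applied coefficientwise, removes the skewing.
\<close>

section \<open>Group algebras of finite abelian groups\<close>

text \<open>\<open>char_idempotent\<close> is a definite description through an unspecified
  isomorphism, so the proof rests on a criterion that can be checked by calculation:
  \<open>e\<close> has value 1 under evaluation at \<open>\<chi>\<close> and kills the kernel of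
  this evaluation. In other words, FN is the direct sum of the block FN e and that kernel.
  Evaluation takes values in a field, so idempotents evaluate to 0 or 1, and from this come
  primitivity, uniqueness and orthogonality. The averaging takes the place of the formula for
  \<open>e\<close> by traces from F(\<chi>) to F. A second obstacle is that Lin(N,F) is specified by
  matrix representations. Both halves of the unique existence in \<open>is_Lin\<close> have to be
  tested on suitable simple modules, and minimal ideals of FN, written in coordinates, supply them.
  Finally, Lin(N,F) is a choice of representatives and need not be closed under composing a
  character with conjugation. The action of G is therefore followed on idempotents, where the choice
  is invisible.\<close>

lemma finsum_conv_sum:
  fixes R :: "('b::comm_monoid_add, 'm) ring_scheme"
  assumes "abelian_monoid R" and "ring.add R = (+)" and "ring.zero R = 0" and "f \<in> A \<rightarrow> carrier R"
  shows "finsum R f A = sum f A"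
  using assms(4)
proof (induction A rule: infinite_finite_induct)
  \<comment> \<open>Both kinds of sum default to zero on infinite index sets, so finiteness need not
    be carried along.\<close>
  case (infinite A)
  then show ?case
    using assms(3) by (simp add: finsum_def finprod_def)
next
  case empty
  then show ?case
    using assms by (simp add: abelian_monoid.finsum_empty)
next
  case (insert x F)
  then show ?case
    using assms by (simp add: abelian_monoid.finsum_insert Pi_iff)
qed

lemma abelian_monoid_scalar_algebra:
  assumes "0 \<in> R" and "\<And>x y. x \<in> R \<Longrightarrow> y \<in> R \<Longrightarrow> x + y \<in> R"
  shows "abelian_monoid (scalar_algebra \<iota> R)"
  using assms by (intro abelian_monoidI) (auto simp: scalar_algebra_def algebra_simps)

text \<open>\<open>f\<close> stands for a formal sum over \<open>S\<close>, and this is the value at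
  it of the linear extension of \<open>\<phi>\<close>, with coefficients moved along
  \<open>j\<close>. Arbitrary \<open>\<phi>\<close> with \<open>j\<close> the identity detect
  equality of formal sums; \<open>j = \<iota>\<close> and a character give the evaluation
  homomorphism to K. One lemma per operation serves both uses.\<close>

definition pairing :: "('f \<Rightarrow> 'k::comm_ring_1) \<Rightarrow> 'a set \<Rightarrow> ('a \<Rightarrow> 'f) \<Rightarrow> ('a \<Rightarrow> 'k) \<Rightarrow> 'k" where
  "pairing j S f \<phi> = (\<Sum>x\<in>S. j (f x) * \<phi> x)"

lemma pairing_eqI:
  fixes f g :: "'a \<Rightarrow> 'f::comm_ring_1"
  assumes "finite S" and "\<And>x. x \<notin> S \<Longrightarrow> f x = 0" and "\<And>x. x \<notin> S \<Longrightarrow> g x = 0"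
    and "\<And>\<phi>. pairing (\<lambda>c. c) S f \<phi> = pairing (\<lambda>c. c) S g \<phi>"
  shows "f = g"
proof
  fix z
  show "f z = g z"
  proof (cases "z \<in> S")
    case True
    then have "pairing (\<lambda>c. c) S h (\<lambda>x. if x = z then 1 else 0) = h z" for h :: "'a \<Rightarrow> 'f"
      using assms(1) by (simp add: pairing_def if_distrib[of "(*) _"] cong: if_cong)
    then show ?thesis
      using assms(4) by metis
  qed (use assms in simp)
qed

lemma carrier_twisted_group_algebra:
  "f \<in> carrier (twisted_group_algebra base_algebra H \<gamma>) \<longleftrightarrow> (\<forall>x. x \<notin> carrier H \<longrightarrow> f x = 0)"
  by (simp add: twisted_group_algebra_def crossed_product_def base_algebra_def scalar_algebra_def)

lemma twisted_group_algebra_mult: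
  fixes f g :: "'a \<Rightarrow> 'f::field"
  shows "f \<otimes>\<^bsub>twisted_group_algebra base_algebra H \<gamma>\<^esub> g =
     (\<lambda>z. \<Sum>p \<in> {(x, y). x \<in> carrier H \<and> y \<in> carrier H \<and> x \<otimes>\<^bsub>H\<^esub> y = z}.
        f (fst p) * g (snd p) * \<gamma> (fst p) (snd p))"
proof -
  have "finsum base_algebra h P = sum h P" for h :: "'a \<times> 'a \<Rightarrow> 'f" and P
    unfolding base_algebra_def
    by (rule finsum_conv_sum[OF abelian_monoid_scalar_algebra]) (auto simp: scalar_algebra_def)
  then show ?thesis
    by (simp add: twisted_group_algebra_def crossed_product_def) (simp add: base_algebra_def scalar_algebra_def)
qed

lemma twisted_group_algebra_simps:
  "ring.add (twisted_group_algebra base_algebra H \<gamma>) = (+)"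
  "ring.zero (twisted_group_algebra base_algebra H \<gamma>) = 0"
  "monoid.one (twisted_group_algebra base_algebra H \<gamma>) = basis_elem \<one>\<^bsub>H\<^esub>"
  "c \<odot>\<^bsub>twisted_group_algebra base_algebra H \<gamma>\<^esub> f = (\<lambda>x. c * f x)"
  by (auto simp: twisted_group_algebra_def crossed_product_def base_algebra_def scalar_algebra_def
      basis_elem_def fun_eq_iff)

text \<open>A coefficient of a product at z runs over the factorizations of z. Summing over all z
  frees the pair, so the pairing is a double sum without side condition, and identities such as
  associativity reduce to rearranging sums.\<close>

lemma pairing_twisted_mult:
  assumes "field_hom j" and "group H" and "finite (carrier H)"
  shows "pairing j (carrier H) (f \<otimes>\<^bsub>twisted_group_algebra base_algebra H \<gamma>\<^esub> g) \<phi> =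
    (\<Sum>x\<in>carrier H. \<Sum>y\<in>carrier H. j (f x) * j (g y) * j (\<gamma> x y) * \<phi> (x \<otimes>\<^bsub>H\<^esub> y))"
proof -
  interpret j: field_hom j by fact
  interpret group H by fact
  let ?S = "carrier H \<times> carrier H" and ?m = "\<lambda>p. fst p \<otimes>\<^bsub>H\<^esub> snd p"
  let ?t = "\<lambda>p. j (f (fst p)) * j (g (snd p)) * j (\<gamma> (fst p) (snd p)) * \<phi> (?m p)"
  have "pairing j (carrier H) (f \<otimes>\<^bsub>twisted_group_algebra base_algebra H \<gamma>\<^esub> g) \<phi> =
      (\<Sum>z\<in>carrier H. \<Sum>p\<in>{p \<in> ?S. ?m p = z}. ?t p)"
    unfolding pairing_def twisted_group_algebra_mult
    by (intro sum.cong refl) (auto simp: j.hom_sum j.hom_mult sum_distrib_right intro!: sum.cong)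
  also have "\<dots> = sum ?t ?S"
    using assms(3) by (intro sum.group) auto
  finally show ?thesis
    by (simp add: sum.cartesian_product split_def)
qed

lemma field_hom_id: "field_hom (\<lambda>c. c)"
  by unfold_locales auto

locale finite_comm_group_field_hom = comm_group H + emb: field_hom \<iota>
  for H :: "('a, 'x) monoid_scheme" (structure) and \<iota> :: "'f::field_char_0 \<Rightarrow> 'k::field" +
  assumes finite_H: "finite (carrier H)"
begin

abbreviation FH :: "('f, 'a \<Rightarrow> 'f) module" where "FH \<equiv> group_algebra H"

abbreviation ev :: "('a \<Rightarrow> 'k) \<Rightarrow> ('a \<Rightarrow> 'f) \<Rightarrow> 'k" where
  "ev \<chi> x \<equiv> pairing \<iota> (carrier H) x \<chi>"

lemma carrier_FH: "x \<in> carrier FH \<longleftrightarrow> (\<forall>m. m \<notin> carrier H \<longrightarrow> x m = 0)"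
  by (simp add: group_algebra_def carrier_twisted_group_algebra)

lemma FH_simps:
  "ring.add FH = (+)" "ring.zero FH = 0" "monoid.one FH = basis_elem \<one>" "c \<odot>\<^bsub>FH\<^esub> x = (\<lambda>m. c * x m)"
  by (simp_all add: group_algebra_def twisted_group_algebra_simps)

lemma pairing_mult:
  assumes "field_hom j"
  shows "pairing j (carrier H) (x \<otimes>\<^bsub>FH\<^esub> y) \<phi> =
    (\<Sum>a\<in>carrier H. \<Sum>b\<in>carrier H. j (x a) * j (y b) * \<phi> (a \<otimes> b))"
proof -
  interpret j: field_hom j by fact
  show ?thesis
    using pairing_twisted_mult[OF assms is_group finite_H] by (simp add: group_algebra_def)
qed

lemma mult_closed_FH: "x \<otimes>\<^bsub>FH\<^esub> y \<in> carrier FH"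
  unfolding carrier_FH
proof (intro allI impI)
  fix m assume "m \<notin> carrier H"
  then have "{(x, y). x \<in> carrier H \<and> y \<in> carrier H \<and> x \<otimes> y = m} = {}"
    by auto
  then show "(x \<otimes>\<^bsub>FH\<^esub> y) m = 0"
    by (simp only: group_algebra_def twisted_group_algebra_mult) simp
qed

lemma FH_eqI:
  assumes "x \<in> carrier FH" and "y \<in> carrier FH"
    and "\<And>\<phi>. pairing (\<lambda>c. c) (carrier H) x \<phi> = pairing (\<lambda>c. c) (carrier H) y \<phi>"
  shows "x = y"
  using assms pairing_eqI[OF finite_H] unfolding carrier_FH by blast

lemma basis_elem_closed: "n \<in> carrier H \<Longrightarrow> basis_elem n \<in> carrier FH"
  by (auto simp: carrier_FH basis_elem_def)

lemma pairing_basis_elem: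
  assumes "field_hom j" and "n \<in> carrier H"
  shows "pairing j (carrier H) (basis_elem n) \<phi> = \<phi> n"
proof -
  interpret j: field_hom j by fact
  have "j (basis_elem n m) * \<phi> m = (if m = n then \<phi> m else 0)" for m
    by (simp add: basis_elem_def)
  then show ?thesis
    using assms(2) finite_H by (simp add: pairing_def)
qed

lemma pairing_add:
  assumes "field_hom j"
  shows "pairing j (carrier H) (x + y) \<phi> = pairing j (carrier H) x \<phi> + pairing j (carrier H) y \<phi>"
proof -
  interpret j: field_hom j by fact
  show ?thesis
    by (simp add: pairing_def j.hom_add distrib_right sum.distrib)
qed

lemma pairing_mult_eq:
  assumes "field_hom j"
  shows "pairing j (carrier H) (x \<otimes>\<^bsub>FH\<^esub> y) \<phi> =
    (\<Sum>a\<in>carrier H. j (x a) * pairing j (carrier H) y (\<lambda>b. \<phi> (a \<otimes> b)))"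
  unfolding pairing_mult[OF assms] by (simp add: pairing_def sum_distrib_left mult.assoc)

text \<open>A form of Fubini's theorem: for a fixed first factor the product only changes the test
  function of the second, so iterated products turn into iterated pairings.\<close>

lemma pairing_mult_nested:
  assumes "field_hom j"
  shows "pairing j (carrier H) (x \<otimes>\<^bsub>FH\<^esub> y) \<phi> =
    pairing j (carrier H) x (\<lambda>a. pairing j (carrier H) y (\<lambda>b. \<phi> (a \<otimes> b)))"
  by (subst pairing_mult_eq[OF assms]) (simp only: pairing_def[of _ _ x])

lemma FH_mult_comm: "x \<otimes>\<^bsub>FH\<^esub> y = y \<otimes>\<^bsub>FH\<^esub> x"
proof (rule FH_eqI)
  fix \<phi> :: "'a \<Rightarrow> 'f"
  show "pairing (\<lambda>c. c) (carrier H) (x \<otimes>\<^bsub>FH\<^esub> y) \<phi> = pairing (\<lambda>c. c) (carrier H) (y \<otimes>\<^bsub>FH\<^esub> x) \<phi>"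
    unfolding pairing_mult[OF field_hom_id]
    by (subst sum.swap) (auto intro!: sum.cong simp: m_comm mult.commute)
qed (rule mult_closed_FH)+

lemma FH_cring: "cring FH"
proof (rule cringI)
  show "abelian_group FH"
  proof (rule abelian_groupI)
    fix x assume "x \<in> carrier FH"
    then show "\<exists>y\<in>carrier FH. y \<oplus>\<^bsub>FH\<^esub> x = \<zero>\<^bsub>FH\<^esub>"
      by (intro bexI[of _ "- x"]) (auto simp: FH_simps carrier_FH)
  qed (auto simp: FH_simps carrier_FH algebra_simps)
  show "comm_monoid FH"
  proof (rule comm_monoidI)
    fix x y z :: "'a \<Rightarrow> 'f"
    show "x \<otimes>\<^bsub>FH\<^esub> y \<otimes>\<^bsub>FH\<^esub> z = x \<otimes>\<^bsub>FH\<^esub> (y \<otimes>\<^bsub>FH\<^esub> z)"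
    proof (rule FH_eqI)
      fix \<phi> :: "'a \<Rightarrow> 'f"
      let ?P = "pairing (\<lambda>c. c) (carrier H)"
      have "?P (x \<otimes>\<^bsub>FH\<^esub> y \<otimes>\<^bsub>FH\<^esub> z) \<phi> =
          ?P (x \<otimes>\<^bsub>FH\<^esub> y) (\<lambda>d. ?P z (\<lambda>c. \<phi> (d \<otimes> c)))"
        by (rule pairing_mult_nested[OF field_hom_id])
      also have "\<dots> = ?P (x \<otimes>\<^bsub>FH\<^esub> (y \<otimes>\<^bsub>FH\<^esub> z)) \<phi>"
        unfolding pairing_mult_eq[OF field_hom_id] pairing_def[of _ _ y] pairing_def[of _ _ z]
        by (intro sum.cong refl arg_cong2[where f = "(*)"]) (auto simp: m_assoc)
      finally show "pairing (\<lambda>c. c) (carrier H) (x \<otimes>\<^bsub>FH\<^esub> y \<otimes>\<^bsub>FH\<^esub> z) \<phi> =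
          pairing (\<lambda>c. c) (carrier H) (x \<otimes>\<^bsub>FH\<^esub> (y \<otimes>\<^bsub>FH\<^esub> z)) \<phi>" .
    qed (rule mult_closed_FH)+
  next
    fix x assume x: "x \<in> carrier FH"
    show "\<one>\<^bsub>FH\<^esub> \<otimes>\<^bsub>FH\<^esub> x = x"
    proof (rule FH_eqI)
      fix \<phi> :: "'a \<Rightarrow> 'f"
      have "pairing (\<lambda>c. c) (carrier H) (\<one>\<^bsub>FH\<^esub> \<otimes>\<^bsub>FH\<^esub> x) \<phi> =
          pairing (\<lambda>c. c) (carrier H) (basis_elem \<one>) (\<lambda>a. pairing (\<lambda>c. c) (carrier H) x (\<lambda>b. \<phi> (a \<otimes> b)))"
        by (simp only: pairing_mult_nested[OF field_hom_id] FH_simps)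
      also have "\<dots> = pairing (\<lambda>c. c) (carrier H) x \<phi>"
        by (simp add: pairing_basis_elem[OF field_hom_id]) (simp add: pairing_def)
      finally show "pairing (\<lambda>c. c) (carrier H) (\<one>\<^bsub>FH\<^esub> \<otimes>\<^bsub>FH\<^esub> x) \<phi> = pairing (\<lambda>c. c) (carrier H) x \<phi>" .
    qed (use x mult_closed_FH in auto)
  qed (auto simp: FH_simps basis_elem_closed mult_closed_FH FH_mult_comm)
next
  fix x y z
  assume xyz: "x \<in> carrier FH" "y \<in> carrier FH" "z \<in> carrier FH"
  show "(x \<oplus>\<^bsub>FH\<^esub> y) \<otimes>\<^bsub>FH\<^esub> z = x \<otimes>\<^bsub>FH\<^esub> z \<oplus>\<^bsub>FH\<^esub> y \<otimes>\<^bsub>FH\<^esub> z"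
  proof (rule FH_eqI)
    show "x \<otimes>\<^bsub>FH\<^esub> z \<oplus>\<^bsub>FH\<^esub> y \<otimes>\<^bsub>FH\<^esub> z \<in> carrier FH"
      using mult_closed_FH[unfolded carrier_FH] by (simp add: FH_simps carrier_FH)
  next
    fix \<phi> :: "'a \<Rightarrow> 'f"
    show "pairing (\<lambda>c. c) (carrier H) ((x \<oplus>\<^bsub>FH\<^esub> y) \<otimes>\<^bsub>FH\<^esub> z) \<phi> =
        pairing (\<lambda>c. c) (carrier H) (x \<otimes>\<^bsub>FH\<^esub> z \<oplus>\<^bsub>FH\<^esub> y \<otimes>\<^bsub>FH\<^esub> z) \<phi>"
      by (simp add: FH_simps pairing_add[OF field_hom_id] pairing_mult_eq[OF field_hom_id]
          distrib_right sum.distrib)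
  qed (rule mult_closed_FH)
qed

sublocale FH: cring FH
  by (rule FH_cring)

lemma finsum_FH: "f \<in> A \<rightarrow> carrier FH \<Longrightarrow> finsum FH f A = sum f A"
  by (rule finsum_conv_sum[OF FH.abelian_monoid_axioms]) (simp_all add: FH_simps)

end

section \<open>Blocks of linear characters\<close>

text \<open>Extending \<open>S\<close> to a basis of the span of \<open>T\<close> adds nothing,
  because independent sets in that span have at most \<open>card T\<close> elements. This is what
  makes an injective linear map of a finite-dimensional space to itself surjective.\<close>

lemma (in vector_space) span_subset_of_card_le:
  assumes "finite T" and "independent S" and "S \<subseteq> span T" and "card T \<le> card S"
  shows "span T \<subseteq> span S"
proof -
  obtain B where B: "S \<subseteq> B" "B \<subseteq> span T" "independent B" "span T \<subseteq> span B"
    using maximal_independent_subset_extend[OF assms(3,2)] by blast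
  have "finite B" and "card B \<le> card T"
    using independent_span_bound[OF assms(1) B(3,2)] by auto
  then have "S = B"
    using B(1) assms(4) by (intro card_seteq) auto
  then show ?thesis
    using B(4) by simp
qed

context finite_comm_group_field_hom
begin

text \<open>In contrast to \<open>linear_characters\<close>, values outside the group are left free,
  so that the notion survives composition with an automorphism.\<close>

definition nonzero_character :: "('a \<Rightarrow> 'k) \<Rightarrow> bool" where
  "nonzero_character \<chi> \<longleftrightarrow> (\<forall>x\<in>carrier H. \<chi> x \<noteq> 0) \<and>
     (\<forall>x\<in>carrier H. \<forall>y\<in>carrier H. \<chi> (x \<otimes> y) = \<chi> x * \<chi> y)"

lemma linear_characters_nonzero: "\<chi> \<in> linear_characters H \<Longrightarrow> nonzero_character \<chi>"
  by (simp add: linear_characters_def nonzero_character_def)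

lemma character_nonzero: "nonzero_character \<chi> \<Longrightarrow> x \<in> carrier H \<Longrightarrow> \<chi> x \<noteq> 0"
  by (simp add: nonzero_character_def)

lemma character_mult:
  "nonzero_character \<chi> \<Longrightarrow> x \<in> carrier H \<Longrightarrow> y \<in> carrier H \<Longrightarrow> \<chi> (x \<otimes> y) = \<chi> x * \<chi> y"
  by (simp add: nonzero_character_def)

lemma character_one:
  assumes "nonzero_character \<chi>" shows "\<chi> \<one> = 1"
  using character_mult[OF assms one_closed one_closed] character_nonzero[OF assms one_closed] by simp

lemma character_inv:
  assumes "nonzero_character \<chi>" and "x \<in> carrier H"
  shows "\<chi> x * \<chi> (inv x) = 1"
  using assms(2) character_mult[OF assms, of "inv x"] character_one[OF assms(1)] by simp

lemma ev_mult:
  assumes "nonzero_character \<chi>"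
  shows "ev \<chi> (x \<otimes>\<^bsub>FH\<^esub> y) = ev \<chi> x * ev \<chi> y"
  unfolding pairing_mult[OF emb.field_hom_axioms]
  by (simp add: pairing_def sum_product character_mult[OF assms] mult_ac)

lemma ev_add: "ev \<chi> (x + y) = ev \<chi> x + ev \<chi> y"
  by (rule pairing_add[OF emb.field_hom_axioms])

lemma ev_zero: "ev \<chi> 0 = 0"
  by (simp add: pairing_def)

lemma ev_diff: "ev \<chi> (x - y) = ev \<chi> x - ev \<chi> y"
  using ev_add[of "x - y" y \<chi>] by simp

lemma ev_smult: "ev \<chi> (\<lambda>m. c * x m) = \<iota> c * ev \<chi> x"
  by (simp add: pairing_def emb.hom_mult sum_distrib_left mult.assoc)

lemma ev_sum: "ev \<chi> (sum f I) = (\<Sum>i\<in>I. ev \<chi> (f i))"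
  by (induction I rule: infinite_finite_induct) (simp_all only: sum.infinite sum.empty sum.insert not_False_eq_True ev_zero ev_add)

lemma ev_basis_elem: "n \<in> carrier H \<Longrightarrow> ev \<chi> (basis_elem n) = \<chi> n"
  by (rule pairing_basis_elem[OF emb.field_hom_axioms])

lemma ev_one: "nonzero_character \<chi> \<Longrightarrow> ev \<chi> \<one>\<^bsub>FH\<^esub> = 1"
  by (simp add: FH_simps ev_basis_elem character_one)

lemma FH_sum_closed: "(\<And>i. i \<in> I \<Longrightarrow> f i \<in> carrier FH) \<Longrightarrow> sum f I \<in> carrier FH"
  by (induction I rule: infinite_finite_induct) (auto simp: carrier_FH)

lemma FH_smult_closed: "x \<in> carrier FH \<Longrightarrow> (\<lambda>m. c * x m) \<in> carrier FH"
  by (simp add: carrier_FH)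

lemma FH_add_closed: "x \<in> carrier FH \<Longrightarrow> y \<in> carrier FH \<Longrightarrow> x + y \<in> carrier FH"
  by (simp add: carrier_FH)

lemma FH_diff_closed: "x \<in> carrier FH \<Longrightarrow> y \<in> carrier FH \<Longrightarrow> x - y \<in> carrier FH"
  by (simp add: carrier_FH)

lemma FH_mult_apply:
  assumes "z \<in> carrier H"
  shows "(x \<otimes>\<^bsub>FH\<^esub> y) z = (\<Sum>k\<in>carrier H. x k * y (inv k \<otimes> z))"
proof -
  let ?d = "\<lambda>m. if m = z then 1 else 0 :: 'f"
  have d: "pairing (\<lambda>c. c) (carrier H) w (\<lambda>m. if m = n then 1 else 0) = w n"
    if "n \<in> carrier H" for n and w :: "'a \<Rightarrow> 'f"
    using that finite_H by (simp add: pairing_def if_distrib[of "(*) _"] cong: if_cong)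
  have "(x \<otimes>\<^bsub>FH\<^esub> y) z = pairing (\<lambda>c. c) (carrier H) (x \<otimes>\<^bsub>FH\<^esub> y) ?d"
    by (rule d[OF assms, symmetric])
  also have "\<dots> = (\<Sum>k\<in>carrier H. x k * pairing (\<lambda>c. c) (carrier H) y (\<lambda>b. ?d (k \<otimes> b)))"
    by (rule pairing_mult_eq[OF field_hom_id])
  also have "\<dots> = (\<Sum>k\<in>carrier H. x k * pairing (\<lambda>c. c) (carrier H) y (\<lambda>b. if b = inv k \<otimes> z then 1 else 0))"
    unfolding pairing_def using assms
    by (intro sum.cong refl arg_cong2[where f = "(*)"] if_cong) (auto simp: inv_solve_left m_assoc[symmetric])
  also have "\<dots> = (\<Sum>k\<in>carrier H. x k * y (inv k \<otimes> z))"
    using assms by (intro sum.cong refl) (simp add: d)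
  finally show ?thesis .
qed

section \<open>The field F(\<chi>) as the F-span of the values of \<chi>\<close>

sublocale kv: vector_space "\<lambda>c y. \<iota> c * y"
  by unfold_locales (simp_all add: algebra_simps emb.hom_add emb.hom_mult)

lemma ev_image_eq_span: "ev \<chi> ` carrier FH = kv.span (\<chi> ` carrier H)"
proof
  show "ev \<chi> ` carrier FH \<subseteq> kv.span (\<chi> ` carrier H)"
    unfolding pairing_def
    by (rule image_subsetI) (rule kv.span_sum, rule kv.span_scale, rule kv.span_base, rule imageI)
  have "kv.subspace (ev \<chi> ` carrier FH)"
  proof (rule kv.subspaceI)
    show "0 \<in> ev \<chi> ` carrier FH"
      using ev_zero by (intro image_eqI[of _ _ 0]) (simp_all add: carrier_FH)
    fix u v c assume u: "u \<in> ev \<chi> ` carrier FH"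
    then show "\<iota> c * u \<in> ev \<chi> ` carrier FH"
      using FH_smult_closed by (auto simp: ev_smult[symmetric])
    assume "v \<in> ev \<chi> ` carrier FH"
    then show "u + v \<in> ev \<chi> ` carrier FH"
      using u FH_add_closed by (auto simp: ev_add[symmetric])
  qed
  then show "kv.span (\<chi> ` carrier H) \<subseteq> ev \<chi> ` carrier FH"
    using basis_elem_closed by (intro kv.span_minimal) (auto simp: ev_basis_elem[symmetric])
qed

lemma ev_image_mult:
  assumes "nonzero_character \<chi>" and "u \<in> ev \<chi> ` carrier FH" and "v \<in> ev \<chi> ` carrier FH"
  shows "u * v \<in> ev \<chi> ` carrier FH"
  using assms(2,3) mult_closed_FH by (auto simp: ev_mult[OF assms(1), symmetric])

lemma obtain_character_basis:
  obtains B where "B \<subseteq> \<chi> ` carrier H" and "finite B" and "kv.independent B"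
    and "kv.span B = kv.span (\<chi> ` carrier H)"
proof -
  obtain B where B: "B \<subseteq> \<chi> ` carrier H" "kv.independent B" "\<chi> ` carrier H \<subseteq> kv.span B"
    using kv.maximal_independent_subset by blast
  then have "kv.span B = kv.span (\<chi> ` carrier H)"
    using kv.span_superset[of "\<chi> ` carrier H"] unfolding kv.span_eq by blast
  moreover have "finite B"
    using B(1) finite_H finite_subset by blast
  ultimately show ?thesis
    using B that by blast
qed

text \<open>Multiplication by y is injective on the finite-dimensional space in question, hence surjective.\<close>

lemma ev_image_inverse:
  assumes "nonzero_character \<chi>" and "y \<in> ev \<chi> ` carrier FH" and "y \<noteq> 0"
  shows "inverse y \<in> ev \<chi> ` carrier FH"
proof -
  obtain B where B: "B \<subseteq> \<chi> ` carrier H" "finite B" "kv.independent B"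
    and "kv.span B = kv.span (\<chi> ` carrier H)"
    by (rule obtain_character_basis)
  then have span_B: "kv.span B = ev \<chi> ` carrier FH"
    by (simp add: ev_image_eq_span)
  let ?S = "(*) y ` B"
  have inj: "inj_on ((*) y) B"
    using assms(3) by (auto simp: inj_on_def)
  have "kv.independent ?S"
  proof (rule kv.independent_if_scalars_zero)
    fix f x assume sum: "(\<Sum>x\<in>?S. \<iota> (f x) * x) = 0" and "x \<in> ?S"
    then obtain b where b: "b \<in> B" "x = y * b"
      by blast
    have "y * (\<Sum>b\<in>B. \<iota> (f (y * b)) * b) = 0"
      using sum unfolding sum.reindex[OF inj] sum_distrib_left o_def by (simp only: mult.left_commute)
    then have "(\<Sum>b\<in>B. \<iota> (f (y * b)) * b) = 0"
      using assms(3) by (simp only: mult_eq_0_iff) simp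
    from kv.independentD[OF B(3,2) order_refl this b(1)] show "f x = 0"
      by (simp only: b(2))
  qed (use B in simp)
  moreover have "?S \<subseteq> kv.span B"
  proof (rule image_subsetI)
    fix b assume "b \<in> B"
    then have "b \<in> ev \<chi> ` carrier FH"
      using span_B kv.span_base by metis
    then show "y * b \<in> kv.span B"
      unfolding span_B by (rule ev_image_mult[OF assms(1,2)])
  qed
  moreover have "card B \<le> card ?S"
    using inj by (simp add: card_image)
  ultimately have "kv.span B \<subseteq> kv.span ?S"
    by (rule kv.span_subset_of_card_le[OF B(2)])
  moreover have "1 \<in> kv.span B"
    using ev_one[OF assms(1)] FH.one_closed unfolding span_B by (metis image_eqI)
  ultimately have "1 \<in> range (\<lambda>u. \<Sum>v\<in>?S. \<iota> (u v) * v)"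
    using B(2) by (simp add: kv.span_finite subset_iff)
  then obtain u where "1 = (\<Sum>v\<in>?S. \<iota> (u v) * v)"
    by blast
  then have "y * (\<Sum>b\<in>B. \<iota> (u (y * b)) * b) = 1"
    unfolding sum.reindex[OF inj] sum_distrib_left o_def by (simp only: mult.left_commute)
  then have "inverse y = (\<Sum>b\<in>B. \<iota> (u (y * b)) * b)"
    using inverse_unique by blast
  also have "\<dots> \<in> kv.span B"
    by (intro kv.span_sum kv.span_scale kv.span_base)
  finally show ?thesis
    using span_B by simp
qed

text \<open>The F-span of the values is closed under products because \<open>\<chi>\<close> is
  multiplicative, and under inverses by \<open>ev_image_inverse\<close>. Hence the ring generated by
  the values is already the field F(\<chi>).\<close>

lemma generate_field_eq_ev_image:
  assumes "nonzero_character \<chi>"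
  shows "generate_field class_ring (range \<iota> \<union> \<chi> ` carrier H) = ev \<chi> ` carrier FH"
proof
  let ?G = "generate_field class_ring (range \<iota> \<union> \<chi> ` carrier H)"
  have "kv.subspace ?G"
  proof (rule kv.subspaceI)
    show "0 \<in> ?G"
      using generate_field.incl[of 0 "range \<iota> \<union> \<chi> ` carrier H" class_ring] by force
    show "u + v \<in> ?G" if "u \<in> ?G" "v \<in> ?G" for u v
      using generate_field.eng_add[OF that] by simp
    show "\<iota> c * u \<in> ?G" if "u \<in> ?G" for u c
      using generate_field.eng_mult[OF generate_field.incl that, of "\<iota> c"] by simp
  qed
  then have "kv.span (\<chi> ` carrier H) \<subseteq> ?G"
    by (intro kv.span_minimal) (auto intro: generate_field.incl)
  then show "ev \<chi> ` carrier FH \<subseteq> ?G"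
    by (simp add: ev_image_eq_span)
  show "?G \<subseteq> ev \<chi> ` carrier FH"
  proof
    fix h assume "h \<in> ?G"
    then show "h \<in> ev \<chi> ` carrier FH"
    proof (induction h rule: generate_field.induct)
      case one
      then show ?case
        using ev_one[OF assms] FH.one_closed by (auto intro!: image_eqI[of _ _ "\<one>\<^bsub>FH\<^esub>"])
    next
      case (incl h)
      then show ?case
      proof
        assume "h \<in> range \<iota>"
        then obtain c where "h = \<iota> c"
          by blast
        then have "h = ev \<chi> (\<lambda>m. c * \<one>\<^bsub>FH\<^esub> m)"
          by (simp add: ev_smult ev_one[OF assms])
        then show ?thesis
          using FH_smult_closed[OF FH.one_closed] by blast
      next
        assume "h \<in> \<chi> ` carrier H"
        then show ?thesis
          using basis_elem_closed by (auto simp: ev_basis_elem[symmetric])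
      qed
    next
      case (a_inv h)
      then obtain x where "h = ev \<chi> x" "x \<in> carrier FH"
        by blast
      then have "\<ominus>\<^bsub>class_ring\<^esub> h = ev \<chi> (0 - x)" "0 - x \<in> carrier FH"
        by (simp_all add: class_ring_simps ev_diff ev_zero carrier_FH del: diff_0)
      then show ?case
        by blast
    next
      case (m_inv h)
      then show ?case
        using ev_image_inverse[OF assms] by (simp add: class_ring_simps)
    next
      case (eng_add h1 h2)
      then show ?case
        using FH_add_closed by (auto simp: ev_add[symmetric])
    next
      case (eng_mult h1 h2)
      then show ?case
        using ev_image_mult[OF assms] by simp
    qed
  qed
qed

lemma character_field_eq:
  "nonzero_character \<chi> \<Longrightarrow> character_field \<iota> H \<chi> = scalar_algebra \<iota> (ev \<chi> ` carrier FH)"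
  by (simp add: character_field_def generate_field_eq_ev_image)

text \<open>The second and third conditions say that the ideal generated by \<open>e\<close> is a
  complement of the kernel of evaluation. Primitivity and the isomorphism with F(\<chi>) are
  consequences, and conditions of this kind are easily moved along automorphisms.\<close>

definition block_idempotent :: "('a \<Rightarrow> 'k) \<Rightarrow> ('a \<Rightarrow> 'f) \<Rightarrow> bool" where
  "block_idempotent \<chi> e \<longleftrightarrow> e \<in> carrier FH \<and> ev \<chi> e = 1 \<and>
     (\<forall>x\<in>carrier FH. ev \<chi> x = 0 \<longrightarrow> x \<otimes>\<^bsub>FH\<^esub> e = 0)"

text \<open>
  Averaging an F-linear section s of the evaluation at \<open>\<chi>\<close> over the group gives the idempotent
  \<open>|H|\<^sup>-\<^sup>1 \<Sum>\<^sub>n n s(\<chi>(n\<^sup>-\<^sup>1))\<close>, as in the proof of Maschke's theorem. The section is given by the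
  coordinates with respect to a basis B consisting of values \<open>\<chi> (r b) = b\<close>.
\<close>

lemma block_idempotent_exists:
  assumes \<chi>: "nonzero_character \<chi>"
  shows "\<exists>e. block_idempotent \<chi> e"
proof -
  obtain B where B: "B \<subseteq> \<chi> ` carrier H" "finite B" "kv.independent B"
    and span_B: "kv.span B = kv.span (\<chi> ` carrier H)"
    by (rule obtain_character_basis)
  have "\<forall>b\<in>B. \<exists>h. h \<in> carrier H \<and> \<chi> h = b"
    using B(1) by blast
  then obtain r where r: "\<And>b. b \<in> B \<Longrightarrow> r b \<in> carrier H" "\<And>b. b \<in> B \<Longrightarrow> \<chi> (r b) = b"
    by (auto dest!: bchoice)
  define s where "s = kv.representation B"
  let ?c = "inverse (of_nat (card (carrier H))) :: 'f"
  have c: "?c * of_nat (card (carrier H)) = 1"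
    using finite_H one_closed card_gt_0_iff[of "carrier H"] by (intro left_inverse) auto
  \<comment> \<open>The section lifts \<open>b\<close> to the group element \<open>r b\<close>. In
    the average of the n s(\<chi>(inv n)) each \<open>b\<close> therefore contributes to the
    coefficient at \<open>m\<close> through the single n with n (r b) = m, which is
    \<open>m \<otimes> inv (r b)\<close>.\<close>
  define e where "e = (\<lambda>m. if m \<in> carrier H
      then ?c * (\<Sum>b\<in>B. s (\<chi> (inv (m \<otimes> inv (r b)))) b) else 0)"
  have in_span: "\<chi> x \<in> kv.span B" if "x \<in> carrier H" for x
    using that by (simp add: span_B kv.span_base)
  have s_sum: "(\<Sum>b\<in>B. \<iota> (s (\<chi> x) b) * b) = \<chi> x" if "x \<in> carrier H" for x
    unfolding s_def by (rule kv.sum_representation_eq[OF B(3) in_span[OF that] B(2) order_refl])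
  have s_scale: "s (\<iota> a * \<chi> x) b = a * s (\<chi> x) b" if "x \<in> carrier H" for x a b
    unfolding s_def kv.representation_scale[OF B(3) in_span[OF that]] ..
  have s_lin: "s (\<Sum>k\<in>carrier H. \<iota> (x k) * \<chi> (k \<otimes> w)) b = (\<Sum>k\<in>carrier H. s (\<iota> (x k) * \<chi> (k \<otimes> w)) b)"
    if "w \<in> carrier H" for x w b
    unfolding s_def using that by (subst kv.representation_sum[OF B(3)]) (auto intro: kv.span_scale in_span)
  have s_zero: "s 0 b = 0" for b
    by (simp add: s_def kv.representation_zero)
  have "e \<in> carrier FH"
    by (simp add: carrier_FH e_def)
  moreover have "ev \<chi> e = 1"
  proof -
    have "ev \<chi> e = (\<Sum>m\<in>carrier H. \<iota> ?c * (\<Sum>b\<in>B. \<iota> (s (\<chi> (inv (m \<otimes> inv (r b)))) b) * \<chi> m))"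
      unfolding pairing_def e_def
      by (intro sum.cong refl) (simp add: emb.hom_mult emb.hom_sum sum_distrib_left sum_distrib_right mult_ac)
    also have "\<dots> = \<iota> ?c * (\<Sum>b\<in>B. \<Sum>m\<in>carrier H. \<iota> (s (\<chi> (inv (m \<otimes> inv (r b)))) b) * \<chi> m)"
      by (simp add: sum_distrib_left sum.swap[of _ "carrier H" B])
    also have "(\<Sum>b\<in>B. \<Sum>m\<in>carrier H. \<iota> (s (\<chi> (inv (m \<otimes> inv (r b)))) b) * \<chi> m) =
        (\<Sum>b\<in>B. \<Sum>n\<in>carrier H. \<iota> (s (\<chi> (inv n)) b) * (\<chi> n * b))"
    proof (rule sum.cong[OF refl])
      fix b assume b: "b \<in> B"
      \<comment> \<open>As \<open>r b\<close> has value \<open>b\<close>, substituting n for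
        \<open>m \<otimes> inv (r b)\<close> splits off a factor \<open>b\<close>. The sum over
        \<open>b\<close> then rebuilds \<chi>(inv n) from its coordinates, so that every n
        contributes \<chi>(n) \<chi>(inv n) = 1.\<close>
      have key: "\<chi> (a \<otimes> inv (r b)) * b = \<chi> a" if "a \<in> carrier H" for a
        using that r[OF b] character_mult[OF \<chi>, of "a \<otimes> inv (r b)" "r b"] by (simp add: m_assoc)
      show "(\<Sum>m\<in>carrier H. \<iota> (s (\<chi> (inv (m \<otimes> inv (r b)))) b) * \<chi> m) =
          (\<Sum>n\<in>carrier H. \<iota> (s (\<chi> (inv n)) b) * (\<chi> n * b))"
        by (rule sum.reindex_bij_witness[where i = "\<lambda>n. n \<otimes> r b" and j = "\<lambda>m. m \<otimes> inv (r b)"])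
          (use r[OF b] key in \<open>auto simp: m_assoc\<close>)
    qed
    also have "\<dots> = (\<Sum>n\<in>carrier H. \<chi> n * (\<Sum>b\<in>B. \<iota> (s (\<chi> (inv n)) b) * b))"
      by (simp add: sum_distrib_left sum.swap[of _ "carrier H" B] mult_ac)
    also have "\<dots> = (\<Sum>n\<in>carrier H. 1)"
      by (intro sum.cong refl)
        (simp add: s_sum character_inv[OF \<chi>])
    finally show ?thesis
      using arg_cong[OF c, of \<iota>] by (simp add: emb.hom_mult emb.hom_of_nat)
  qed
  moreover have "x \<otimes>\<^bsub>FH\<^esub> e = 0" if x: "x \<in> carrier FH" "ev \<chi> x = 0" for x
  proof
    fix z
    show "(x \<otimes>\<^bsub>FH\<^esub> e) z = 0 z"
    proof (cases "z \<in> carrier H")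
      case z: True
      have "(x \<otimes>\<^bsub>FH\<^esub> e) z =
          (\<Sum>k\<in>carrier H. ?c * (\<Sum>b\<in>B. x k * s (\<chi> (inv (inv k \<otimes> z \<otimes> inv (r b)))) b))"
        using z by (simp add: FH_mult_apply e_def sum_distrib_left mult_ac cong: sum.cong)
      also have "\<dots> = ?c * (\<Sum>b\<in>B. \<Sum>k\<in>carrier H. x k * s (\<chi> (inv (inv k \<otimes> z \<otimes> inv (r b)))) b)"
        by (simp add: sum_distrib_left sum.swap[of _ "carrier H" B])
      also have "(\<Sum>b\<in>B. \<Sum>k\<in>carrier H. x k * s (\<chi> (inv (inv k \<otimes> z \<otimes> inv (r b)))) b) = 0"
      proof (rule sum.neutral, rule ballI)
        fix b assume b: "b \<in> B"
        \<comment> \<open>\<open>w\<close> collects what does not depend on \<open>k\<close>.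
          Coordinates are F-linear, so the sum over \<open>k\<close> moves inside them and becomes
          \<open>ev \<chi> x * \<chi> w\<close>, which vanishes.\<close>
        define w where "w = inv z \<otimes> r b"
        have w: "w \<in> carrier H"
          using b z r by (simp add: w_def)
        have "inv (inv k \<otimes> z \<otimes> inv (r b)) = k \<otimes> w" if "k \<in> carrier H" for k
          using that b z r by (simp add: w_def inv_mult_group m_ac)
        then have "(\<Sum>k\<in>carrier H. x k * s (\<chi> (inv (inv k \<otimes> z \<otimes> inv (r b)))) b) =
            (\<Sum>k\<in>carrier H. s (\<iota> (x k) * \<chi> (k \<otimes> w)) b)"
          using w by (intro sum.cong refl) (simp add: s_scale)
        also have "\<dots> = s (\<Sum>k\<in>carrier H. \<iota> (x k) * \<chi> (k \<otimes> w)) b"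
          by (rule s_lin[OF w, symmetric])
        also have "(\<Sum>k\<in>carrier H. \<iota> (x k) * \<chi> (k \<otimes> w)) = ev \<chi> x * \<chi> w"
          using w by (simp add: pairing_def sum_distrib_right character_mult[OF \<chi>] mult.assoc)
        finally show "(\<Sum>k\<in>carrier H. x k * s (\<chi> (inv (inv k \<otimes> z \<otimes> inv (r b)))) b) = 0"
          by (simp add: x(2) s_zero)
      qed
      finally show ?thesis
        by simp
    qed (use mult_closed_FH[unfolded carrier_FH] in simp)
  qed
  ultimately show ?thesis
    unfolding block_idempotent_def by blast
qed

end

lemma corner_simps:
  "carrier (corner R e) = (\<lambda>x. x \<otimes>\<^bsub>R\<^esub> e) ` carrier R"
  "monoid.mult (corner R e) = monoid.mult R"
  "monoid.one (corner R e) = e"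
  "ring.zero (corner R e) = ring.zero R"
  "ring.add (corner R e) = ring.add R"
  "module.smult (corner R e) = module.smult R"
  by (simp_all add: corner_def)

lemma scalar_algebra_simps:
  "carrier (scalar_algebra j A) = A"
  "monoid.mult (scalar_algebra j A) = (*)"
  "monoid.one (scalar_algebra j A) = 1"
  "ring.zero (scalar_algebra j A) = 0"
  "ring.add (scalar_algebra j A) = (+)"
  "c \<odot>\<^bsub>scalar_algebra j A\<^esub> x = j c * x"
  by (simp_all add: scalar_algebra_def)

context finite_comm_group_field_hom
begin

section \<open>Uniqueness and primitivity of block idempotents\<close>

lemma FH_diff_mult:
  assumes "x \<in> carrier FH" and "y \<in> carrier FH" and "z \<in> carrier FH"
  shows "(x - y) \<otimes>\<^bsub>FH\<^esub> z = x \<otimes>\<^bsub>FH\<^esub> z - y \<otimes>\<^bsub>FH\<^esub> z"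
proof -
  have "(x - y) \<otimes>\<^bsub>FH\<^esub> z \<oplus>\<^bsub>FH\<^esub> y \<otimes>\<^bsub>FH\<^esub> z = ((x - y) \<oplus>\<^bsub>FH\<^esub> y) \<otimes>\<^bsub>FH\<^esub> z"
    using assms by (simp add: FH.l_distr FH_diff_closed)
  then show ?thesis
    by (simp add: FH_simps algebra_simps)
qed

lemma FH_smult_mult: "(\<lambda>m. c * x m) \<otimes>\<^bsub>FH\<^esub> y = (\<lambda>m. c * (x \<otimes>\<^bsub>FH\<^esub> y) m)"
proof (rule FH_eqI)
  have s: "pairing (\<lambda>c. c) (carrier H) (\<lambda>m. c * w m) \<phi> = c * pairing (\<lambda>c. c) (carrier H) w \<phi>"
    for w \<phi>
    by (simp add: pairing_def sum_distrib_left mult.assoc)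
  show "pairing (\<lambda>c. c) (carrier H) ((\<lambda>m. c * x m) \<otimes>\<^bsub>FH\<^esub> y) \<phi> =
      pairing (\<lambda>c. c) (carrier H) (\<lambda>m. c * (x \<otimes>\<^bsub>FH\<^esub> y) m) \<phi>" for \<phi>
    unfolding s pairing_mult[OF field_hom_id] by (simp add: sum_distrib_left mult.assoc)
qed (auto intro: mult_closed_FH FH_smult_closed)

lemma FH_sum_mult:
  assumes "\<And>i. i \<in> I \<Longrightarrow> f i \<in> carrier FH" and "x \<in> carrier FH"
  shows "sum f I \<otimes>\<^bsub>FH\<^esub> x = (\<Sum>i\<in>I. f i \<otimes>\<^bsub>FH\<^esub> x)"
  using assms(1)
proof (induction I rule: infinite_finite_induct)
  case (insert i F)
  have "f i \<in> carrier FH" "sum f F \<in> carrier FH"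
    using insert by (auto intro: FH_sum_closed)
  then show ?case
    using insert FH.l_distr[OF _ _ assms(2), of "f i" "sum f F"]
    by (simp only: FH_simps sum.insert insertI2 not_False_eq_True)
qed (use FH.l_null[OF assms(2)] in \<open>simp_all only: FH_simps sum.infinite sum.empty not_False_eq_True\<close>)

text \<open>In a crossed product over a corner, both coefficients and the twisting carry the
  idempotent \<open>u\<close>. The three copies merge into one, which makes cutting by
  \<open>u\<close> compatible with multiplication.\<close>

lemma idempotent_absorb:
  assumes "a \<in> carrier FH" "b \<in> carrier FH" "w \<in> carrier FH" "u \<in> carrier FH" "u \<otimes>\<^bsub>FH\<^esub> u = u"
  shows "(a \<otimes>\<^bsub>FH\<^esub> u) \<otimes>\<^bsub>FH\<^esub> (b \<otimes>\<^bsub>FH\<^esub> u) \<otimes>\<^bsub>FH\<^esub> (u \<otimes>\<^bsub>FH\<^esub> w) = (a \<otimes>\<^bsub>FH\<^esub> b \<otimes>\<^bsub>FH\<^esub> w) \<otimes>\<^bsub>FH\<^esub> u"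
proof -
  have "(a \<otimes>\<^bsub>FH\<^esub> u) \<otimes>\<^bsub>FH\<^esub> (b \<otimes>\<^bsub>FH\<^esub> u) \<otimes>\<^bsub>FH\<^esub> (u \<otimes>\<^bsub>FH\<^esub> w) =
      (a \<otimes>\<^bsub>FH\<^esub> b \<otimes>\<^bsub>FH\<^esub> w) \<otimes>\<^bsub>FH\<^esub> (u \<otimes>\<^bsub>FH\<^esub> u \<otimes>\<^bsub>FH\<^esub> u)"
    using assms(1-4) by (simp add: FH.m_ac)
  then show ?thesis
    by (simp only: assms(5))
qed

lemma FH_expand:
  assumes "x \<in> carrier FH"
  shows "x = (\<Sum>n\<in>carrier H. (\<lambda>m. x n * basis_elem n m))"
proof
  fix z
  have sum_apply: "(\<Sum>n\<in>A. g n) z = (\<Sum>n\<in>A. g n z)" for A and g :: "'a \<Rightarrow> 'a \<Rightarrow> 'f"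
    by (induction A rule: infinite_finite_induct) simp_all
  show "x z = (\<Sum>n\<in>carrier H. (\<lambda>m. x n * basis_elem n m)) z"
    using assms finite_H
    by (simp add: sum_apply basis_elem_def if_distrib[of "(*) _"] carrier_FH eq_commute[of z] cong: if_cong)
qed

text \<open>Linear maps are determined on the group. Linearity of \<open>\<psi>\<close> is asked for
  on the carrier only, since \<open>\<psi>\<close> will be built from an arbitrary isomorphism of a
  corner.\<close>

lemma FH_linear_ext:
  assumes add: "\<And>x y. x \<in> carrier FH \<Longrightarrow> y \<in> carrier FH \<Longrightarrow> \<psi> (x + y) = \<psi> x + \<psi> y"
    and smult: "\<And>c x. x \<in> carrier FH \<Longrightarrow> \<psi> (\<lambda>m. c * x m) = \<iota> c * \<psi> x"
    and basis: "\<And>n. n \<in> carrier H \<Longrightarrow> \<psi> (basis_elem n) = \<chi> n"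
    and x: "x \<in> carrier FH"
  shows "\<psi> x = ev \<chi> x"
proof -
  have zero: "\<psi> 0 = 0"
  proof -
    have "0 \<in> carrier FH"
      by (simp add: carrier_FH)
    then have "\<psi> (0 + 0) = \<psi> 0 + \<psi> 0"
      by (intro add)
    then show ?thesis
      by (metis add_cancel_right_right)
  qed
  have closed: "(\<lambda>m. x n * basis_elem n m) \<in> carrier FH" if "n \<in> carrier H" for n
    using that by (intro FH_smult_closed basis_elem_closed)
  have "F \<subseteq> carrier H \<Longrightarrow> \<psi> (\<Sum>n\<in>F. (\<lambda>m. x n * basis_elem n m)) = (\<Sum>n\<in>F. \<iota> (x n) * \<chi> n)"
    if "finite F" for F
    using that
  proof (induction F rule: finite_induct)
    case empty
    then show ?case
      by (simp only: sum.empty zero)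
  next
    case (insert a F)
    have "\<psi> (\<Sum>n\<in>insert a F. (\<lambda>m. x n * basis_elem n m)) =
        \<psi> ((\<lambda>m. x a * basis_elem a m) + (\<Sum>n\<in>F. (\<lambda>m. x n * basis_elem n m)))"
      using insert.hyps by (simp only: sum.insert not_False_eq_True)
    also have "\<dots> = \<psi> (\<lambda>m. x a * basis_elem a m) + \<psi> (\<Sum>n\<in>F. (\<lambda>m. x n * basis_elem n m))"
      using insert.prems by (intro add closed FH_sum_closed) auto
    finally show ?case
      using insert
      by (simp only: smult basis basis_elem_closed sum.insert insert_subset simp_thms)
  qed
  from this[OF finite_H order_refl] show ?thesis
    using FH_expand[OF x] by (simp only: pairing_def)
qed

lemma block_idempotentD:
  assumes "block_idempotent \<chi> e"
  shows "e \<in> carrier FH" and "ev \<chi> e = 1"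
    and "\<And>x. x \<in> carrier FH \<Longrightarrow> ev \<chi> x = 0 \<Longrightarrow> x \<otimes>\<^bsub>FH\<^esub> e = 0"
  using assms by (auto simp: block_idempotent_def)

text \<open>Because \<open>e\<close> has value 1, multiplying by it leaves the evaluation unchanged,
  so nothing outside the kernel is killed. Equality inside the block can thus be tested in
  K.\<close>

lemma block_mult_eq_zero_iff:
  assumes "nonzero_character \<chi>" and "block_idempotent \<chi> e" and "x \<in> carrier FH"
  shows "x \<otimes>\<^bsub>FH\<^esub> e = 0 \<longleftrightarrow> ev \<chi> x = 0"
  using block_idempotentD[OF assms(2)] assms(3) ev_mult[OF assms(1), of x e] by (auto simp: ev_zero)

lemma block_mult_eq_iff:
  assumes "nonzero_character \<chi>" and "block_idempotent \<chi> e" and "x \<in> carrier FH" and "y \<in> carrier FH"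
  shows "x \<otimes>\<^bsub>FH\<^esub> e = y \<otimes>\<^bsub>FH\<^esub> e \<longleftrightarrow> ev \<chi> x = ev \<chi> y"
  using block_mult_eq_zero_iff[OF assms(1,2) FH_diff_closed[OF assms(3,4)]] assms(3,4)
    block_idempotentD(1)[OF assms(2)] by (simp add: FH_diff_mult ev_diff)

lemma block_mult_eq_self:
  assumes "nonzero_character \<chi>" and "block_idempotent \<chi> e" and "x \<in> carrier FH" and "ev \<chi> x = 1"
  shows "x \<otimes>\<^bsub>FH\<^esub> e = e"
  using block_mult_eq_iff[OF assms(1,2,3) FH.one_closed] assms(4) ev_one[OF assms(1)]
    block_idempotentD(1)[OF assms(2)] by simp

lemma block_idempotent_idem:
  assumes "nonzero_character \<chi>" and "block_idempotent \<chi> e"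
  shows "e \<otimes>\<^bsub>FH\<^esub> e = e"
  by (rule block_mult_eq_self[OF assms block_idempotentD(1,2)[OF assms(2)]])

lemma block_idempotent_nonzero: "block_idempotent \<chi> e \<Longrightarrow> e \<noteq> 0"
  using block_idempotentD(2)[of \<chi> e] ev_zero[of \<chi>] by auto

text \<open>Each idempotent evaluates to 0 or 1 at the other's character. A value 0 gives
  orthogonality; if both values are 1, each idempotent absorbs the other, and the common product
  equals both.\<close>

lemma block_idempotent_eq_or_orthogonal:
  assumes "nonzero_character \<chi>" and "block_idempotent \<chi> e"
    and "nonzero_character \<chi>'" and "block_idempotent \<chi>' e'"
  shows "e \<otimes>\<^bsub>FH\<^esub> e' = 0 \<or> e = e'"
proof -
  note e = block_idempotentD(1)[OF assms(2)] and e' = block_idempotentD(1)[OF assms(4)]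
  have "ev \<chi> e' * ev \<chi> e' = ev \<chi> e'" "ev \<chi>' e * ev \<chi>' e = ev \<chi>' e"
    using block_idempotent_idem[OF assms(1,2)] block_idempotent_idem[OF assms(3,4)]
    by (simp_all add: ev_mult[OF assms(1), symmetric] ev_mult[OF assms(3), symmetric])
  then consider "ev \<chi> e' = 0" | "ev \<chi>' e = 0" | "ev \<chi> e' = 1" "ev \<chi>' e = 1"
    by auto
  then show ?thesis
  proof cases
    case 1
    then show ?thesis
      using block_idempotentD(3)[OF assms(2) e'] FH_mult_comm by metis
  next
    case 2
    then show ?thesis
      using block_idempotentD(3)[OF assms(4) e] by blast
  next
    case 3
    then show ?thesis
      using block_mult_eq_self[OF assms(1,2) e'] block_mult_eq_self[OF assms(3,4) e] FH_mult_comm by metis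
  qed
qed

lemma block_idempotent_unique:
  assumes "nonzero_character \<chi>" and "block_idempotent \<chi> e" and "block_idempotent \<chi> e'"
  shows "e = e'"
  using block_mult_eq_self[OF assms(1,2) block_idempotentD(1,2)[OF assms(3)]]
    block_mult_eq_self[OF assms(1,3) block_idempotentD(1,2)[OF assms(2)]] FH_mult_comm by metis

text \<open>In an orthogonal splitting of \<open>e\<close> both parts lie in the block and would
  have nonzero values, yet the product of these values is 0 in a field.\<close>

lemma block_idempotent_primitive:
  assumes "nonzero_character \<chi>" and "block_idempotent \<chi> e"
  shows "primitive_central_idempotent FH e"
  unfolding primitive_central_idempotent_def
proof (intro conjI notI)
  note e = block_idempotentD[OF assms(2)]
  show "central_idempotent FH e"
    using e(1) block_idempotent_idem[OF assms] FH_mult_comm by (auto simp: central_idempotent_def)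
  show False if "e = \<zero>\<^bsub>FH\<^esub>"
    using that block_idempotent_nonzero[OF assms(2)] by (simp add: FH_simps)
  assume "\<exists>a b. central_idempotent FH a \<and> central_idempotent FH b \<and> a \<noteq> \<zero>\<^bsub>FH\<^esub> \<and> b \<noteq> \<zero>\<^bsub>FH\<^esub> \<and>
      a \<otimes>\<^bsub>FH\<^esub> b = \<zero>\<^bsub>FH\<^esub> \<and> e = a \<oplus>\<^bsub>FH\<^esub> b"
  then obtain a b where ab: "a \<in> carrier FH" "b \<in> carrier FH" "a \<otimes>\<^bsub>FH\<^esub> a = a" "b \<otimes>\<^bsub>FH\<^esub> b = b"
    "a \<noteq> \<zero>\<^bsub>FH\<^esub>" "b \<noteq> \<zero>\<^bsub>FH\<^esub>" "a \<otimes>\<^bsub>FH\<^esub> b = \<zero>\<^bsub>FH\<^esub>" "e = a \<oplus>\<^bsub>FH\<^esub> b"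
    unfolding central_idempotent_def by blast
  have "a \<otimes>\<^bsub>FH\<^esub> e = a" "b \<otimes>\<^bsub>FH\<^esub> e = b"
    using ab(1-4,7,8) by (simp_all add: FH.r_distr FH_mult_comm[of b a])
  then have "ev \<chi> a \<noteq> 0" "ev \<chi> b \<noteq> 0"
    using ab block_mult_eq_zero_iff[OF assms, of a] block_mult_eq_zero_iff[OF assms, of b]
    by (auto simp: FH_simps)
  moreover have "ev \<chi> a * ev \<chi> b = 0"
    using ab(7) by (simp add: ev_mult[OF assms(1), symmetric] FH_simps ev_zero)
  ultimately show False
    by simp
qed

lemma ev_corner_iso:
  assumes "nonzero_character \<chi>" and "block_idempotent \<chi> e"
  shows "ev \<chi> \<in> algebra_iso (corner FH e) (character_field \<iota> H \<chi>)"
proof -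
  note e = block_idempotentD[OF assms(2)]
  have ev: "ev \<chi> (x \<otimes>\<^bsub>FH\<^esub> e) = ev \<chi> x" for x
    by (simp add: ev_mult[OF assms(1)] e(2))
  have "bij_betw (ev \<chi>) ((\<lambda>x. x \<otimes>\<^bsub>FH\<^esub> e) ` carrier FH) (ev \<chi> ` carrier FH)"
    unfolding bij_betw_def
  proof
    show "inj_on (ev \<chi>) ((\<lambda>x. x \<otimes>\<^bsub>FH\<^esub> e) ` carrier FH)"
      by (rule inj_onI) (auto simp: ev block_mult_eq_iff[OF assms])
    show "ev \<chi> ` (\<lambda>x. x \<otimes>\<^bsub>FH\<^esub> e) ` carrier FH = ev \<chi> ` carrier FH"
      by (simp add: image_image ev)
  qed
  then show ?thesis
    unfolding algebra_iso_def character_field_eq[OF assms(1)]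
    by (auto intro!: ring_iso_memI
        simp: corner_simps scalar_algebra_simps FH_simps ev ev_add ev_smult e ev_mult[OF assms(1)])
qed

text \<open>Here the definite description is resolved. For any competitor \<open>e'\<close> with
  isomorphism \<open>\<phi>\<close>, the map sending x to \<open>\<phi>\<close> of x e' is linear
  and equals \<open>\<chi>\<close> on the group, hence is evaluation at \<open>\<chi>\<close>. Its
  value at \<open>e'\<close> is 1, and injectivity of \<open>\<phi>\<close> makes \<open>e'\<close>
  kill the kernel; uniqueness of block idempotents finishes.\<close>

lemma char_idempotent_block:
  assumes \<chi>: "nonzero_character \<chi>"
  shows "block_idempotent \<chi> (char_idempotent \<iota> H \<chi>)"
proof -
  obtain e where e: "block_idempotent \<chi> e"
    using block_idempotent_exists[OF \<chi>] by blast
  let ?P = "\<lambda>e. primitive_central_idempotent FH e \<and>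
        (\<exists>\<phi>\<in>algebra_iso (corner FH e) (character_field \<iota> H \<chi>).
           \<forall>n\<in>carrier H. \<phi> (basis_elem n \<otimes>\<^bsub>FH\<^esub> e) = \<chi> n)"
  have "?P e"
    using block_idempotent_primitive[OF \<chi> e] ev_corner_iso[OF \<chi> e] block_idempotentD(2)[OF e]
    by (auto simp: ev_mult[OF \<chi>] ev_basis_elem intro!: bexI[of _ "ev \<chi>"])
  moreover have "e' = e" if P: "?P e'" for e'
  proof -
    obtain \<phi> where iso: "\<phi> \<in> algebra_iso (corner FH e') (character_field \<iota> H \<chi>)"
      and \<phi>: "\<And>n. n \<in> carrier H \<Longrightarrow> \<phi> (basis_elem n \<otimes>\<^bsub>FH\<^esub> e') = \<chi> n"
      using P by blast
    have e': "e' \<in> carrier FH" "e' \<otimes>\<^bsub>FH\<^esub> e' = e'"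
      using P by (auto simp: primitive_central_idempotent_def central_idempotent_def)
    have hom: "\<phi> \<in> Ring.ring_hom (corner FH e') (character_field \<iota> H \<chi>)"
      and inj: "inj_on \<phi> ((\<lambda>x. x \<otimes>\<^bsub>FH\<^esub> e') ` carrier FH)"
      and smult: "\<And>c x. x \<in> (\<lambda>x. x \<otimes>\<^bsub>FH\<^esub> e') ` carrier FH \<Longrightarrow> \<phi> (\<lambda>m. c * x m) = \<iota> c * \<phi> x"
      using iso by (auto simp: algebra_iso_def ring_iso_def bij_betw_def corner_simps FH_simps
          character_field_def scalar_algebra_simps)
    have "\<phi> (x \<otimes>\<^bsub>FH\<^esub> e') = ev \<chi> x" if x: "x \<in> carrier FH" for x
    proof (rule FH_linear_ext[where \<psi> = "\<lambda>x. \<phi> (x \<otimes>\<^bsub>FH\<^esub> e')" and \<chi> = \<chi>, OF _ _ \<phi> x])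
      fix x y c assume xy: "x \<in> carrier FH" "y \<in> carrier FH"
      show "\<phi> ((x + y) \<otimes>\<^bsub>FH\<^esub> e') = \<phi> (x \<otimes>\<^bsub>FH\<^esub> e') + \<phi> (y \<otimes>\<^bsub>FH\<^esub> e')"
        using FH.l_distr[OF xy e'(1)] ring_hom_add[OF hom, of "x \<otimes>\<^bsub>FH\<^esub> e'" "y \<otimes>\<^bsub>FH\<^esub> e'"] xy
        by (simp add: corner_simps FH_simps character_field_def scalar_algebra_simps)
    next
      fix x c assume "x \<in> carrier FH"
      then show "\<phi> ((\<lambda>m. c * x m) \<otimes>\<^bsub>FH\<^esub> e') = \<iota> c * \<phi> (x \<otimes>\<^bsub>FH\<^esub> e')"
        by (simp add: FH_smult_mult smult)
    qed
    note \<phi>_ev = this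
    have "\<phi> e' = 1"
      using ring_hom_one[OF hom] by (simp add: corner_simps character_field_def scalar_algebra_simps)
    then have "ev \<chi> e' = 1"
      using \<phi>_ev[OF e'(1)] e'(2) by simp
    moreover have "x \<otimes>\<^bsub>FH\<^esub> e' = 0" if "x \<in> carrier FH" "ev \<chi> x = 0" for x
    proof -
      have "0 \<in> carrier FH"
        by (simp add: carrier_FH)
      moreover from this have "0 = 0 \<otimes>\<^bsub>FH\<^esub> e'"
        using FH.l_null[OF e'(1)] by (simp add: FH_simps)
      moreover have "\<phi> (x \<otimes>\<^bsub>FH\<^esub> e') = \<phi> (0 \<otimes>\<^bsub>FH\<^esub> e')"
        using that \<phi>_ev \<open>0 \<in> carrier FH\<close> by (simp add: ev_zero)
      ultimately show ?thesis
        using inj_onD[OF inj] that by auto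
    qed
    ultimately have "block_idempotent \<chi> e'"
      using e'(1) by (simp add: block_idempotent_def)
    then show ?thesis
      by (rule block_idempotent_unique[OF \<chi> _ e])
  qed
  ultimately have "char_idempotent \<iota> H \<chi> = e"
    unfolding char_idempotent_def by (rule the_equality)
  then show ?thesis
    using e by simp
qed

text \<open>Values are roots of X^n - 1 with n the group order, and extensionality leaves no freedom
  outside the group.\<close>

lemma finite_linear_characters: "finite (linear_characters H :: ('a \<Rightarrow> 'k) set)"
proof -
  let ?n = "Coset.order H" and ?p = "monom 1 (Coset.order H) - 1 :: 'k poly"
  have "?n > 0"
    using finite_H order_gt_0_iff_finite by simp
  then have fin: "finite {z. poly ?p z = 0}"
    by (intro poly_roots_finite) (auto simp: monom_eq_1_iff)
  have "\<chi> x \<in> {z. poly ?p z = 0}" if "\<chi> \<in> linear_characters H" "x \<in> carrier H" for \<chi> x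
  proof -
    note \<chi> = linear_characters_nonzero[OF that(1)]
    have "\<chi> (x [^] k) = \<chi> x ^ k" for k :: nat
      using that(2) by (induction k) (simp_all add: character_one[OF \<chi>] character_mult[OF \<chi>] mult.commute)
    from this[of ?n] show ?thesis
      using pow_order_eq_1[OF that(2)] by (simp add: character_one[OF \<chi>] poly_monom)
  qed
  then have "linear_characters H \<subseteq> (\<Pi>\<^sub>E x\<in>carrier H. {z. poly ?p z = 0})"
    by (auto simp: linear_characters_def PiE_def)
  moreover have "finite (\<Pi>\<^sub>E x\<in>carrier H. {z. poly ?p z = 0})"
    by (intro finite_PiE finite_H fin)
  ultimately show ?thesis
    by (rule finite_subset)
qed

end

section \<open>Simple modules and their constituents\<close>

text \<open>A named scaling on functions, so that the vector space theory can be interpreted at this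
  type.\<close>

definition fun_scale :: "'f::field \<Rightarrow> ('a \<Rightarrow> 'f) \<Rightarrow> 'a \<Rightarrow> 'f" where
  "fun_scale c x = (\<lambda>m. c * x m)"

interpretation fun_space: vector_space fun_scale
  by unfold_locales (auto simp: fun_scale_def fun_eq_iff algebra_simps)

lemma mat_eqI_mult_vec:
  fixes A B :: "'c::field mat"
  assumes "A \<in> carrier_mat m n" and "B \<in> carrier_mat m n"
    and "\<And>v. v \<in> carrier_vec n \<Longrightarrow> A *\<^sub>v v = B *\<^sub>v v"
  shows "A = B"
proof (rule eq_matI)
  fix i j assume ij: "i < dim_row B" "j < dim_col B"
  have "(A *\<^sub>v unit_vec n j) $ i = (B *\<^sub>v unit_vec n j) $ i"
    by (simp add: assms(3))
  then show "A $$ (i, j) = B $$ (i, j)"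
    using ij assms(1,2) by simp
qed (use assms in auto)

lemma invariant_subspaceD:
  fixes \<rho> :: "'a \<Rightarrow> 'c::field mat"
  assumes "invariant_subspace H d \<rho> W"
  shows "W \<subseteq> carrier_vec d" and "0\<^sub>v d \<in> W"
    and "\<And>v w. v \<in> W \<Longrightarrow> w \<in> W \<Longrightarrow> v + w \<in> W" and "\<And>c v. v \<in> W \<Longrightarrow> c \<cdot>\<^sub>v v \<in> W"
    and "\<And>x v. x \<in> carrier H \<Longrightarrow> v \<in> W \<Longrightarrow> \<rho> x *\<^sub>v v \<in> W"
  using assms
  by (auto simp: invariant_subspace_def subspace_def submodule_def module_vec_simps)

lemma invariant_subspace_carrier:
  fixes \<rho> :: "'a \<Rightarrow> 'c::field mat"
  assumes "\<And>x. x \<in> carrier H \<Longrightarrow> \<rho> x \<in> carrier_mat d d"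
  shows "invariant_subspace H d \<rho> (carrier_vec d)"
  using mult_mat_vec_carrier[OF assms]
  by (auto simp: invariant_subspace_def subspace_def submodule_def module_vec_simps vec_vs vec_module)

text \<open>Supplies the decreasing measure in the search for a minimal ideal.\<close>

lemma (in vector_space) dim_psubset:
  assumes "subspace U" and "U \<subset> V" and "V \<subseteq> span T" and "finite T"
  shows "dim U < dim V"
proof -
  obtain B where B: "B \<subseteq> U" "independent B" "U \<subseteq> span B"
    using maximal_independent_subset by blast
  obtain C where C: "B \<subseteq> C" "C \<subseteq> V" "independent C" "V \<subseteq> span C"
    using maximal_independent_subset_extend[of B V] B(1,2) assms(2) by blast
  have "span B = U"
    using B assms(1) span_subspace by blast
  then have "B \<noteq> C"
    using C(4) assms(2) by blast
  moreover have "finite C"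
    using independent_span_bound[OF assms(4) C(3)] C(2) assms(3) by blast
  ultimately have "card B < card C"
    using C(1) by (intro psubset_card_mono) auto
  then show ?thesis
    using basis_card_eq_dim[OF B(1,3,2)] basis_card_eq_dim[OF C(2,4,3)] by simp
qed

text \<open>A basis enumerated by an initial segment of the natural numbers, which is how rows and
  columns of representing matrices are indexed.\<close>

lemma (in vector_space) finite_coordinates:
  assumes "subspace V" and "V \<subseteq> span T" and "finite T"
  obtains d and b :: "nat \<Rightarrow> 'b" where "\<And>i. i < d \<Longrightarrow> b i \<in> V"
    and "\<And>v. (\<Sum>i=0..<d. scale (v i) (b i)) = 0 \<Longrightarrow> \<forall>i<d. v i = 0"
    and "\<And>x. x \<in> V \<Longrightarrow> \<exists>v. x = (\<Sum>i=0..<d. scale (v i) (b i))"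
proof -
  obtain B where B: "B \<subseteq> V" "independent B" "V \<subseteq> span B"
    using maximal_independent_subset by blast
  have fin: "finite B"
    using independent_span_bound[OF assms(3) B(2)] B(1) assms(2) by blast
  obtain b where b: "bij_betw b {0..<card B} B"
    using ex_bij_betw_nat_finite[OF fin] by blast
  have sum: "(\<Sum>i=0..<card B. scale (u (b i)) (b i)) = (\<Sum>x\<in>B. scale (u x) x)" for u
    by (rule sum.reindex_bij_betw[OF b])
  show thesis
  proof (rule that[of "card B" b])
    show "b i \<in> V" if "i < card B" for i
      using that b B(1) by (auto simp: bij_betw_def)
    show "\<forall>i<card B. v i = 0" if v: "(\<Sum>i=0..<card B. scale (v i) (b i)) = 0" for v
    proof (intro allI impI)
      fix i assume i: "i < card B"
      \<comment> \<open>Coefficients are carried from indices to basis vectors along the inverse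
        enumeration, so that independence of the set \<open>B\<close> applies.\<close>
      let ?u = "\<lambda>x. v (inv_into {0..<card B} b x)"
      have u: "?u (b j) = v j" if "j < card B" for j
        using b that by (simp add: bij_betw_def)
      have "(\<Sum>x\<in>B. scale (?u x) x) = (\<Sum>i=0..<card B. scale (v i) (b i))"
        unfolding sum[of ?u, symmetric] by (intro sum.cong refl) (simp add: u)
      then have "?u (b i) = 0"
        using b i v by (intro independentD[OF B(2) fin order_refl]) (auto simp: bij_betw_def)
      then show "v i = 0"
        by (simp only: u[OF i])
    qed
    show "\<exists>v. x = (\<Sum>i=0..<card B. scale (v i) (b i))" if "x \<in> V" for x
    proof
      show "x = (\<Sum>i=0..<card B. scale (representation B x (b i)) (b i))"
        unfolding sum using that B(3) by (intro sum_representation_eq[OF B(2) _ fin, symmetric]) auto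
    qed
  qed
qed

context finite_comm_group_field_hom
begin

section \<open>Ideals of the group algebra and their matrix representations\<close>

lemma FH_smult: "c \<odot>\<^bsub>FH\<^esub> x = fun_scale c x"
  by (simp add: FH_simps fun_scale_def)

lemma pairing_sum:
  fixes f :: "'i \<Rightarrow> 'a \<Rightarrow> 'f"
  shows "pairing (\<lambda>c. c) (carrier H) (sum f I) \<phi> = (\<Sum>i\<in>I. pairing (\<lambda>c. c) (carrier H) (f i) \<phi>)"
proof (induction I rule: infinite_finite_induct)
  case (insert i F)
  then show ?case
    by (simp only: sum.insert not_False_eq_True pairing_add[OF field_hom_id])
qed (simp_all add: pairing_def)

lemma pairing_fun_scale:
  "pairing (\<lambda>c. c) (carrier H) (fun_scale c x) \<phi> = c * pairing (\<lambda>c. c) (carrier H) x \<phi>"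
  by (simp add: pairing_def fun_scale_def sum_distrib_left mult.assoc)

lemma ev_fun_scale: "ev \<chi> (fun_scale c x) = \<iota> c * ev \<chi> x"
  by (simp add: fun_scale_def ev_smult)

lemma fun_scale_closed: "x \<in> carrier FH \<Longrightarrow> fun_scale c x \<in> carrier FH"
  by (simp add: fun_scale_def FH_smult_closed)

lemma fun_scale_mult: "fun_scale c x \<otimes>\<^bsub>FH\<^esub> y = fun_scale c (x \<otimes>\<^bsub>FH\<^esub> y)"
  by (simp add: fun_scale_def FH_smult_mult)

lemma mult_fun_scale: "y \<otimes>\<^bsub>FH\<^esub> fun_scale c x = fun_scale c (y \<otimes>\<^bsub>FH\<^esub> x)"
  using fun_scale_mult FH_mult_comm by metis

lemma FH_mult_sum:
  assumes "\<And>i. i \<in> I \<Longrightarrow> f i \<in> carrier FH" and "x \<in> carrier FH"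
  shows "x \<otimes>\<^bsub>FH\<^esub> sum f I = (\<Sum>i\<in>I. x \<otimes>\<^bsub>FH\<^esub> f i)"
  using FH_sum_mult[OF assms] by (simp add: FH_mult_comm[of x])

lemma FH_expand': "x \<in> carrier FH \<Longrightarrow> x = (\<Sum>n\<in>carrier H. fun_scale (x n) (basis_elem n))"
  using FH_expand by (simp add: fun_scale_def)

lemma carrier_FH_span: "carrier FH \<subseteq> fun_space.span (basis_elem ` carrier H)"
proof
  fix x assume "x \<in> carrier FH"
  then have "x = (\<Sum>n\<in>carrier H. fun_scale (x n) (basis_elem n))"
    by (rule FH_expand')
  also have "\<dots> \<in> fun_space.span (basis_elem ` carrier H)"
    by (intro fun_space.span_sum fun_space.span_scale fun_space.span_base imageI)
  finally show "x \<in> fun_space.span (basis_elem ` carrier H)" .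
qed

lemma basis_elem_mult:
  assumes "x \<in> carrier H" and "y \<in> carrier H"
  shows "(basis_elem x :: 'a \<Rightarrow> 'f) \<otimes>\<^bsub>FH\<^esub> basis_elem y = basis_elem (x \<otimes> y)"
proof (rule FH_eqI)
  fix \<phi> :: "'a \<Rightarrow> 'f"
  have "pairing (\<lambda>c. c) (carrier H) (basis_elem x \<otimes>\<^bsub>FH\<^esub> basis_elem y) \<phi> =
      pairing (\<lambda>c. c) (carrier H) (basis_elem x)
        (\<lambda>a. pairing (\<lambda>c. c) (carrier H) (basis_elem y) (\<lambda>b. \<phi> (a \<otimes> b)))"
    by (rule pairing_mult_nested[OF field_hom_id])
  then show "pairing (\<lambda>c. c) (carrier H) (basis_elem x \<otimes>\<^bsub>FH\<^esub> basis_elem y) \<phi> =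
      pairing (\<lambda>c. c) (carrier H) (basis_elem (x \<otimes> y)) \<phi>"
    using assms by (simp add: pairing_basis_elem[OF field_hom_id])
qed (use assms in \<open>auto intro: mult_closed_FH basis_elem_closed\<close>)

text \<open>By linearity these are the ideals of the group algebra. Asking for stability under group
  elements only is the condition that corresponds to \<open>invariant_subspace\<close> on the matrix
  side.\<close>

definition invariant_space :: "('a \<Rightarrow> 'f) set \<Rightarrow> bool" where
  "invariant_space I \<longleftrightarrow> I \<subseteq> carrier FH \<and> fun_space.subspace I \<and>
     (\<forall>n\<in>carrier H. \<forall>x\<in>I. basis_elem n \<otimes>\<^bsub>FH\<^esub> x \<in> I)"

lemma mult_expand:
  assumes "a \<in> carrier FH" and "x \<in> carrier FH"
  shows "a \<otimes>\<^bsub>FH\<^esub> x = (\<Sum>n\<in>carrier H. fun_scale (a n) (basis_elem n \<otimes>\<^bsub>FH\<^esub> x))"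
proof -
  have "a \<otimes>\<^bsub>FH\<^esub> x = (\<Sum>n\<in>carrier H. fun_scale (a n) (basis_elem n)) \<otimes>\<^bsub>FH\<^esub> x"
    using FH_expand'[OF assms(1)] by simp
  also have "\<dots> = (\<Sum>n\<in>carrier H. fun_scale (a n) (basis_elem n) \<otimes>\<^bsub>FH\<^esub> x)"
    by (intro FH_sum_mult fun_scale_closed basis_elem_closed assms(2))
  finally show ?thesis
    by (simp only: fun_scale_mult)
qed

lemma invariant_space_mult:
  assumes "invariant_space I" and "a \<in> carrier FH" and "x \<in> I"
  shows "a \<otimes>\<^bsub>FH\<^esub> x \<in> I"
proof -
  have "a \<otimes>\<^bsub>FH\<^esub> x = (\<Sum>n\<in>carrier H. fun_scale (a n) (basis_elem n \<otimes>\<^bsub>FH\<^esub> x))"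
    using assms by (intro mult_expand) (auto simp: invariant_space_def)
  also have "\<dots> \<in> I"
    using assms by (intro fun_space.subspace_sum fun_space.subspace_scale) (auto simp: invariant_space_def)
  finally show ?thesis .
qed

lemma invariant_space_principal:
  assumes "c \<in> carrier FH"
  shows "invariant_space ((\<lambda>x. x \<otimes>\<^bsub>FH\<^esub> c) ` carrier FH)"
proof -
  let ?I = "(\<lambda>x. x \<otimes>\<^bsub>FH\<^esub> c) ` carrier FH"
  have "fun_space.subspace ?I"
  proof (rule fun_space.subspaceI)
    show "0 \<in> ?I"
      using FH.l_null[OF assms] FH.zero_closed by (intro image_eqI[of _ _ 0]) (simp_all add: FH_simps)
    show "x + y \<in> ?I" if "x \<in> ?I" "y \<in> ?I" for x y
    proof -
      obtain u v where "x = u \<otimes>\<^bsub>FH\<^esub> c" "y = v \<otimes>\<^bsub>FH\<^esub> c" "u \<in> carrier FH" "v \<in> carrier FH"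
        using \<open>x \<in> ?I\<close> \<open>y \<in> ?I\<close> by blast
      then show ?thesis
        using FH.l_distr[of u v c] assms by (intro image_eqI[of _ _ "u + v"]) (simp_all add: FH_simps FH_add_closed)
    qed
    show "fun_scale a x \<in> ?I" if "x \<in> ?I" for a x
      using that fun_scale_closed by (auto simp: fun_scale_mult[symmetric])
  qed
  moreover have "basis_elem n \<otimes>\<^bsub>FH\<^esub> (x \<otimes>\<^bsub>FH\<^esub> c) \<in> ?I" if "n \<in> carrier H" "x \<in> carrier FH" for n x
    using that assms basis_elem_closed
    by (intro image_eqI[of _ _ "basis_elem n \<otimes>\<^bsub>FH\<^esub> x"]) (simp_all add: FH.m_assoc)
  ultimately show ?thesis
    using mult_closed_FH by (auto simp: invariant_space_def)
qed

definition minimal_invariant :: "('a \<Rightarrow> 'f) set \<Rightarrow> bool" where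
  "minimal_invariant I \<longleftrightarrow> invariant_space I \<and> I \<noteq> {0} \<and>
     (\<forall>J. invariant_space J \<longrightarrow> J \<subseteq> I \<longrightarrow> J = {0} \<or> J = I)"

lemma minimal_invariant_exists:
  assumes "invariant_space I" and "I \<noteq> {0}"
  shows "\<exists>J\<subseteq>I. minimal_invariant J"
  using assms
proof (induction "fun_space.dim I" arbitrary: I rule: less_induct)
  case less
  show ?case
  proof (cases "minimal_invariant I")
    case False
    then obtain J where J: "invariant_space J" "J \<subset> I" "J \<noteq> {0}"
      using less.prems by (auto simp: minimal_invariant_def)
    have "fun_space.dim J < fun_space.dim I"
      using J less.prems carrier_FH_span finite_H
      by (intro fun_space.dim_psubset[of _ _ "basis_elem ` carrier H"])
        (auto simp: invariant_space_def)
    then obtain K where "K \<subseteq> J" "minimal_invariant K"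
      using less.hyps J by blast
    then show ?thesis
      using J(2) by blast
  qed blast
qed

text \<open>Writes a minimal ideal in coordinates: column j of \<open>\<rho> n\<close> holds the
  coordinates of n times \<open>b j\<close>. The basis is exported together with the representation,
  because later arguments pass between matrices and elements of the ideal.\<close>

lemma minimal_invariant_rep:
  assumes I: "minimal_invariant I"
  obtains d \<rho> b where "irreducible_rep H d (\<rho> :: 'a \<Rightarrow> 'f mat)"
    and "\<And>i. i < d \<Longrightarrow> b i \<in> I"
    and "\<And>v. (\<Sum>i=0..<d. fun_scale (v i) (b i)) = 0 \<Longrightarrow> \<forall>i<d. v i = 0"
    and "\<And>x. x \<in> I \<Longrightarrow> \<exists>v. x = (\<Sum>i=0..<d. fun_scale (v i) (b i))"
    and "\<And>n j. n \<in> carrier H \<Longrightarrow> j < d \<Longrightarrow>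
      basis_elem n \<otimes>\<^bsub>FH\<^esub> b j = (\<Sum>i=0..<d. fun_scale (\<rho> n $$ (i, j)) (b i))"
proof -
  have inv: "I \<subseteq> carrier FH" "fun_space.subspace I"
    "\<And>n x. n \<in> carrier H \<Longrightarrow> x \<in> I \<Longrightarrow> basis_elem n \<otimes>\<^bsub>FH\<^esub> x \<in> I"
    using I by (auto simp: minimal_invariant_def invariant_space_def)
  obtain d and b :: "nat \<Rightarrow> 'a \<Rightarrow> 'f" where b: "\<And>i. i < d \<Longrightarrow> b i \<in> I"
    and indep: "\<And>v. (\<Sum>i=0..<d. fun_scale (v i) (b i)) = 0 \<Longrightarrow> \<forall>i<d. v i = 0"
    and coord: "\<And>x. x \<in> I \<Longrightarrow> \<exists>v. x = (\<Sum>i=0..<d. fun_scale (v i) (b i))"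
    using fun_space.finite_coordinates[OF inv(2) subset_trans[OF inv(1) carrier_FH_span]] finite_H by blast
  have "\<forall>n. \<forall>j. \<exists>v. n \<in> carrier H \<longrightarrow> j < d \<longrightarrow>
      basis_elem n \<otimes>\<^bsub>FH\<^esub> b j = (\<Sum>i=0..<d. fun_scale (v i) (b i))"
    using coord b inv(3) by blast
  then obtain R where R: "\<And>n j. n \<in> carrier H \<Longrightarrow> j < d \<Longrightarrow>
      basis_elem n \<otimes>\<^bsub>FH\<^esub> b j = (\<Sum>i=0..<d. fun_scale (R n j i) (b i))"
    by metis
  define \<rho> where "\<rho> n = mat d d (\<lambda>(i, j). R n j i)" for n
  \<comment> \<open>The coordinate isomorphism from column vectors onto \<open>I\<close>. Once
    \<open>T\<close> is known to be equivariant, the laws of a representation are pulled back from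
    associativity in the group algebra, and irreducibility from minimality of
    \<open>I\<close>.\<close>
  define T where "T v = (\<Sum>i=0..<d. fun_scale (v $ i) (b i))" for v :: "'f vec"
  have \<rho>_carrier: "\<rho> n \<in> carrier_mat d d" for n
    by (simp add: \<rho>_def)
  have b_carrier: "b i \<in> carrier FH" if "i < d" for i
    using b inv(1) that by blast
  have T_closed: "T v \<in> I" for v
    unfolding T_def by (intro fun_space.subspace_sum[OF inv(2)] fun_space.subspace_scale[OF inv(2)] b) simp
  have T_add: "T (v + w) = T v + T w" if "v \<in> carrier_vec d" "w \<in> carrier_vec d" for v w
    unfolding T_def sum.distrib[symmetric] using that
    by (intro sum.cong refl) (simp add: fun_space.scale_left_distrib)
  have T_smult: "T (c \<cdot>\<^sub>v v) = fun_scale c (T v)" if "v \<in> carrier_vec d" for c v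
    unfolding T_def fun_space.scale_sum_right using that by (intro sum.cong refl) simp
  have T_inj: "v = w" if "v \<in> carrier_vec d" "w \<in> carrier_vec d" "T v = T w" for v w
  proof -
    have "(\<Sum>i=0..<d. fun_scale (v $ i - w $ i) (b i)) = T v - T w"
      unfolding T_def sum_subtractf[symmetric] by (simp only: fun_space.scale_left_diff_distrib)
    then have "(\<Sum>i=0..<d. fun_scale (v $ i - w $ i) (b i)) = 0"
      using that(3) by (simp only: diff_self)
    from indep[OF this] show ?thesis
      using that(1,2) by (intro eq_vecI) auto
  qed
  have T_surj: "\<exists>v\<in>carrier_vec d. x = T v" if "x \<in> I" for x
  proof -
    obtain u where u: "x = (\<Sum>i=0..<d. fun_scale (u i) (b i))"
      using coord[OF \<open>x \<in> I\<close>] by blast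
    have "x = T (vec d u)"
      unfolding u T_def by (intro sum.cong refl) simp
    then show ?thesis
      by (intro bexI[of _ "vec d u"]) simp_all
  qed
  have T_\<rho>: "T (\<rho> n *\<^sub>v v) = basis_elem n \<otimes>\<^bsub>FH\<^esub> T v" if n: "n \<in> carrier H" and v: "v \<in> carrier_vec d" for n v
  proof -
    have "basis_elem n \<otimes>\<^bsub>FH\<^esub> T v = (\<Sum>j=0..<d. basis_elem n \<otimes>\<^bsub>FH\<^esub> fun_scale (v $ j) (b j))"
      unfolding T_def by (intro FH_mult_sum fun_scale_closed b_carrier basis_elem_closed n) simp
    also have "\<dots> = (\<Sum>j=0..<d. \<Sum>i=0..<d. fun_scale (v $ j * R n j i) (b i))"
      by (intro sum.cong refl) (simp add: mult_fun_scale R[OF n] fun_space.scale_sum_right)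
    also have "\<dots> = (\<Sum>i=0..<d. \<Sum>j=0..<d. fun_scale (v $ j * R n j i) (b i))"
      by (rule sum.swap)
    also have "\<dots> = T (\<rho> n *\<^sub>v v)"
      unfolding T_def fun_space.scale_sum_left[symmetric] using v
      by (intro sum.cong refl arg_cong2[where f = fun_scale])
        (simp add: \<rho>_def scalar_prod_def mult.commute)
    finally show ?thesis
      by simp
  qed
  have "matrix_rep H d \<rho>"
    unfolding matrix_rep_def
  proof (intro conjI ballI)
    show "\<rho> \<one> = 1\<^sub>m d"
    proof (rule mat_eqI_mult_vec[OF \<rho>_carrier one_carrier_mat])
      fix v :: "'f vec" assume v: "v \<in> carrier_vec d"
      have "T (\<rho> \<one> *\<^sub>v v) = \<one>\<^bsub>FH\<^esub> \<otimes>\<^bsub>FH\<^esub> T v"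
        by (simp add: T_\<rho>[OF one_closed v] FH_simps)
      also have "\<dots> = T v"
        using T_closed inv(1) by (intro FH.l_one) blast
      finally have "\<rho> \<one> *\<^sub>v v = v"
        by (rule T_inj[OF mult_mat_vec_carrier[OF \<rho>_carrier v] v])
      then show "\<rho> \<one> *\<^sub>v v = 1\<^sub>m d *\<^sub>v v"
        using v by simp
    qed
    fix x y assume xy: "x \<in> carrier H" "y \<in> carrier H"
    show "\<rho> (x \<otimes> y) = \<rho> x * \<rho> y"
    proof (rule mat_eqI_mult_vec[OF \<rho>_carrier mult_carrier_mat[OF \<rho>_carrier \<rho>_carrier]])
      fix v :: "'f vec" assume v: "v \<in> carrier_vec d"
      have w: "\<rho> y *\<^sub>v v \<in> carrier_vec d"
        using v \<rho>_carrier mult_mat_vec_carrier by blast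
      have "T (\<rho> (x \<otimes> y) *\<^sub>v v) = T (\<rho> x *\<^sub>v (\<rho> y *\<^sub>v v))"
        using xy T_closed inv(1)
        by (simp add: T_\<rho> v w basis_elem_mult[symmetric] FH.m_assoc basis_elem_closed subset_iff)
      then have "\<rho> (x \<otimes> y) *\<^sub>v v = \<rho> x *\<^sub>v (\<rho> y *\<^sub>v v)"
        using v w \<rho>_carrier mult_mat_vec_carrier by (intro T_inj) blast+
      then show "\<rho> (x \<otimes> y) *\<^sub>v v = \<rho> x * \<rho> y *\<^sub>v v"
        by (simp add: assoc_mult_mat_vec[OF \<rho>_carrier \<rho>_carrier v])
    qed
  qed (rule \<rho>_carrier)
  moreover have "d \<noteq> 0"
  proof
    assume "d = 0"
    then have "I \<subseteq> {0}"
      using coord by fastforce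
    then show False
      using I inv(2) fun_space.subspace_0 by (auto simp: minimal_invariant_def)
  qed
  moreover have "W = {0\<^sub>v d} \<or> W = carrier_vec d" if "invariant_subspace H d \<rho> W" for W
  proof -
    note W = invariant_subspaceD[OF that]
    have T0: "T (0\<^sub>v d) = 0"
      unfolding T_def by (intro sum.neutral) simp
    \<comment> \<open>The image of an invariant subspace is an ideal inside \<open>I\<close>, so
      minimality leaves only the two extremes, and injectivity of \<open>T\<close> brings them back
      to \<open>W\<close>.\<close>
    have "fun_space.subspace (T ` W)"
    proof (rule fun_space.subspaceI)
      show "0 \<in> T ` W"
        using W(2) T0 by (intro image_eqI[of _ _ "0\<^sub>v d"]) simp_all
      show "x + y \<in> T ` W" if "x \<in> T ` W" "y \<in> T ` W" for x y
        using that W(1,3) T_add by (smt (verit) image_iff subset_iff)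
      show "fun_scale c x \<in> T ` W" if "x \<in> T ` W" for c x
        using that W(1,4) T_smult by (smt (verit) image_iff subset_iff)
    qed
    moreover have "basis_elem n \<otimes>\<^bsub>FH\<^esub> x \<in> T ` W" if "n \<in> carrier H" "x \<in> T ` W" for n x
      using that W(1,5) T_\<rho> by (smt (verit) image_iff subset_iff)
    ultimately have "invariant_space (T ` W)"
      using T_closed inv(1) by (auto simp: invariant_space_def)
    then consider "T ` W = {0}" | "T ` W = I"
      using I T_closed by (auto simp: minimal_invariant_def)
    then show ?thesis
    proof cases
      case 1
      then have "w = 0\<^sub>v d" if "w \<in> W" for w
        using that W(1) T0 by (intro T_inj) auto
      then show ?thesis
        using W(2) by blast
    next
      case 2
      have "v \<in> W" if v: "v \<in> carrier_vec d" for v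
      proof -
        obtain w where "w \<in> W" "T v = T w"
          using T_closed 2 by (metis imageE)
        then show ?thesis
          using T_inj v W(1) by blast
      qed
      then show ?thesis
        using W(1) by blast
    qed
  qed
  ultimately have "irreducible_rep H d \<rho>"
    unfolding irreducible_rep_def by blast
  then show thesis
    by (rule that[OF _ b indep coord]) (simp_all add: R \<rho>_def)
qed

lemma linear_character_irreducible_rep:
  assumes \<chi>: "nonzero_character \<chi>"
  shows "irreducible_rep H 1 (\<lambda>n. mat 1 1 (\<lambda>_. \<chi> n))"
  unfolding irreducible_rep_def
proof (intro conjI allI impI)
  show "matrix_rep H 1 (\<lambda>n. mat 1 1 (\<lambda>_. \<chi> n))"
    by (auto simp: matrix_rep_def character_one[OF \<chi>] character_mult[OF \<chi>] scalar_prod_def)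
  fix W assume W: "invariant_subspace H 1 (\<lambda>n. mat 1 1 (\<lambda>_. \<chi> n)) W"
  note W = invariant_subspaceD[OF W]
  show "W = {0\<^sub>v 1} \<or> W = carrier_vec 1"
  proof (cases "W \<subseteq> {0\<^sub>v 1}")
    case False
    then obtain w where w: "w \<in> W" "w \<noteq> 0\<^sub>v 1"
      by blast
    then have w0: "w $ 0 \<noteq> 0" and dim: "w \<in> carrier_vec 1"
      using W(1) by (auto simp: vec_eq_iff)
    have "v \<in> W" if "v \<in> carrier_vec 1" for v
    proof -
      have "v = (v $ 0 / w $ 0) \<cdot>\<^sub>v w"
        using that dim w0 by (intro eq_vecI) auto
      also have "\<dots> \<in> W"
        by (rule W(4)[OF w(1)])
      finally show ?thesis .
    qed
    then show ?thesis
      using W(1) by blast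
  qed (use W(2) in blast)
qed simp

text \<open>The block is a copy of the field F(\<chi>). For a nonzero x in an ideal J, an element z
  whose value is inverse to that of x gives z x = e, so J contains \<open>e\<close> and is the whole
  block.\<close>

lemma principal_block_minimal:
  assumes \<chi>: "nonzero_character \<chi>" and e: "block_idempotent \<chi> e"
  shows "minimal_invariant ((\<lambda>x. x \<otimes>\<^bsub>FH\<^esub> e) ` carrier FH)"
  unfolding minimal_invariant_def
proof (intro conjI allI impI)
  let ?I = "(\<lambda>x. x \<otimes>\<^bsub>FH\<^esub> e) ` carrier FH"
  note e_closed = block_idempotentD(1)[OF e]
  show "invariant_space ?I"
    by (rule invariant_space_principal[OF e_closed])
  have "e \<in> ?I"
    using e_closed by (intro image_eqI[of _ _ "\<one>\<^bsub>FH\<^esub>"]) simp_all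
  then show "?I \<noteq> {0}"
    using block_idempotent_nonzero[OF e] by blast
  fix J assume J: "invariant_space J" "J \<subseteq> ?I"
  show "J = {0} \<or> J = ?I"
  proof (cases "J \<subseteq> {0}")
    case True
    then show ?thesis
      using J(1) fun_space.subspace_0 by (auto simp: invariant_space_def)
  next
    case False
    then obtain x y where x: "x \<in> J" "x \<noteq> 0" "x = y \<otimes>\<^bsub>FH\<^esub> e" and y: "y \<in> carrier FH"
      using J(2) by blast
    have x_closed: "x \<in> carrier FH"
      using x(3) mult_closed_FH by simp
    have xe: "x \<otimes>\<^bsub>FH\<^esub> e = x"
      using y e_closed block_idempotent_idem[OF \<chi> e] by (simp add: x(3) FH.m_assoc)
    then have "ev \<chi> x \<noteq> 0"
      using x(2) block_mult_eq_zero_iff[OF \<chi> e x_closed] by simp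
    then have "inverse (ev \<chi> x) \<in> ev \<chi> ` carrier FH"
      using x_closed by (intro ev_image_inverse[OF \<chi>]) auto
    then obtain z where z: "z \<in> carrier FH" "ev \<chi> z = inverse (ev \<chi> x)"
      by (metis imageE)
    have "(z \<otimes>\<^bsub>FH\<^esub> x) \<otimes>\<^bsub>FH\<^esub> e = e"
      using z \<open>ev \<chi> x \<noteq> 0\<close> by (intro block_mult_eq_self[OF \<chi> e mult_closed_FH]) (simp add: ev_mult[OF \<chi>])
    then have "z \<otimes>\<^bsub>FH\<^esub> x = e"
      using z(1) x_closed e_closed by (simp add: FH.m_assoc xe)
    then have "e \<in> J"
      using invariant_space_mult[OF J(1) z(1) x(1)] by simp
    then have "?I \<subseteq> J"
      using invariant_space_mult[OF J(1)] by blast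
    then show ?thesis
      using J(2) by blast
  qed
qed

text \<open>
  The characters whose idempotent is e all occur in the simple module \<open>FH e\<close>: a character
  \<open>\<chi>'\<close> gives the quotient map \<open>x \<mapsto> \<chi>'(x)\<close> after extension of scalars.
\<close>

lemma block_constituent:
  assumes \<chi>: "nonzero_character \<chi>" and e: "block_idempotent \<chi> e"
  obtains d and \<rho> :: "'a \<Rightarrow> 'f mat" where "irreducible_rep H d \<rho>"
    and "\<And>\<chi>'. \<chi>' \<in> linear_characters H \<Longrightarrow> block_idempotent \<chi>' e \<Longrightarrow> constituent_character \<iota> H d \<rho> \<chi>'"
proof -
  let ?I = "(\<lambda>x. x \<otimes>\<^bsub>FH\<^esub> e) ` carrier FH"
  obtain d and \<rho> :: "'a \<Rightarrow> 'f mat" and b where irr: "irreducible_rep H d \<rho>"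
    and b: "\<And>i. i < d \<Longrightarrow> b i \<in> ?I"
    and "\<And>v. (\<Sum>i=0..<d. fun_scale (v i) (b i)) = 0 \<Longrightarrow> \<forall>i<d. v i = 0"
    and coord: "\<And>x. x \<in> ?I \<Longrightarrow> \<exists>v. x = (\<Sum>i=0..<d. fun_scale (v i) (b i))"
    and \<rho>: "\<And>n j. n \<in> carrier H \<Longrightarrow> j < d \<Longrightarrow>
      basis_elem n \<otimes>\<^bsub>FH\<^esub> b j = (\<Sum>i=0..<d. fun_scale (\<rho> n $$ (i, j)) (b i))"
    by (fact minimal_invariant_rep[OF principal_block_minimal[OF \<chi> e]])
  have \<rho>_carrier: "\<rho> n \<in> carrier_mat d d" if "n \<in> carrier H" for n
    using irr that by (simp add: irreducible_rep_def matrix_rep_def)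
  have "constituent_character \<iota> H d \<rho> \<chi>'"
    if \<chi>': "\<chi>' \<in> linear_characters H" "block_idempotent \<chi>' e" for \<chi>'
  proof -
    note nz = linear_characters_nonzero[OF \<chi>'(1)]
    \<comment> \<open>The row matrix of evaluation at \<open>\<chi>'\<close> in the coordinates
      \<open>b\<close>, extended K-linearly.\<close>
    define P where "P = mat 1 d (\<lambda>(i, j). ev \<chi>' (b j))"
    have P: "P *\<^sub>v w = vec 1 (\<lambda>_. \<Sum>j=0..<d. ev \<chi>' (b j) * w $ j)" if "w \<in> carrier_vec d" for w
      using that by (intro eq_vecI) (simp_all add: P_def scalar_prod_def)
    have "e \<in> ?I"
      using block_idempotentD(1)[OF e] by (intro image_eqI[of _ _ "\<one>\<^bsub>FH\<^esub>"]) simp_all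
    from coord[OF this] obtain v where v: "e = (\<Sum>i=0..<d. fun_scale (v i) (b i))"
      by blast
    have "ev \<chi>' e = (\<Sum>i=0..<d. \<iota> (v i) * ev \<chi>' (b i))"
      by (simp add: v ev_sum ev_fun_scale)
    then have "(\<Sum>i=0..<d. \<iota> (v i) * ev \<chi>' (b i)) \<noteq> 0"
      using block_idempotentD(2)[OF \<chi>'(2)] by simp
    \<comment> \<open>As \<open>e\<close> lies in the span of the \<open>b i\<close> and has value
      1, some basis vector has a nonzero value. That entry of \<open>P\<close> suffices to hit all
      of K.\<close>
    then obtain k where "k \<in> {0..<d}" "\<iota> (v k) * ev \<chi>' (b k) \<noteq> 0"
      by (rule sum.not_neutral_contains_not_neutral)
    then have k: "k < d" "ev \<chi>' (b k) \<noteq> 0"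
      by auto
    have "composition_factor H d (\<lambda>x. map_mat \<iota> (\<rho> x)) 1 (\<lambda>n. mat 1 1 (\<lambda>_. \<chi>' n))"
      unfolding composition_factor_def
    proof (intro conjI exI[of _ "carrier_vec d"] exI[of _ P] ballI)
      show "irreducible_rep H 1 (\<lambda>n. mat 1 1 (\<lambda>_. \<chi>' n))"
        by (rule linear_character_irreducible_rep[OF nz])
      show "invariant_subspace H d (\<lambda>x. map_mat \<iota> (\<rho> x)) (carrier_vec d)"
        by (rule invariant_subspace_carrier) (simp add: \<rho>_carrier)
      show "P \<in> carrier_mat 1 d"
        by (simp add: P_def)
      show "(\<lambda>w. P *\<^sub>v w) ` carrier_vec d = carrier_vec 1"
      proof
        show "(\<lambda>w. P *\<^sub>v w) ` carrier_vec d \<subseteq> carrier_vec 1"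
          by (auto simp: P)
        show "carrier_vec 1 \<subseteq> (\<lambda>w. P *\<^sub>v w) ` carrier_vec d"
        proof
          fix u :: "'k vec" assume u: "u \<in> carrier_vec 1"
          let ?w = "vec d (\<lambda>j. if j = k then u $ 0 / ev \<chi>' (b k) else 0)"
          have "P *\<^sub>v ?w = u"
            using u k by (intro eq_vecI) (auto simp: P if_distrib[of "(*) _"] cong: if_cong)
          then show "u \<in> (\<lambda>w. P *\<^sub>v w) ` carrier_vec d"
            by (intro image_eqI[of _ _ ?w]) simp_all
        qed
      qed
      fix n and w :: "'k vec" assume n: "n \<in> carrier H" and w: "w \<in> carrier_vec d"
      have nw: "map_mat \<iota> (\<rho> n) *\<^sub>v w \<in> carrier_vec d"
        using \<rho>_carrier[OF n] w by (intro mult_mat_vec_carrier[of _ d d]) simp_all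
      have "(\<Sum>i=0..<d. ev \<chi>' (b i) * (map_mat \<iota> (\<rho> n) *\<^sub>v w) $ i) =
          (\<Sum>i=0..<d. \<Sum>j=0..<d. \<iota> (\<rho> n $$ (i, j)) * ev \<chi>' (b i) * w $ j)"
        using \<rho>_carrier[OF n] w by (intro sum.cong refl) (simp add: scalar_prod_def sum_distrib_left mult_ac)
      also have "\<dots> = (\<Sum>j=0..<d. \<Sum>i=0..<d. \<iota> (\<rho> n $$ (i, j)) * ev \<chi>' (b i) * w $ j)"
        by (rule sum.swap)
      also have "\<dots> = (\<Sum>j=0..<d. ev \<chi>' (basis_elem n \<otimes>\<^bsub>FH\<^esub> b j) * w $ j)"
        by (intro sum.cong refl) (simp add: \<rho>[OF n] ev_sum ev_fun_scale sum_distrib_right)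
      also have "\<dots> = \<chi>' n * (\<Sum>j=0..<d. ev \<chi>' (b j) * w $ j)"
        by (simp add: ev_mult[OF nz] ev_basis_elem[OF n] sum_distrib_left mult.assoc)
      finally show "P *\<^sub>v (map_mat \<iota> (\<rho> n) *\<^sub>v w) = mat 1 1 (\<lambda>_. \<chi>' n) *\<^sub>v (P *\<^sub>v w)"
        unfolding P[OF w] P[OF nw] by (intro eq_vecI) (simp_all add: scalar_prod_def)
    qed
    moreover have "\<chi>' = rep_character H (\<lambda>n. mat 1 1 (\<lambda>_. \<chi>' n))"
      using \<chi>'(1) by (auto simp: rep_character_def linear_characters_def extensional_def fun_eq_iff)
    ultimately show ?thesis
      unfolding constituent_character_def by blast
  qed
  then show thesis
    by (rule that[OF irr])
qed

section \<open>The idempotents belonging to a choice of Lin\<close>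

lemma is_Lin_linear: "is_Lin \<iota> H L \<Longrightarrow> \<chi> \<in> L \<Longrightarrow> nonzero_character \<chi>"
  using linear_characters_nonzero by (auto simp: is_Lin_def)

lemma is_Lin_finite: "is_Lin \<iota> H L \<Longrightarrow> finite L"
  using finite_linear_characters finite_subset by (auto simp: is_Lin_def)

text \<open>Uses the uniqueness half of \<open>is_Lin\<close>, at the simple module formed by the
  common block.\<close>

lemma is_Lin_inj:
  assumes L: "is_Lin \<iota> H L" and \<chi>: "\<chi> \<in> L" "\<chi>' \<in> L"
    and eq: "char_idempotent \<iota> H \<chi> = char_idempotent \<iota> H \<chi>'"
  shows "\<chi> = \<chi>'"
proof -
  note nz = is_Lin_linear[OF L \<chi>(1)] is_Lin_linear[OF L \<chi>(2)]
  have "\<chi> \<in> linear_characters H" "\<chi>' \<in> linear_characters H"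
    using L \<chi> by (auto simp: is_Lin_def)
  moreover obtain d and \<rho> :: "'a \<Rightarrow> 'f mat" where irr: "irreducible_rep H d \<rho>"
    and c: "\<And>\<chi>''. \<chi>'' \<in> linear_characters H \<Longrightarrow> block_idempotent \<chi>'' (char_idempotent \<iota> H \<chi>)
      \<Longrightarrow> constituent_character \<iota> H d \<rho> \<chi>''"
    by (fact block_constituent[OF nz(1) char_idempotent_block[OF nz(1)]])
  ultimately have "constituent_character \<iota> H d \<rho> \<chi>" "constituent_character \<iota> H d \<rho> \<chi>'"
    using char_idempotent_block[OF nz(1)] char_idempotent_block[OF nz(2)] eq by simp_all
  then show ?thesis
    using L irr \<chi> unfolding is_Lin_def by blast
qed

lemma is_Lin_orthogonal:
  assumes L: "is_Lin \<iota> H L" and \<chi>: "\<chi> \<in> L" "\<chi>' \<in> L" "\<chi> \<noteq> \<chi>'"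
  shows "char_idempotent \<iota> H \<chi> \<otimes>\<^bsub>FH\<^esub> char_idempotent \<iota> H \<chi>' = 0"
proof -
  note nz = is_Lin_linear[OF L \<chi>(1)] is_Lin_linear[OF L \<chi>(2)]
  have "char_idempotent \<iota> H \<chi> \<noteq> char_idempotent \<iota> H \<chi>'"
    using is_Lin_inj[OF L \<chi>(1,2)] \<chi>(3) by blast
  then show ?thesis
    using block_idempotent_eq_or_orthogonal[OF nz(1) char_idempotent_block[OF nz(1)]
        nz(2) char_idempotent_block[OF nz(2)]] by blast
qed

text \<open>
  If f acts as the identity on a module, then so it does on every constituent of the
  module after extension of scalars, and its trace there is the degree.
\<close>

lemma constituent_character_trace:
  fixes \<rho> :: "'a \<Rightarrow> 'f mat"
  assumes c: "constituent_character \<iota> H d \<rho> \<chi>"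
    and id: "\<And>i j. i < d \<Longrightarrow> j < d \<Longrightarrow> (\<Sum>n\<in>carrier H. f n * \<rho> n $$ (i, j)) = (if i = j then 1 else 0)"
    and \<rho>: "\<And>n. n \<in> carrier H \<Longrightarrow> \<rho> n \<in> carrier_mat d d"
  shows "ev \<chi> f \<noteq> 0"
proof -
  obtain m \<tau> W P where irr: "irreducible_rep H m \<tau>" and \<chi>: "\<chi> = rep_character H \<tau>"
    and W: "invariant_subspace H d (\<lambda>x. map_mat \<iota> (\<rho> x)) W" and P: "P \<in> carrier_mat m d"
    and PW: "(\<lambda>w. P *\<^sub>v w) ` W = carrier_vec m"
    and eqv: "\<And>x w. x \<in> carrier H \<Longrightarrow> w \<in> W \<Longrightarrow> P *\<^sub>v (map_mat \<iota> (\<rho> x) *\<^sub>v w) = \<tau> x *\<^sub>v (P *\<^sub>v w)"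
    using c unfolding constituent_character_def composition_factor_def by metis
  have \<tau>: "\<tau> n \<in> carrier_mat m m" if "n \<in> carrier H" for n
    using irr that by (simp add: irreducible_rep_def matrix_rep_def)
  have diag: "(\<Sum>n\<in>carrier H. \<iota> (f n) * \<tau> n $$ (k, k)) = 1" if k: "k < m" for k
  proof -
    \<comment> \<open>Equivariance of \<open>P\<close> is available on \<open>W\<close> only, so the
      k-th column of \<open>\<tau> n\<close> is computed from a preimage in \<open>W\<close> of the
      unit vector.\<close>
    have "unit_vec m k \<in> (\<lambda>w. P *\<^sub>v w) ` W"
      unfolding PW by simp
    then obtain w where w: "w \<in> W" "P *\<^sub>v w = unit_vec m k"
      by (metis imageE)
    have w_carrier: "w \<in> carrier_vec d"
      using w(1) invariant_subspaceD(1)[OF W] by blast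
    have \<tau>_eq: "\<tau> n $$ (k, k) = (\<Sum>i=0..<d. P $$ (k, i) * (\<Sum>j=0..<d. \<iota> (\<rho> n $$ (i, j)) * w $ j))"
      if n: "n \<in> carrier H" for n
    proof -
      have "\<tau> n $$ (k, k) = (\<tau> n *\<^sub>v (P *\<^sub>v w)) $ k"
        using k \<tau>[OF n] by (simp add: w(2))
      also have "\<dots> = (P *\<^sub>v (map_mat \<iota> (\<rho> n) *\<^sub>v w)) $ k"
        by (simp only: eqv[OF n w(1)])
      also have "\<dots> = (\<Sum>i=0..<d. P $$ (k, i) * (\<Sum>j=0..<d. \<iota> (\<rho> n $$ (i, j)) * w $ j))"
        using k P \<rho>[OF n] w_carrier by (simp add: scalar_prod_def)
      finally show ?thesis .
    qed
    have "(\<Sum>n\<in>carrier H. \<iota> (f n) * \<tau> n $$ (k, k)) =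
        (\<Sum>n\<in>carrier H. \<Sum>i=0..<d. \<Sum>j=0..<d. P $$ (k, i) * (\<iota> (f n * \<rho> n $$ (i, j)) * w $ j))"
      by (intro sum.cong refl) (simp add: \<tau>_eq sum_distrib_left emb.hom_mult mult_ac)
    also have "\<dots> = (\<Sum>i=0..<d. \<Sum>j=0..<d. \<Sum>n\<in>carrier H. P $$ (k, i) * (\<iota> (f n * \<rho> n $$ (i, j)) * w $ j))"
      by (subst sum.swap) (intro sum.cong refl, rule sum.swap)
    also have "\<dots> = (\<Sum>i=0..<d. \<Sum>j=0..<d. P $$ (k, i) * (\<iota> (\<Sum>n\<in>carrier H. f n * \<rho> n $$ (i, j)) * w $ j))"
      by (simp add: sum_distrib_left sum_distrib_right emb.hom_sum)
    also have "\<dots> = (\<Sum>i=0..<d. \<Sum>j=0..<d. if i = j then P $$ (k, i) * w $ j else 0)"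
      by (intro sum.cong refl) (simp add: id)
    also have "\<dots> = (P *\<^sub>v w) $ k"
      using k P w_carrier by (simp add: scalar_prod_def)
    finally show ?thesis
      using k by (simp add: w(2))
  qed
  have "ev \<chi> f = (\<Sum>n\<in>carrier H. \<Sum>k<m. \<iota> (f n) * \<tau> n $$ (k, k))"
    unfolding pairing_def \<chi> by (intro sum.cong refl) (simp add: rep_character_def sum_distrib_left carrier_matD(1)[OF \<tau>])
  also have "\<dots> = (\<Sum>k<m. 1)"
    by (subst sum.swap) (simp add: diag)
  also have "\<dots> = \<iota> (of_nat m)"
    by (simp add: emb.hom_of_nat)
  \<comment> \<open>The degree \<open>m\<close> is positive, hence nonzero in F by characteristic 0,
    and the injective \<open>\<iota>\<close> keeps it nonzero in K.\<close>
  also have "\<dots> \<noteq> 0"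
    using irr by (simp add: irreducible_rep_def)
  finally show ?thesis .
qed

text \<open>Uses the existence half of \<open>is_Lin\<close>. The defect \<open>f\<close> is an
  idempotent that kills every block, so it evaluates to 0 at each character of \<open>L\<close>. On
  a minimal ideal below \<open>f\<close> it acts as the identity, so its trace on a constituent from
  \<open>L\<close> would be the nonzero degree.\<close>

lemma is_Lin_sum:
  assumes L: "is_Lin \<iota> H L"
  shows "(\<Sum>\<chi>\<in>L. char_idempotent \<iota> H \<chi>) = \<one>\<^bsub>FH\<^esub>"
proof (rule ccontr)
  let ?e = "char_idempotent \<iota> H"
  define f where "f = \<one>\<^bsub>FH\<^esub> - sum ?e L"
  have e: "block_idempotent \<chi> (?e \<chi>)" if "\<chi> \<in> L" for \<chi>
    by (rule char_idempotent_block[OF is_Lin_linear[OF L that]])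
  have e_closed: "?e \<chi> \<in> carrier FH" if "\<chi> \<in> L" for \<chi>
    by (rule block_idempotentD(1)[OF e[OF that]])
  have sum_closed: "sum ?e L \<in> carrier FH"
    by (rule FH_sum_closed[OF e_closed])
  have f_closed: "f \<in> carrier FH"
    unfolding f_def by (intro FH_diff_closed FH.one_closed sum_closed)
  assume "sum ?e L \<noteq> \<one>\<^bsub>FH\<^esub>"
  then have "f \<noteq> 0"
    by (metis f_def eq_iff_diff_eq_0)
  have sum_e: "sum ?e L \<otimes>\<^bsub>FH\<^esub> ?e \<chi> = ?e \<chi>" if "\<chi> \<in> L" for \<chi>
  proof -
    have "sum ?e L \<otimes>\<^bsub>FH\<^esub> ?e \<chi> = (\<Sum>\<chi>'\<in>L. ?e \<chi>' \<otimes>\<^bsub>FH\<^esub> ?e \<chi>)"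
      using that by (intro FH_sum_mult e_closed)
    also have "\<dots> = (\<Sum>\<chi>'\<in>L. if \<chi>' = \<chi> then ?e \<chi> else 0)"
      using that is_Lin_orthogonal[OF L] block_idempotent_idem[OF is_Lin_linear[OF L that] e[OF that]]
      by (intro sum.cong refl) auto
    finally show ?thesis
      using that is_Lin_finite[OF L] by simp
  qed
  have fe: "f \<otimes>\<^bsub>FH\<^esub> ?e \<chi> = 0" if "\<chi> \<in> L" for \<chi>
    using that e_closed sum_closed by (simp add: f_def FH_diff_mult sum_e)
  \<comment> \<open>The sum is 1 - f, so its vanishing product with \<open>f\<close> says that
    \<open>f\<close> is idempotent.\<close>
  have "f \<otimes>\<^bsub>FH\<^esub> sum ?e L = 0"
    by (subst FH_mult_sum[OF e_closed f_closed]) (auto simp: fe intro: sum.neutral)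
  then have ff: "f \<otimes>\<^bsub>FH\<^esub> f = f"
    using f_closed sum_closed FH_diff_mult[OF FH.one_closed sum_closed f_closed] FH_mult_comm[of f]
    by (metis FH.l_one diff_zero f_def)
  let ?I = "(\<lambda>x. x \<otimes>\<^bsub>FH\<^esub> f) ` carrier FH"
  have "f \<in> ?I"
    using f_closed by (intro image_eqI[of _ _ "\<one>\<^bsub>FH\<^esub>"]) simp_all
  then have "?I \<noteq> {0}"
    using \<open>f \<noteq> 0\<close> by blast
  then obtain J where J: "J \<subseteq> ?I" "minimal_invariant J"
    using minimal_invariant_exists[OF invariant_space_principal[OF f_closed]] by blast
  obtain d and \<rho> :: "'a \<Rightarrow> 'f mat" and b where irr: "irreducible_rep H d \<rho>"
    and b: "\<And>i. i < d \<Longrightarrow> b i \<in> J"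
    and indep: "\<And>v. (\<Sum>i=0..<d. fun_scale (v i) (b i)) = 0 \<Longrightarrow> \<forall>i<d. v i = 0"
    and "\<And>x. x \<in> J \<Longrightarrow> \<exists>v. x = (\<Sum>i=0..<d. fun_scale (v i) (b i))"
    and \<rho>: "\<And>n j. n \<in> carrier H \<Longrightarrow> j < d \<Longrightarrow>
      basis_elem n \<otimes>\<^bsub>FH\<^esub> b j = (\<Sum>i=0..<d. fun_scale (\<rho> n $$ (i, j)) (b i))"
    by (fact minimal_invariant_rep[OF J(2)])
  \<comment> \<open>Elements of \<open>J\<close> are multiples of the idempotent \<open>f\<close>
    and hence fixed by it. Comparing coordinates of f (b j) and b j shows that \<open>f\<close> is
    represented by the identity matrix.\<close>
  have id: "(\<Sum>n\<in>carrier H. f n * \<rho> n $$ (i, j)) = (if i = j then 1 else 0)" if ij: "i < d" "j < d" for i j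
  proof -
    obtain x where x: "b j = x \<otimes>\<^bsub>FH\<^esub> f" "x \<in> carrier FH"
      using b[OF ij(2)] J(1) by blast
    have bj: "b j \<in> carrier FH"
      using x mult_closed_FH by simp
    have "f \<otimes>\<^bsub>FH\<^esub> b j = b j"
      using x(2) f_closed ff FH_mult_comm[of f "b j"] by (simp add: x(1) FH.m_assoc)
    then have "b j = (\<Sum>n\<in>carrier H. fun_scale (f n) (\<Sum>i=0..<d. fun_scale (\<rho> n $$ (i, j)) (b i)))"
      unfolding mult_expand[OF f_closed bj] by (simp add: \<rho> ij(2) cong: sum.cong)
    also have "\<dots> = (\<Sum>i=0..<d. fun_scale (\<Sum>n\<in>carrier H. f n * \<rho> n $$ (i, j)) (b i))"
      unfolding fun_space.scale_sum_right fun_space.scale_scale fun_space.scale_sum_left by (rule sum.swap)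
    finally have "(\<Sum>i=0..<d. fun_scale (\<Sum>n\<in>carrier H. f n * \<rho> n $$ (i, j)) (b i)) = b j"
      by simp
    moreover have "(\<Sum>i=0..<d. fun_scale (if i = j then 1 else 0) (b i)) = b j"
      using ij(2) by (subst sum.remove[of _ j]) (auto simp: sum.neutral)
    ultimately have "(\<Sum>i=0..<d. fun_scale ((\<Sum>n\<in>carrier H. f n * \<rho> n $$ (i, j)) - (if i = j then 1 else 0)) (b i)) = 0"
      unfolding fun_space.scale_left_diff_distrib sum_subtractf by (simp only: diff_self)
    from indep[OF this] show ?thesis
      using ij(1) by simp
  qed
  obtain \<chi> where \<chi>: "\<chi> \<in> L" "constituent_character \<iota> H d \<rho> \<chi>"
    using L irr unfolding is_Lin_def by blast
  have "ev \<chi> f \<noteq> 0"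
    using irr by (intro constituent_character_trace[OF \<chi>(2) id]) (auto simp: irreducible_rep_def matrix_rep_def)
  moreover have "ev \<chi> f = 0"
    using block_mult_eq_zero_iff[OF is_Lin_linear[OF L \<chi>(1)] e[OF \<chi>(1)] f_closed] fe[OF \<chi>(1)] by simp
  ultimately show False
    by simp
qed

end

section \<open>Automorphisms and sums of blocks\<close>

lemma abelian_monoid_corner:
  assumes "cring R" and e: "e \<in> carrier R"
  shows "abelian_monoid (corner R e)"
proof -
  interpret cring R by fact
  show ?thesis
  proof (rule abelian_monoidI)
    fix x y assume "x \<in> carrier (corner R e)" "y \<in> carrier (corner R e)"
    then obtain u v where uv: "x = u \<otimes>\<^bsub>R\<^esub> e" "y = v \<otimes>\<^bsub>R\<^esub> e" "u \<in> carrier R" "v \<in> carrier R"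
      by (auto simp: corner_simps)
    then have "x \<oplus>\<^bsub>R\<^esub> y = (u \<oplus>\<^bsub>R\<^esub> v) \<otimes>\<^bsub>R\<^esub> e"
      using e by (simp add: l_distr)
    then show "x \<oplus>\<^bsub>corner R e\<^esub> y \<in> carrier (corner R e)"
      using uv by (simp add: corner_simps)
    show "x \<oplus>\<^bsub>corner R e\<^esub> y = y \<oplus>\<^bsub>corner R e\<^esub> x"
      using uv e by (simp add: corner_simps a_comm)
  next
    show "\<zero>\<^bsub>corner R e\<^esub> \<in> carrier (corner R e)"
      using e unfolding corner_simps by (intro image_eqI[of _ _ "\<zero>\<^bsub>R\<^esub>"]) simp_all
  qed (use e in \<open>auto simp: corner_simps a_assoc\<close>)
qed

lemma crossed_product_mult:
  fixes S :: "('r, 's::comm_monoid_add) module"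
  assumes "abelian_monoid S" and "ring.add S = (+)" and "ring.zero S = 0"
    and "\<And>x y. x \<in> carrier H \<Longrightarrow> y \<in> carrier H \<Longrightarrow> x \<otimes>\<^bsub>H\<^esub> y = z \<Longrightarrow>
      f x \<otimes>\<^bsub>S\<^esub> \<sigma> x (g y) \<otimes>\<^bsub>S\<^esub> \<tau> x y \<in> carrier S"
  shows "(f \<otimes>\<^bsub>crossed_product S H \<sigma> \<tau>\<^esub> g) z =
    (\<Sum>p \<in> {(x, y). x \<in> carrier H \<and> y \<in> carrier H \<and> x \<otimes>\<^bsub>H\<^esub> y = z}.
       f (fst p) \<otimes>\<^bsub>S\<^esub> \<sigma> (fst p) (g (snd p)) \<otimes>\<^bsub>S\<^esub> \<tau> (fst p) (snd p))"
  unfolding crossed_product_def monoid.simps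
  by (rule finsum_conv_sum[OF assms(1-3)]) (auto simp: assms(4))

lemma crossed_product_simps:
  "carrier (crossed_product S H \<sigma> \<tau>) =
     {f. (\<forall>x\<in>carrier H. f x \<in> carrier S) \<and> (\<forall>x. x \<notin> carrier H \<longrightarrow> f x = \<zero>\<^bsub>S\<^esub>)}"
  "monoid.one (crossed_product S H \<sigma> \<tau>) = (\<lambda>x. if x = \<one>\<^bsub>H\<^esub> then \<one>\<^bsub>S\<^esub> else \<zero>\<^bsub>S\<^esub>)"
  "ring.add (crossed_product S H \<sigma> \<tau>) f g = (\<lambda>x. f x \<oplus>\<^bsub>S\<^esub> g x)"
  "module.smult (crossed_product S H \<sigma> \<tau>) c f = (\<lambda>x. c \<odot>\<^bsub>S\<^esub> f x)"
  by (simp_all add: crossed_product_def)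

lemma external_direct_sum_simps:
  "carrier (external_direct_sum I A) = (\<Pi>\<^sub>E i\<in>I. carrier (A i))"
  "monoid.mult (external_direct_sum I A) f g = (\<lambda>i\<in>I. f i \<otimes>\<^bsub>A i\<^esub> g i)"
  "monoid.one (external_direct_sum I A) = (\<lambda>i\<in>I. \<one>\<^bsub>A i\<^esub>)"
  "ring.add (external_direct_sum I A) f g = (\<lambda>i\<in>I. f i \<oplus>\<^bsub>A i\<^esub> g i)"
  "module.smult (external_direct_sum I A) c f = (\<lambda>i\<in>I. c \<odot>\<^bsub>A i\<^esub> f i)"
  by (simp_all add: external_direct_sum_def)

context finite_comm_group_field_hom
begin

section \<open>Linear extension of group automorphisms\<close>

abbreviation linext :: "('a \<Rightarrow> 'a) \<Rightarrow> ('a \<Rightarrow> 'f) \<Rightarrow> 'a \<Rightarrow> 'f" where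
  "linext s \<equiv> linear_extension (carrier H) s"

text \<open>Linear extension is the pushforward along \<open>s\<close>, so this is the change of
  variables formula. It holds for non-injective \<open>s\<close> as well, by grouping along the
  fibres.\<close>

lemma pairing_linext:
  assumes "field_hom j" and "s \<in> carrier H \<rightarrow> carrier H"
  shows "pairing j (carrier H) (linext s x) \<phi> = pairing j (carrier H) x (\<lambda>n. \<phi> (s n))"
proof -
  interpret j: field_hom j by fact
  have "pairing j (carrier H) (linext s x) \<phi> =
      (\<Sum>m\<in>carrier H. \<Sum>n\<in>{n \<in> carrier H. s n = m}. j (x n) * \<phi> (s n))"
    unfolding pairing_def linear_extension_def
    by (intro sum.cong refl) (auto simp: j.hom_sum sum_distrib_right intro!: sum.cong)
  also have "\<dots> = pairing j (carrier H) x (\<lambda>n. \<phi> (s n))"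
    unfolding pairing_def using assms(2) finite_H by (intro sum.group) auto
  finally show ?thesis .
qed

lemma linext_closed: "s \<in> carrier H \<rightarrow> carrier H \<Longrightarrow> linext s x \<in> carrier FH"
  by (auto simp: carrier_FH linear_extension_def intro!: sum.neutral)

lemma linext_add: "linext s (x + y) = linext s x + linext s y"
  by (auto simp: linear_extension_def sum.distrib)

lemma linext_zero: "linext s 0 = 0"
  by (auto simp: linear_extension_def)

lemma linext_sum: "linext s (sum f I) = (\<Sum>i\<in>I. linext s (f i))"
  by (induction I rule: infinite_finite_induct)
    (simp_all only: sum.infinite sum.empty sum.insert not_False_eq_True linext_zero linext_add)

lemma linext_mult:
  assumes "s \<in> hom H H"
  shows "linext s (x \<otimes>\<^bsub>FH\<^esub> y) = linext s x \<otimes>\<^bsub>FH\<^esub> linext s y"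
proof (rule FH_eqI)
  have s: "s \<in> carrier H \<rightarrow> carrier H"
    using assms by (simp add: hom_def)
  show "linext s (x \<otimes>\<^bsub>FH\<^esub> y) \<in> carrier FH"
    by (rule linext_closed[OF s])
  fix \<phi> :: "'a \<Rightarrow> 'f"
  have "pairing (\<lambda>c. c) (carrier H) (linext s x \<otimes>\<^bsub>FH\<^esub> linext s y) \<phi> =
      pairing (\<lambda>c. c) (carrier H) (linext s x)
        (\<lambda>a. pairing (\<lambda>c. c) (carrier H) (linext s y) (\<lambda>b. \<phi> (a \<otimes> b)))"
    by (rule pairing_mult_nested[OF field_hom_id])
  also have "\<dots> = pairing (\<lambda>c. c) (carrier H) (linext s (x \<otimes>\<^bsub>FH\<^esub> y)) \<phi>"
    unfolding pairing_linext[OF field_hom_id s] pairing_mult_eq[OF field_hom_id]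
    using assms by (simp add: pairing_def hom_def cong: sum.cong)
  finally show "pairing (\<lambda>c. c) (carrier H) (linext s (x \<otimes>\<^bsub>FH\<^esub> y)) \<phi> =
      pairing (\<lambda>c. c) (carrier H) (linext s x \<otimes>\<^bsub>FH\<^esub> linext s y) \<phi>"
    by simp
qed (rule mult_closed_FH)

lemma linext_comp:
  assumes "s \<in> carrier H \<rightarrow> carrier H" and "t \<in> carrier H \<rightarrow> carrier H"
    and "\<And>n. n \<in> carrier H \<Longrightarrow> s (t n) = u n"
  shows "linext s (linext t x) = linext u x"
proof (rule FH_eqI)
  have u: "u \<in> carrier H \<rightarrow> carrier H"
    using assms by (metis Pi_iff)
  show "linext u x \<in> carrier FH"
    by (rule linext_closed[OF u])
  show "pairing (\<lambda>c. c) (carrier H) (linext s (linext t x)) \<phi> =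
      pairing (\<lambda>c. c) (carrier H) (linext u x) \<phi>" for \<phi>
    unfolding pairing_linext[OF field_hom_id assms(1)] pairing_linext[OF field_hom_id assms(2)]
      pairing_linext[OF field_hom_id u]
    by (simp add: pairing_def assms(3))
qed (rule linext_closed[OF assms(1)])

lemma linext_id:
  assumes "\<And>n. n \<in> carrier H \<Longrightarrow> s n = n" and "x \<in> carrier FH"
  shows "linext s x = x"
proof (rule FH_eqI)
  have s: "s \<in> carrier H \<rightarrow> carrier H"
    using assms by simp
  show "linext s x \<in> carrier FH"
    by (rule linext_closed[OF s])
  show "pairing (\<lambda>c. c) (carrier H) (linext s x) \<phi> = pairing (\<lambda>c. c) (carrier H) x \<phi>" for \<phi>
    unfolding pairing_linext[OF field_hom_id s] by (simp add: pairing_def assms(1))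
qed (rule assms(2))

lemma ev_linext: "s \<in> carrier H \<rightarrow> carrier H \<Longrightarrow> ev \<chi> (linext s x) = ev (\<lambda>n. \<chi> (s n)) x"
  by (rule pairing_linext[OF emb.field_hom_axioms])

lemma ev_cong: "(\<And>n. n \<in> carrier H \<Longrightarrow> \<chi> n = \<chi>' n) \<Longrightarrow> ev \<chi> x = ev \<chi>' x"
  by (simp add: pairing_def)

lemma block_idempotent_cong:
  assumes "\<And>n. n \<in> carrier H \<Longrightarrow> \<chi> n = \<chi>' n"
  shows "block_idempotent \<chi> u \<longleftrightarrow> block_idempotent \<chi>' u"
  using ev_cong[of \<chi> \<chi>', OF assms] by (simp add: block_idempotent_def)

text \<open>Transport of structure along \<open>s\<close>. The character has to be composed with the
  inverse \<open>t\<close>, because evaluation at the new character after \<open>s\<close> must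
  return evaluation at \<open>\<chi>\<close>.\<close>

lemma block_idempotent_linext:
  assumes e: "block_idempotent \<chi> e" and s: "s \<in> hom H H" and t: "t \<in> hom H H"
    and st: "\<And>n. n \<in> carrier H \<Longrightarrow> s (t n) = n" and ts: "\<And>n. n \<in> carrier H \<Longrightarrow> t (s n) = n"
  shows "block_idempotent (\<lambda>n. \<chi> (t n)) (linext s e)"
proof -
  have s': "s \<in> carrier H \<rightarrow> carrier H" and t': "t \<in> carrier H \<rightarrow> carrier H"
    using s t by (simp_all add: hom_def)
  have "x \<otimes>\<^bsub>FH\<^esub> linext s e = 0" if x: "x \<in> carrier FH" "ev (\<lambda>n. \<chi> (t n)) x = 0" for x
  proof -
    have "linext t x \<otimes>\<^bsub>FH\<^esub> e = 0"
      using x(2) by (intro block_idempotentD(3)[OF e] linext_closed t') (simp add: ev_linext[OF t'])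
    then have "linext s (linext t x) \<otimes>\<^bsub>FH\<^esub> linext s e = 0"
      by (simp add: linext_mult[OF s, symmetric] linext_zero)
    moreover have "linext s (linext t x) = x"
      using linext_comp[OF s' t' st] linext_id x(1) by metis
    ultimately show ?thesis
      by simp
  qed
  moreover have "ev (\<lambda>n. \<chi> (t n)) (linext s e) = 1"
    using block_idempotentD(2)[OF e] ev_cong[of "\<lambda>n. \<chi> (t (s n))" \<chi> e] ts by (simp add: ev_linext[OF s'])
  ultimately show ?thesis
    using linext_closed[OF s'] by (simp add: block_idempotent_def)
qed

lemma nonzero_character_comp:
  "nonzero_character \<chi> \<Longrightarrow> t \<in> hom H H \<Longrightarrow> nonzero_character (\<lambda>n. \<chi> (t n))"
  by (auto simp: nonzero_character_def hom_def Pi_iff)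

text \<open>The composite of \<open>\<chi>\<close> with \<open>t\<close> may lie outside
  \<open>L\<close>, so the member of \<open>L\<close> is found through idempotents: the blocks of
  \<open>L\<close> sum to 1, hence one of them is not orthogonal to the image, and then it equals
  the image.\<close>

lemma is_Lin_linext:
  assumes L: "is_Lin \<iota> H L" and \<chi>: "\<chi> \<in> L" and s: "s \<in> hom H H" and t: "t \<in> hom H H"
    and st: "\<And>n. n \<in> carrier H \<Longrightarrow> s (t n) = n" and ts: "\<And>n. n \<in> carrier H \<Longrightarrow> t (s n) = n"
  shows "\<exists>\<chi>'\<in>L. linext s (char_idempotent \<iota> H \<chi>) = char_idempotent \<iota> H \<chi>'"
proof -
  let ?e = "char_idempotent \<iota> H" and ?f = "linext s (char_idempotent \<iota> H \<chi>)"
  note nz = is_Lin_linear[OF L \<chi>]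
  have f: "block_idempotent (\<lambda>n. \<chi> (t n)) ?f" and nzf: "nonzero_character (\<lambda>n. \<chi> (t n))"
    using block_idempotent_linext[OF char_idempotent_block[OF nz] s t st ts] nonzero_character_comp[OF nz t]
    by simp_all
  have e_closed: "?e \<chi>' \<in> carrier FH" if "\<chi>' \<in> L" for \<chi>'
    by (rule block_idempotentD(1)[OF char_idempotent_block[OF is_Lin_linear[OF L that]]])
  have "?f = ?f \<otimes>\<^bsub>FH\<^esub> \<one>\<^bsub>FH\<^esub>"
    using block_idempotentD(1)[OF f] by simp
  also have "\<dots> = (\<Sum>\<chi>'\<in>L. ?f \<otimes>\<^bsub>FH\<^esub> ?e \<chi>')"
    unfolding is_Lin_sum[OF L, symmetric] by (rule FH_mult_sum[OF e_closed block_idempotentD(1)[OF f]])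
  finally have "(\<Sum>\<chi>'\<in>L. ?f \<otimes>\<^bsub>FH\<^esub> ?e \<chi>') \<noteq> 0"
    using block_idempotent_nonzero[OF f] by simp
  then obtain \<chi>' where "\<chi>' \<in> L" "?f \<otimes>\<^bsub>FH\<^esub> ?e \<chi>' \<noteq> 0"
    by (rule sum.not_neutral_contains_not_neutral)
  then show ?thesis
    using block_idempotent_eq_or_orthogonal[OF nzf f is_Lin_linear[OF L] char_idempotent_block[OF is_Lin_linear[OF L]]]
    by blast
qed

section \<open>Sums of blocks over subsets of Lin\<close>

abbreviation block_sum :: "('a \<Rightarrow> 'k) set \<Rightarrow> 'a \<Rightarrow> 'f" where
  "block_sum C \<equiv> (\<Sum>\<chi>\<in>C. char_idempotent \<iota> H \<chi>)"

lemma char_idempotent_closed: "is_Lin \<iota> H L \<Longrightarrow> \<chi> \<in> L \<Longrightarrow> char_idempotent \<iota> H \<chi> \<in> carrier FH"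
  using block_idempotentD(1) char_idempotent_block is_Lin_linear by blast

lemma block_sum_closed: "is_Lin \<iota> H L \<Longrightarrow> C \<subseteq> L \<Longrightarrow> block_sum C \<in> carrier FH"
  using char_idempotent_closed by (intro FH_sum_closed) blast

lemma orbit_idempotent_eq: "is_Lin \<iota> H L \<Longrightarrow> C \<subseteq> L \<Longrightarrow> orbit_idempotent \<iota> H C = block_sum C"
  unfolding orbit_idempotent_def using char_idempotent_closed by (intro finsum_FH) blast

lemma char_idempotent_block_sum:
  assumes L: "is_Lin \<iota> H L" and C: "C \<subseteq> L" and \<chi>: "\<chi> \<in> L"
  shows "char_idempotent \<iota> H \<chi> \<otimes>\<^bsub>FH\<^esub> block_sum C = (if \<chi> \<in> C then char_idempotent \<iota> H \<chi> else 0)"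
proof -
  let ?e = "char_idempotent \<iota> H"
  have "?e \<chi> \<otimes>\<^bsub>FH\<^esub> block_sum C = (\<Sum>\<chi>'\<in>C. ?e \<chi> \<otimes>\<^bsub>FH\<^esub> ?e \<chi>')"
    using C \<chi> by (intro FH_mult_sum char_idempotent_closed[OF L]) auto
  also have "\<dots> = (\<Sum>\<chi>'\<in>C. if \<chi>' = \<chi> then ?e \<chi> else 0)"
  proof (intro sum.cong refl)
    fix \<chi>' assume "\<chi>' \<in> C"
    then show "?e \<chi> \<otimes>\<^bsub>FH\<^esub> ?e \<chi>' = (if \<chi>' = \<chi> then ?e \<chi> else 0)"
      using is_Lin_orthogonal[OF L \<chi>, of \<chi>'] C
        block_idempotent_idem[OF is_Lin_linear[OF L \<chi>] char_idempotent_block[OF is_Lin_linear[OF L \<chi>]]]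
      by auto
  qed
  also have "\<dots> = (if \<chi> \<in> C then ?e \<chi> else 0)"
    using finite_subset[OF C is_Lin_finite[OF L]] by simp
  finally show ?thesis .
qed

lemma block_sum_mult:
  assumes L: "is_Lin \<iota> H L" and C: "C \<subseteq> L" "D \<subseteq> L"
  shows "block_sum C \<otimes>\<^bsub>FH\<^esub> block_sum D = block_sum (C \<inter> D)"
proof -
  have "block_sum C \<otimes>\<^bsub>FH\<^esub> block_sum D = (\<Sum>\<chi>\<in>C. char_idempotent \<iota> H \<chi> \<otimes>\<^bsub>FH\<^esub> block_sum D)"
    using C by (intro FH_sum_mult char_idempotent_closed[OF L] block_sum_closed[OF L]) auto
  also have "\<dots> = (\<Sum>\<chi>\<in>C. if \<chi> \<in> D then char_idempotent \<iota> H \<chi> else 0)"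
    using C by (intro sum.cong refl char_idempotent_block_sum[OF L]) auto
  finally show ?thesis
    using finite_subset[OF C(1) is_Lin_finite[OF L]] by (simp only: sum.inter_restrict)
qed

lemma ev_block_sum:
  assumes L: "is_Lin \<iota> H L" and C: "C \<subseteq> L" and \<chi>: "\<chi> \<in> C"
  shows "ev \<chi> (block_sum C) = 1"
proof -
  have \<chi>L: "\<chi> \<in> L"
    using C \<chi> by blast
  note nz = is_Lin_linear[OF L \<chi>L]
  have "ev \<chi> (char_idempotent \<iota> H \<chi> \<otimes>\<^bsub>FH\<^esub> block_sum C) = 1"
    using \<chi> block_idempotentD(2)[OF char_idempotent_block[OF nz]] by (simp add: char_idempotent_block_sum[OF L C \<chi>L])
  then show ?thesis
    using block_idempotentD(2)[OF char_idempotent_block[OF nz]] by (simp add: ev_mult[OF nz])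
qed

text \<open>The isomorphism is the tuple of evaluations at the members of \<open>C\<close>. It is
  injective on the corner, since x times the block sum is the sum of the x e over the blocks, and
  each summand depends only on the corresponding value.\<close>

lemma corner_block_sum_iso:
  assumes L: "is_Lin \<iota> H L" and C: "C \<subseteq> L"
  shows "algebra_isomorphic (corner FH (block_sum C)) (external_direct_sum C (character_field \<iota> H))"
proof -
  let ?e = "char_idempotent \<iota> H" and ?E = "block_sum C"
  let ?h = "\<lambda>x. \<lambda>\<chi>\<in>C. ev \<chi> x"
  have nz: "nonzero_character \<chi>" if "\<chi> \<in> C" for \<chi>
    using is_Lin_linear[OF L] C that by blast
  note e = char_idempotent_block[OF nz]
  have field: "character_field \<iota> H \<chi> = scalar_algebra \<iota> (ev \<chi> ` carrier FH)" if "\<chi> \<in> C" for \<chi>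
    by (rule character_field_eq[OF nz[OF that]])
  have E: "ev \<chi> (x \<otimes>\<^bsub>FH\<^esub> ?E) = ev \<chi> x" if "\<chi> \<in> C" for \<chi> x
    by (simp add: ev_mult[OF nz[OF that]] ev_block_sum[OF L C that])
  have fin: "finite C"
    using finite_subset[OF C is_Lin_finite[OF L]] .
  have inj: "x \<otimes>\<^bsub>FH\<^esub> ?E = y \<otimes>\<^bsub>FH\<^esub> ?E"
    if xy: "x \<in> carrier FH" "y \<in> carrier FH" and eq: "\<And>\<chi>. \<chi> \<in> C \<Longrightarrow> ev \<chi> x = ev \<chi> y" for x y
  proof -
    have "x \<otimes>\<^bsub>FH\<^esub> ?E = (\<Sum>\<chi>\<in>C. x \<otimes>\<^bsub>FH\<^esub> ?e \<chi>)"
      using xy(1) block_idempotentD(1)[OF e] by (intro FH_mult_sum)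
    also have "\<dots> = (\<Sum>\<chi>\<in>C. y \<otimes>\<^bsub>FH\<^esub> ?e \<chi>)"
      using eq block_mult_eq_iff[OF nz e xy] by (intro sum.cong refl) blast
    also have "\<dots> = y \<otimes>\<^bsub>FH\<^esub> ?E"
      using xy(2) block_idempotentD(1)[OF e] by (intro FH_mult_sum[symmetric])
    finally show ?thesis .
  qed
  have surj: "\<exists>x\<in>carrier FH. ?h x = F" if F: "F \<in> (\<Pi>\<^sub>E \<chi>\<in>C. ev \<chi> ` carrier FH)" for F
  proof -
    have "\<forall>\<chi>\<in>C. \<exists>x. x \<in> carrier FH \<and> F \<chi> = ev \<chi> x"
      using F by blast
    then obtain u where u: "\<forall>\<chi>\<in>C. u \<chi> \<in> carrier FH \<and> F \<chi> = ev \<chi> (u \<chi>)"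
      by (rule bchoice[THEN exE])
    \<comment> \<open>As in the Chinese remainder theorem: by orthogonality, evaluation at one
      character sees only its own summand.\<close>
    let ?x = "\<Sum>\<chi>\<in>C. u \<chi> \<otimes>\<^bsub>FH\<^esub> ?e \<chi>"
    have "ev \<chi> ?x = F \<chi>" if \<chi>: "\<chi> \<in> C" for \<chi>
    proof -
      have "ev \<chi> (?e \<chi>') = (if \<chi>' = \<chi> then 1 else 0)" if "\<chi>' \<in> C" for \<chi>'
        using block_idempotentD(1,2)[OF e[OF \<open>\<chi> \<in> C\<close>]] block_idempotentD(1)[OF e[OF that]]
          block_mult_eq_zero_iff[OF nz[OF \<chi>] e[OF \<chi>], of "?e \<chi>'"] is_Lin_orthogonal[OF L, of \<chi>' \<chi>] that \<chi> C
        by auto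
      then have "ev \<chi> ?x = (\<Sum>\<chi>'\<in>C. if \<chi>' = \<chi> then ev \<chi> (u \<chi>) else 0)"
        unfolding ev_sum by (intro sum.cong refl) (simp add: ev_mult[OF nz[OF \<chi>]])
      then show ?thesis
        using \<chi> fin u by simp
    qed
    then have "?h ?x = F"
      using F by (intro extensionalityI[of _ C]) (auto simp: PiE_def)
    moreover have "?x \<in> carrier FH"
      by (intro FH_sum_closed mult_closed_FH)
    ultimately show ?thesis
      by blast
  qed
  have "bij_betw ?h ((\<lambda>x. x \<otimes>\<^bsub>FH\<^esub> ?E) ` carrier FH) (\<Pi>\<^sub>E \<chi>\<in>C. ev \<chi> ` carrier FH)"
    unfolding bij_betw_def
  proof
    have h: "?h (x \<otimes>\<^bsub>FH\<^esub> ?E) = ?h x" for x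
      by (auto simp: E)
    show "inj_on ?h ((\<lambda>x. x \<otimes>\<^bsub>FH\<^esub> ?E) ` carrier FH)"
    proof (rule inj_onI, elim imageE, simp only: h)
      fix x y assume xy: "x \<in> carrier FH" "y \<in> carrier FH" "?h x = ?h y"
      show "x \<otimes>\<^bsub>FH\<^esub> ?E = y \<otimes>\<^bsub>FH\<^esub> ?E"
      proof (rule inj[OF xy(1,2)])
        fix \<chi> assume "\<chi> \<in> C"
        then show "ev \<chi> x = ev \<chi> y"
          using fun_cong[OF xy(3), of \<chi>] by simp
      qed
    qed
    show "?h ` (\<lambda>x. x \<otimes>\<^bsub>FH\<^esub> ?E) ` carrier FH = (\<Pi>\<^sub>E \<chi>\<in>C. ev \<chi> ` carrier FH)"
      unfolding image_image h using surj by auto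
  qed
  moreover have carrier: "(\<Pi>\<^sub>E \<chi>\<in>C. carrier (character_field \<iota> H \<chi>)) = (\<Pi>\<^sub>E \<chi>\<in>C. ev \<chi> ` carrier FH)"
    by (intro PiE_cong) (simp add: field scalar_algebra_simps)
  ultimately have "?h \<in> ring_iso (corner FH ?E) (external_direct_sum C (character_field \<iota> H))"
    by (intro ring_iso_memI)
      (auto simp: corner_simps external_direct_sum_simps carrier field scalar_algebra_simps E
        ev_mult[OF nz] ev_add FH_simps ev_block_sum[OF L C] mult_closed_FH intro!: restrict_ext)
  then have "?h \<in> algebra_iso (corner FH ?E) (external_direct_sum C (character_field \<iota> H))"
    by (auto simp: algebra_iso_def corner_simps external_direct_sum_simps field scalar_algebra_simps
        FH_simps ev_smult intro!: restrict_ext)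
  then show ?thesis
    unfolding algebra_isomorphic_def by blast
qed

end

section \<open>Extensions with abelian kernel\<close>

locale finite_group_extension =
  fixes \<iota> :: "'f::field_char_0 \<Rightarrow> 'k::field"
    and \<Gamma> :: "('a, 'x) monoid_scheme" (structure) and G :: "('g, 'y) monoid_scheme"
    and p :: "'a \<Rightarrow> 'g" and N :: "'a set"
    and \<mu> :: "'g \<Rightarrow> 'a" and L :: "('a \<Rightarrow> 'k) set"
  assumes group_\<Gamma>: "group \<Gamma>" and finite_\<Gamma>: "finite (carrier \<Gamma>)"
    and group_G: "group G" and finite_G: "finite (carrier G)"
    and epi: "p \<in> epi \<Gamma> G" and N_kernel: "N = kernel \<Gamma> G p"
    and comm_N: "comm_group (\<Gamma>\<lparr>carrier := N\<rparr>)"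
    and normalized_\<mu>: "normalized_section \<Gamma> G p \<mu>"
    and field_hom_\<iota>: "field_hom \<iota>"
    and Lin: "is_Lin \<iota> (\<Gamma>\<lparr>carrier := N\<rparr>) L"
begin

sublocale \<Gamma>: group \<Gamma>
  by (rule group_\<Gamma>)

sublocale G: group G
  by (rule group_G)

sublocale p: group_hom \<Gamma> G p
  using epi by unfold_locales (simp add: epi_def)

abbreviation K :: "('a, 'x) monoid_scheme" where "K \<equiv> \<Gamma>\<lparr>carrier := N\<rparr>"

lemma N_subset: "N \<subseteq> carrier \<Gamma>"
  by (auto simp: N_kernel kernel_def)

lemma N_closed: "n \<in> N \<Longrightarrow> n \<in> carrier \<Gamma>"
  using N_subset by blast

lemma finite_N: "finite N"
  using finite_subset[OF N_subset finite_\<Gamma>] .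

lemma N_iff: "n \<in> N \<longleftrightarrow> n \<in> carrier \<Gamma> \<and> p n = \<one>\<^bsub>G\<^esub>"
  by (auto simp: N_kernel kernel_def)

text \<open>The \<open>rewrites\<close> remove the projections of the updated record, so that the
  results for abelian groups speak of \<open>N\<close> and the operations of \<Gamma>.\<close>

sublocale N: finite_comm_group_field_hom K \<iota>
  rewrites "carrier (\<Gamma>\<lparr>carrier := N\<rparr>) = N"
    and "monoid.mult (\<Gamma>\<lparr>carrier := N\<rparr>) = monoid.mult \<Gamma>"
    and "monoid.one (\<Gamma>\<lparr>carrier := N\<rparr>) = monoid.one \<Gamma>"
proof -
  interpret comm_group K
    by (rule comm_N)
  interpret field_hom \<iota>
    by (rule field_hom_\<iota>)
  show "finite_comm_group_field_hom K \<iota>"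
    by unfold_locales (simp add: finite_N)
qed simp_all

abbreviation A :: "('f, 'a \<Rightarrow> 'f) module" where "A \<equiv> group_algebra K"

abbreviation \<sigma> :: "'g \<Rightarrow> 'a \<Rightarrow> 'a" where "\<sigma> \<equiv> section_conj \<Gamma> \<mu>"

abbreviation \<alpha> :: "'g \<Rightarrow> 'g \<Rightarrow> 'a" where "\<alpha> \<equiv> section_cocycle \<Gamma> G \<mu>"

abbreviation S :: "'g \<Rightarrow> ('a \<Rightarrow> 'f) \<Rightarrow> 'a \<Rightarrow> 'f" where "S g \<equiv> linear_extension N (\<sigma> g)"

abbreviation e :: "('a \<Rightarrow> 'k) \<Rightarrow> 'a \<Rightarrow> 'f" where "e \<equiv> char_idempotent \<iota> K"

abbreviation E :: "('a \<Rightarrow> 'k) set \<Rightarrow> 'a \<Rightarrow> 'f" where "E \<equiv> N.block_sum"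

abbreviation orb :: "('a \<Rightarrow> 'k) \<Rightarrow> ('a \<Rightarrow> 'k) set" where "orb \<equiv> Lin_orbit \<iota> \<Gamma> G N \<mu> L"

section \<open>Conjugation and multiplication of cosets\<close>

lemma \<mu>_closed: "g \<in> carrier G \<Longrightarrow> \<mu> g \<in> carrier \<Gamma>"
  and p_\<mu>: "g \<in> carrier G \<Longrightarrow> p (\<mu> g) = g"
  and \<mu>_one: "\<mu> \<one>\<^bsub>G\<^esub> = \<one>"
  using normalized_\<mu> by (auto simp: normalized_section_def)

lemma \<sigma>_closed:
  assumes "g \<in> carrier G" and "n \<in> N"
  shows "\<sigma> g n \<in> N"
  using assms \<mu>_closed p_\<mu> by (simp add: N_iff section_conj_def)

lemma \<alpha>_closed:
  assumes "g \<in> carrier G" and "h \<in> carrier G"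
  shows "\<alpha> g h \<in> N"
  using assms \<mu>_closed p_\<mu> by (simp add: N_iff section_cocycle_def)

lemma \<sigma>_\<mu>: "g \<in> carrier G \<Longrightarrow> n \<in> N \<Longrightarrow> \<mu> g \<otimes> n = \<sigma> g n \<otimes> \<mu> g"
  by (simp add: section_conj_def \<mu>_closed N_closed \<Gamma>.m_assoc)

lemma \<mu>_mult: "g \<in> carrier G \<Longrightarrow> h \<in> carrier G \<Longrightarrow> \<mu> g \<otimes> \<mu> h = \<alpha> g h \<otimes> \<mu> (g \<otimes>\<^bsub>G\<^esub> h)"
  by (simp add: section_cocycle_def \<mu>_closed \<Gamma>.m_assoc)

lemma \<sigma>_hom: "g \<in> carrier G \<Longrightarrow> \<sigma> g \<in> hom K K"
  by (auto simp: hom_def \<sigma>_closed) (simp add: section_conj_def \<mu>_closed N_closed \<Gamma>.m_assoc \<Gamma>.inv_solve_left)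

lemma \<sigma>_one: "n \<in> N \<Longrightarrow> \<sigma> \<one>\<^bsub>G\<^esub> n = n"
  by (simp add: section_conj_def \<mu>_one N_closed)

lemma N_comm: "m \<in> N \<Longrightarrow> n \<in> N \<Longrightarrow> m \<otimes> n = n \<otimes> m"
  by (rule N.m_comm)

text \<open>The two sides differ by conjugation with \<alpha>(g,h), which is trivial because
  \<alpha>(g,h) lies in the abelian group \<open>N\<close>. So conjugation by the section is an
  honest action of G, although the section need not be multiplicative.\<close>

lemma \<sigma>_comp:
  assumes g: "g \<in> carrier G" and h: "h \<in> carrier G" and n: "n \<in> N"
  shows "\<sigma> g (\<sigma> h n) = \<sigma> (g \<otimes>\<^bsub>G\<^esub> h) n"
proof -
  let ?a = "\<alpha> g h" and ?m = "\<mu> (g \<otimes>\<^bsub>G\<^esub> h)"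
  have cl: "?a \<in> carrier \<Gamma>" "?m \<in> carrier \<Gamma>" "\<mu> g \<in> carrier \<Gamma>" "\<mu> h \<in> carrier \<Gamma>" "n \<in> carrier \<Gamma>"
    "\<sigma> h n \<in> carrier \<Gamma>" "\<sigma> g (\<sigma> h n) \<in> carrier \<Gamma>" "\<sigma> (g \<otimes>\<^bsub>G\<^esub> h) n \<in> carrier \<Gamma>"
    using assms \<mu>_closed \<alpha>_closed \<sigma>_closed N_closed by simp_all
  have "\<sigma> g (\<sigma> h n) \<otimes> (?a \<otimes> ?m) = \<sigma> g (\<sigma> h n) \<otimes> \<mu> g \<otimes> \<mu> h"
    using cl by (simp add: \<mu>_mult[OF g h, symmetric] \<Gamma>.m_assoc)
  also have "\<dots> = \<mu> g \<otimes> (\<sigma> h n \<otimes> \<mu> h)"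
    using cl by (simp add: \<sigma>_\<mu>[OF g \<sigma>_closed[OF h n], symmetric] \<Gamma>.m_assoc)
  also have "\<dots> = \<mu> g \<otimes> \<mu> h \<otimes> n"
    using cl by (simp add: \<sigma>_\<mu>[OF h n, symmetric] \<Gamma>.m_assoc)
  also have "\<dots> = ?a \<otimes> (\<sigma> (g \<otimes>\<^bsub>G\<^esub> h) n \<otimes> ?m)"
    using cl g h n by (simp add: \<mu>_mult[OF g h] \<sigma>_\<mu>[symmetric] \<Gamma>.m_assoc)
  also have "\<dots> = \<sigma> (g \<otimes>\<^bsub>G\<^esub> h) n \<otimes> (?a \<otimes> ?m)"
    using cl N_comm[OF \<alpha>_closed[OF g h] \<sigma>_closed[OF G.m_closed[OF g h] n]]
    by (simp add: \<Gamma>.m_assoc[symmetric])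
  finally show ?thesis
    using cl by simp
qed

text \<open>Moving \<open>\<mu> g\<close> past \<open>b\<close> costs \<sigma>, and merging the two
  sections costs \<alpha>. On the level of group elements these are already the skewing and the
  twisting.\<close>

lemma coset_mult:
  assumes "g \<in> carrier G" and "h \<in> carrier G" and "a \<in> N" and "b \<in> N"
  shows "(a \<otimes> \<mu> g) \<otimes> (b \<otimes> \<mu> h) = (a \<otimes> \<sigma> g b \<otimes> \<alpha> g h) \<otimes> \<mu> (g \<otimes>\<^bsub>G\<^esub> h)"
proof -
  have cl: "a \<in> carrier \<Gamma>" "b \<in> carrier \<Gamma>" "\<mu> g \<in> carrier \<Gamma>" "\<mu> h \<in> carrier \<Gamma>" "\<mu> (g \<otimes>\<^bsub>G\<^esub> h) \<in> carrier \<Gamma>"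
    "\<sigma> g b \<in> carrier \<Gamma>" "\<alpha> g h \<in> carrier \<Gamma>"
    using assms \<mu>_closed \<alpha>_closed \<sigma>_closed N_closed by simp_all
  have "(a \<otimes> \<mu> g) \<otimes> (b \<otimes> \<mu> h) = a \<otimes> (\<mu> g \<otimes> b) \<otimes> \<mu> h"
    using cl by (simp add: \<Gamma>.m_assoc)
  also have "\<dots> = a \<otimes> \<sigma> g b \<otimes> (\<mu> g \<otimes> \<mu> h)"
    using cl by (simp add: \<sigma>_\<mu>[OF assms(1,4)] \<Gamma>.m_assoc)
  finally show ?thesis
    using cl by (simp add: \<mu>_mult[OF assms(1,2)] \<Gamma>.m_assoc)
qed

lemma p_coset: "g \<in> carrier G \<Longrightarrow> n \<in> N \<Longrightarrow> p (n \<otimes> \<mu> g) = g"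
  using N_iff by (simp add: \<mu>_closed p_\<mu>)

lemma coset_closed: "g \<in> carrier G \<Longrightarrow> n \<in> N \<Longrightarrow> n \<otimes> \<mu> g \<in> carrier \<Gamma>"
  by (simp add: \<mu>_closed N_closed)

lemma coset_rep: "g \<in> carrier G \<Longrightarrow> n \<in> N \<Longrightarrow> n \<otimes> \<mu> g \<otimes> inv (\<mu> g) = n"
  by (simp add: \<mu>_closed N_closed \<Gamma>.m_assoc)

lemma rep_closed: "x \<in> carrier \<Gamma> \<Longrightarrow> x \<otimes> inv (\<mu> (p x)) \<in> N"
  by (simp add: N_iff \<mu>_closed p_\<mu>)

lemma rep_coset: "x \<in> carrier \<Gamma> \<Longrightarrow> x \<otimes> inv (\<mu> (p x)) \<otimes> \<mu> (p x) = x"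
  by (simp add: \<mu>_closed \<Gamma>.m_assoc)

lemma sum_\<Gamma>: "(\<Sum>x\<in>carrier \<Gamma>. F x) = (\<Sum>g\<in>carrier G. \<Sum>n\<in>N. F (n \<otimes> \<mu> g))"
proof -
  have "(\<Sum>x\<in>carrier \<Gamma>. F x) = (\<Sum>q\<in>carrier G \<times> N. F (snd q \<otimes> \<mu> (fst q)))"
    by (rule sum.reindex_bij_witness[where j = "\<lambda>x. (p x, x \<otimes> inv (\<mu> (p x)))" and i = "\<lambda>q. snd q \<otimes> \<mu> (fst q)"])
      (auto simp: rep_closed rep_coset p_coset coset_rep coset_closed)
  then show ?thesis
    by (simp add: sum.cartesian_product split_def)
qed

section \<open>The action of G on idempotents and its orbits\<close>

lemma S_closed: "g \<in> carrier G \<Longrightarrow> S g x \<in> carrier A"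
  by (rule N.linext_closed) (auto simp: \<sigma>_closed)

lemma S_mult: "g \<in> carrier G \<Longrightarrow> S g (x \<otimes>\<^bsub>A\<^esub> y) = S g x \<otimes>\<^bsub>A\<^esub> S g y"
  by (rule N.linext_mult[OF \<sigma>_hom])

lemma S_comp: "g \<in> carrier G \<Longrightarrow> h \<in> carrier G \<Longrightarrow> S g (S h x) = S (g \<otimes>\<^bsub>G\<^esub> h) x"
  by (rule N.linext_comp) (auto simp: \<sigma>_closed \<sigma>_comp)

lemma S_one: "x \<in> carrier A \<Longrightarrow> S \<one>\<^bsub>G\<^esub> x = x"
  by (rule N.linext_id) (auto simp: \<sigma>_one)

lemma S_inv:
  assumes "g \<in> carrier G" and "x \<in> carrier A"
  shows "S (inv\<^bsub>G\<^esub> g) (S g x) = x"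
  using assms by (simp add: S_comp S_one)

lemma e_closed: "\<chi> \<in> L \<Longrightarrow> e \<chi> \<in> carrier A"
  by (rule N.char_idempotent_closed[OF Lin])

lemma S_e:
  assumes "g \<in> carrier G" and "\<chi> \<in> L"
  shows "\<exists>\<chi>'\<in>L. S g (e \<chi>) = e \<chi>'"
  using assms
  by (intro N.is_Lin_linext[OF Lin, where t = "\<sigma> (inv\<^bsub>G\<^esub> g)"]) (auto simp: \<sigma>_hom \<sigma>_comp \<sigma>_one)

lemma orb_iff: "\<chi>' \<in> orb \<chi> \<longleftrightarrow> \<chi>' \<in> L \<and> (\<exists>g\<in>carrier G. e \<chi>' = S g (e \<chi>))"
  by (simp add: Lin_orbit_def)

lemma orb_subset: "orb \<chi> \<subseteq> L"
  by (auto simp: orb_iff)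

lemma orb_self: "\<chi> \<in> L \<Longrightarrow> \<chi> \<in> orb \<chi>"
  using S_one[OF e_closed] G.one_closed unfolding orb_iff by metis

lemma orb_eq:
  assumes \<chi>: "\<chi> \<in> L" and \<chi>': "\<chi>' \<in> orb \<chi>"
  shows "orb \<chi>' = orb \<chi>"
proof -
  obtain g where g: "g \<in> carrier G" "e \<chi>' = S g (e \<chi>)"
    using \<chi>' by (auto simp: orb_iff)
  have g': "e \<chi> = S (inv\<^bsub>G\<^esub> g) (e \<chi>')"
    using g \<chi> by (simp add: S_inv e_closed)
  have "\<exists>k\<in>carrier G. x = S k (e \<chi>)" if "h \<in> carrier G" "x = S h (e \<chi>')" for h x
    using that g by (intro bexI[of _ "h \<otimes>\<^bsub>G\<^esub> g"]) (simp_all add: S_comp)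
  moreover have "\<exists>k\<in>carrier G. x = S k (e \<chi>')" if "h \<in> carrier G" "x = S h (e \<chi>)" for h x
  proof (rule bexI[of _ "h \<otimes>\<^bsub>G\<^esub> inv\<^bsub>G\<^esub> g"])
    show "x = S (h \<otimes>\<^bsub>G\<^esub> inv\<^bsub>G\<^esub> g) (e \<chi>')"
      using that g(1) S_comp[of h "inv\<^bsub>G\<^esub> g" "e \<chi>'"] g' by simp
  qed (use that g in simp)
  ultimately show ?thesis
    by (auto simp: orb_iff)
qed

text \<open>Orbits are the fibres of \<open>orb\<close>, so a sum over \<open>L\<close> can be
  regrouped into a sum over orbits.\<close>

lemma orb_fibre: "C \<in> orb ` L \<Longrightarrow> {\<chi> \<in> L. orb \<chi> = C} = C"
  using orb_eq orb_self orb_subset by blast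

lemma orb_image_subset: "C \<in> orb ` L \<Longrightarrow> C \<subseteq> L"
  using orb_subset by blast

lemma finite_L: "finite L"
  by (rule N.is_Lin_finite[OF Lin])

lemma E_closed: "C \<in> orb ` L \<Longrightarrow> E C \<in> carrier A"
  using N.block_sum_closed[OF Lin] orb_image_subset by blast

lemma E_idem: "C \<in> orb ` L \<Longrightarrow> E C \<otimes>\<^bsub>A\<^esub> E C = E C"
  by (simp add: N.block_sum_mult[OF Lin] orb_image_subset)

lemma E_orthogonal:
  assumes "C \<in> orb ` L" and "D \<in> orb ` L" and "C \<noteq> D"
  shows "E C \<otimes>\<^bsub>A\<^esub> E D = 0"
proof -
  have "C \<inter> D = {}"
    using orb_fibre[OF assms(1)] orb_fibre[OF assms(2)] assms(3) by blast
  then show ?thesis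
    by (simp only: N.block_sum_mult[OF Lin orb_image_subset[OF assms(1)] orb_image_subset[OF assms(2)]] sum.empty)
qed

lemma sum_E: "(\<Sum>C\<in>orb ` L. E C) = \<one>\<^bsub>A\<^esub>"
proof -
  have "(\<Sum>\<chi>\<in>L. e \<chi>) = (\<Sum>C\<in>orb ` L. \<Sum>\<chi>\<in>{\<chi> \<in> L. orb \<chi> = C}. e \<chi>)"
    by (rule sum.image_gen[OF finite_L])
  also have "\<dots> = (\<Sum>C\<in>orb ` L. E C)"
    by (intro sum.cong refl) (simp only: orb_fibre)
  finally show ?thesis
    using N.is_Lin_sum[OF Lin] by simp
qed

text \<open>\<open>S g\<close> maps the finite set of idempotents of an orbit injectively into
  itself, hence permutes it and fixes its sum. Consequently the orbit sum passes through the skewing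
  unchanged.\<close>

lemma S_E:
  assumes g: "g \<in> carrier G" and C: "C \<in> orb ` L"
  shows "S g (E C) = E C"
proof -
  obtain \<chi> where \<chi>: "\<chi> \<in> L" "C = orb \<chi>"
    using C by blast
  have CL: "C \<subseteq> L"
    by (rule orb_image_subset[OF C])
  have fin: "finite C"
    using finite_subset[OF CL finite_L] .
  have inj_e: "inj_on e C"
    using N.is_Lin_inj[OF Lin] CL by (auto intro!: inj_onI)
  have e_C: "e \<chi>' \<in> carrier A" if "\<chi>' \<in> C" for \<chi>'
    using e_closed CL that by blast
  have inj_S: "inj_on (S g) (e ` C)"
    using S_inv[OF g] e_C by (auto intro!: inj_onI) metis
  have "S g (e \<chi>') \<in> e ` C" if \<chi>': "\<chi>' \<in> C" for \<chi>'
  proof -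
    obtain \<chi>'' where \<chi>'': "\<chi>'' \<in> L" "S g (e \<chi>') = e \<chi>''"
      using S_e[OF g] CL \<chi>' by blast
    then have "\<chi>'' \<in> orb \<chi>'"
      using g by (auto simp: orb_iff intro!: bexI[of _ g])
    then have "\<chi>'' \<in> C"
      using orb_eq[OF \<chi>(1)] \<chi>' \<chi>(2) by blast
    then show ?thesis
      using \<chi>'' by blast
  qed
  then have "S g ` e ` C = e ` C"
    using fin inj_S by (intro card_subset_eq) (auto simp: card_image)
  have "S g (E C) = (\<Sum>\<chi>\<in>C. S g (e \<chi>))"
    by (rule N.linext_sum)
  also have "\<dots> = (\<Sum>x\<in>e ` C. S g x)"
    by (simp only: sum.reindex[OF inj_e] o_def)
  also have "\<dots> = (\<Sum>x\<in>S g ` e ` C. x)"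
    by (simp only: sum.reindex[OF inj_S] o_def)
  also have "\<dots> = (\<Sum>x\<in>e ` C. x)"
    by (simp only: \<open>S g ` e ` C = e ` C\<close>)
  also have "\<dots> = E C"
    by (simp only: sum.reindex[OF inj_e] o_def)
  finally show ?thesis .
qed

end

section \<open>Crossed products over orbits\<close>

context finite_group_extension
begin

text \<open>The coefficient at g when the basis element of \<open>n \<otimes> \<mu> g\<close> in the
  twisted group algebra is read as n times the basis element of g, that is, as an element of a left
  module over FN.\<close>

definition coset_coeffs :: "('a \<Rightarrow> 'f) \<Rightarrow> 'g \<Rightarrow> 'a \<Rightarrow> 'f" where
  "coset_coeffs f g = (\<lambda>n. if n \<in> N then f (n \<otimes> \<mu> g) else 0)"

abbreviation twisted :: "('g \<Rightarrow> 'g \<Rightarrow> 'f) \<Rightarrow> ('f, 'a \<Rightarrow> 'f) module" where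
  "twisted \<beta> \<equiv> twisted_group_algebra base_algebra \<Gamma> (\<lambda>x y. \<beta> (p x) (p y))"

abbreviation factors :: "'g \<Rightarrow> ('g \<times> 'g) set" where
  "factors z \<equiv> {(x, y). x \<in> carrier G \<and> y \<in> carrier G \<and> x \<otimes>\<^bsub>G\<^esub> y = z}"

lemma coset_coeffs_closed: "coset_coeffs f g \<in> carrier A"
  by (simp add: N.carrier_FH coset_coeffs_def)

lemma coset_coeffs_add: "coset_coeffs (f + f') g = coset_coeffs f g + coset_coeffs f' g"
  by (auto simp: coset_coeffs_def)

lemma coset_coeffs_scale: "coset_coeffs (\<lambda>x. c * f x) g = fun_scale c (coset_coeffs f g)"
  by (auto simp: coset_coeffs_def fun_scale_def)

text \<open>The test function is shifted to the coset over \<open>g\<close> and extended by zero, so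
  that a pairing on \<open>N\<close> becomes one on all of \<Gamma>, where the product formula
  applies.\<close>

lemma pairing_coset_coeffs:
  assumes "g \<in> carrier G"
  shows "pairing (\<lambda>c. c) N (coset_coeffs f g) \<phi> =
    pairing (\<lambda>c. c) (carrier \<Gamma>) f (\<lambda>x. if p x = g then \<phi> (x \<otimes> inv (\<mu> g)) else 0)"
proof -
  have "pairing (\<lambda>c. c) (carrier \<Gamma>) f (\<lambda>x. if p x = g then \<phi> (x \<otimes> inv (\<mu> g)) else 0) =
      (\<Sum>h\<in>carrier G. if h = g then \<Sum>n\<in>N. f (n \<otimes> \<mu> g) * \<phi> n else 0)"
    unfolding pairing_def sum_\<Gamma> by (intro sum.cong refl) (simp add: p_coset coset_rep assms cong: sum.cong)
  also have "\<dots> = pairing (\<lambda>c. c) N (coset_coeffs f g) \<phi>"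
    using assms finite_G by (simp add: pairing_def coset_coeffs_def)
  finally show ?thesis
    by simp
qed

lemma pairing_crossed_term:
  assumes "g \<in> carrier G" and "a \<in> N"
  shows "pairing (\<lambda>c. c) N (x \<otimes>\<^bsub>A\<^esub> S g y \<otimes>\<^bsub>A\<^esub> fun_scale c (basis_elem a)) \<phi> =
    (\<Sum>k\<in>N. \<Sum>l\<in>N. x k * y l * c * \<phi> (k \<otimes> \<sigma> g l \<otimes> a))"
proof -
  have \<sigma>: "\<sigma> g \<in> N \<rightarrow> N"
    using assms(1) \<sigma>_closed by blast
  show ?thesis
    unfolding N.pairing_mult_nested[OF field_hom_id] N.pairing_fun_scale N.pairing_linext[OF field_hom_id \<sigma>]
    by (simp add: N.pairing_basis_elem[OF field_hom_id assms(2)])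
      (simp add: pairing_def sum_distrib_left mult.assoc)
qed

lemma sum_factors:
  "(\<Sum>q\<in>factors z. F q) = (\<Sum>x\<in>carrier G. \<Sum>y\<in>carrier G. if x \<otimes>\<^bsub>G\<^esub> y = z then F (x, y) else 0)"
proof -
  have "factors z = {q \<in> carrier G \<times> carrier G. fst q \<otimes>\<^bsub>G\<^esub> snd q = z}"
    by auto
  then have "(\<Sum>q\<in>factors z. F q) = (\<Sum>q\<in>carrier G \<times> carrier G. if fst q \<otimes>\<^bsub>G\<^esub> snd q = z then F q else 0)"
    using finite_G by (simp only: sum.inter_filter[symmetric] finite_cartesian_product)
  then show ?thesis
    by (simp only: sum.cartesian_product split_def prod.collapse)
qed

text \<open>This identifies the twisted group algebra of \<Gamma> with a crossed product of G over
  FN, before any splitting into blocks. After pairing with a test function, both sides become sums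
  over pairs of elements of \<Gamma> arranged by cosets.\<close>

lemma coset_coeffs_mult:
  assumes z: "z \<in> carrier G"
  shows "coset_coeffs (f \<otimes>\<^bsub>twisted \<beta>\<^esub> f') z =
    (\<Sum>q\<in>factors z. coset_coeffs f (fst q) \<otimes>\<^bsub>A\<^esub> S (fst q) (coset_coeffs f' (snd q)) \<otimes>\<^bsub>A\<^esub>
       fun_scale (\<beta> (fst q) (snd q)) (basis_elem (\<alpha> (fst q) (snd q))))"
    (is "_ = (\<Sum>q\<in>_. ?t q)")
proof (rule N.FH_eqI)
  show "(\<Sum>q\<in>factors z. ?t q) \<in> carrier A"
    by (intro N.FH_sum_closed N.mult_closed_FH)
  fix \<phi> :: "'a \<Rightarrow> 'f"
  let ?\<phi> = "\<lambda>x. if p x = z then \<phi> (x \<otimes> inv (\<mu> z)) else 0"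
  let ?s = "\<lambda>g h. \<Sum>k\<in>N. \<Sum>l\<in>N. f (k \<otimes> \<mu> g) * f' (l \<otimes> \<mu> h) * \<beta> g h * \<phi> (k \<otimes> \<sigma> g l \<otimes> \<alpha> g h)"
  have "pairing (\<lambda>c. c) N (coset_coeffs (f \<otimes>\<^bsub>twisted \<beta>\<^esub> f') z) \<phi> =
      (\<Sum>x\<in>carrier \<Gamma>. \<Sum>y\<in>carrier \<Gamma>. f x * f' y * \<beta> (p x) (p y) * ?\<phi> (x \<otimes> y))"
    unfolding pairing_coset_coeffs[OF z] by (rule pairing_twisted_mult[OF field_hom_id group_\<Gamma> finite_\<Gamma>])
  \<comment> \<open>Both variables are split as k \<mu>(g) and l \<mu>(h). By
    \<open>coset_mult\<close> their product lies over g h and has N-part k \<sigma>_g(l)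
    \<alpha>(g,h); as \<beta> is inflated, it depends on g and h alone.\<close>
  also have "\<dots> = (\<Sum>g\<in>carrier G. \<Sum>k\<in>N. \<Sum>h\<in>carrier G. \<Sum>l\<in>N. f (k \<otimes> \<mu> g) * f' (l \<otimes> \<mu> h) *
      \<beta> g h * (if g \<otimes>\<^bsub>G\<^esub> h = z then \<phi> (k \<otimes> \<sigma> g l \<otimes> \<alpha> g h) else 0))"
    unfolding sum_\<Gamma>
    by (intro sum.cong refl)
      (auto simp: p_coset coset_mult coset_rep \<sigma>_closed \<alpha>_closed coset_closed)
  also have "\<dots> = (\<Sum>g\<in>carrier G. \<Sum>h\<in>carrier G. \<Sum>k\<in>N. \<Sum>l\<in>N. f (k \<otimes> \<mu> g) * f' (l \<otimes> \<mu> h) *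
      \<beta> g h * (if g \<otimes>\<^bsub>G\<^esub> h = z then \<phi> (k \<otimes> \<sigma> g l \<otimes> \<alpha> g h) else 0))"
    by (intro sum.cong refl) (rule sum.swap)
  also have "\<dots> = (\<Sum>g\<in>carrier G. \<Sum>h\<in>carrier G. if g \<otimes>\<^bsub>G\<^esub> h = z then ?s g h else 0)"
    by (intro sum.cong refl) simp
  also have "\<dots> = (\<Sum>g\<in>carrier G. \<Sum>h\<in>carrier G. if g \<otimes>\<^bsub>G\<^esub> h = z then pairing (\<lambda>c. c) N (?t (g, h)) \<phi> else 0)"
    by (intro sum.cong refl)
      (simp add: pairing_crossed_term \<alpha>_closed, simp add: coset_coeffs_def cong: sum.cong)
  also have "\<dots> = pairing (\<lambda>c. c) N (\<Sum>q\<in>factors z. ?t q) \<phi>"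
    by (subst N.pairing_sum) (simp only: sum_factors)
  finally show "pairing (\<lambda>c. c) N (coset_coeffs (f \<otimes>\<^bsub>twisted \<beta>\<^esub> f') z) \<phi> =
      pairing (\<lambda>c. c) N (\<Sum>q\<in>factors z. ?t q) \<phi>" .
qed (rule coset_coeffs_closed)

section \<open>Cutting the crossed product by orbit sums\<close>

lemma orbit_crossed_product_eq:
  assumes "C \<in> orb ` L"
  shows "orbit_crossed_product \<iota> \<Gamma> G N \<mu> \<beta> C = crossed_product (corner A (E C)) G S
    (\<lambda>g h. E C \<otimes>\<^bsub>A\<^esub> fun_scale (\<beta> g h) (basis_elem (\<alpha> g h)))"
  by (simp add: orbit_crossed_product_def orbit_algebra_def Let_def N.FH_smult
      N.orbit_idempotent_eq[OF Lin orb_image_subset[OF assms]])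

lemma twist_closed:
  "g \<in> carrier G \<Longrightarrow> h \<in> carrier G \<Longrightarrow> fun_scale (\<beta> g h) (basis_elem (\<alpha> g h)) \<in> carrier A"
  by (intro N.fun_scale_closed N.basis_elem_closed \<alpha>_closed)

lemma orbit_crossed_product_mult:
  assumes C: "C \<in> orb ` L"
  shows "(f \<otimes>\<^bsub>orbit_crossed_product \<iota> \<Gamma> G N \<mu> \<beta> C\<^esub> f') z =
    (\<Sum>q\<in>factors z. f (fst q) \<otimes>\<^bsub>A\<^esub> S (fst q) (f' (snd q)) \<otimes>\<^bsub>A\<^esub>
      (E C \<otimes>\<^bsub>A\<^esub> fun_scale (\<beta> (fst q) (snd q)) (basis_elem (\<alpha> (fst q) (snd q)))))"
proof -
  have mem: "f x \<otimes>\<^bsub>A\<^esub> S x (f' y) \<otimes>\<^bsub>A\<^esub> (E C \<otimes>\<^bsub>A\<^esub> fun_scale (\<beta> x y) (basis_elem (\<alpha> x y)))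
      \<in> (\<lambda>x. x \<otimes>\<^bsub>A\<^esub> E C) ` carrier A" if "x \<in> carrier G" "y \<in> carrier G" for x y
    using twist_closed[OF that, of \<beta>] E_closed[OF C] N.mult_closed_FH[of "f x" "S x (f' y)"]
    by (intro image_eqI[of _ _ "f x \<otimes>\<^bsub>A\<^esub> S x (f' y) \<otimes>\<^bsub>A\<^esub> fun_scale (\<beta> x y) (basis_elem (\<alpha> x y))"])
      (simp_all add: N.mult_closed_FH N.FH.m_assoc N.FH_mult_comm[of "E C"])
  show ?thesis
    unfolding orbit_crossed_product_eq[OF C]
    by (subst crossed_product_mult[OF abelian_monoid_corner[OF N.FH_cring E_closed[OF C]]])
      (simp_all add: corner_simps N.FH_simps mem)
qed

lemma orbit_crossed_product_simps:
  assumes "C \<in> orb ` L"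
  shows "f \<in> carrier (orbit_crossed_product \<iota> \<Gamma> G N \<mu> \<beta> C) \<longleftrightarrow>
      (\<forall>g\<in>carrier G. f g \<in> (\<lambda>x. x \<otimes>\<^bsub>A\<^esub> E C) ` carrier A) \<and> (\<forall>g. g \<notin> carrier G \<longrightarrow> f g = 0)"
    and "monoid.one (orbit_crossed_product \<iota> \<Gamma> G N \<mu> \<beta> C) = (\<lambda>g. if g = \<one>\<^bsub>G\<^esub> then E C else 0)"
    and "f \<oplus>\<^bsub>orbit_crossed_product \<iota> \<Gamma> G N \<mu> \<beta> C\<^esub> f' = (\<lambda>g. f g + f' g)"
    and "c \<odot>\<^bsub>orbit_crossed_product \<iota> \<Gamma> G N \<mu> \<beta> C\<^esub> f = (\<lambda>g. fun_scale c (f g))"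
  unfolding orbit_crossed_product_eq[OF assms] crossed_product_simps corner_simps N.FH_simps
  by (simp_all add: fun_scale_def)

definition block_decomposition :: "('a \<Rightarrow> 'f) \<Rightarrow> ('a \<Rightarrow> 'k) set \<Rightarrow> 'g \<Rightarrow> 'a \<Rightarrow> 'f" where
  "block_decomposition f = (\<lambda>C\<in>orb ` L. \<lambda>g. if g \<in> carrier G then coset_coeffs f g \<otimes>\<^bsub>A\<^esub> E C else 0)"

text \<open>The inverse adds up the components and reassembles the cosets. It is a left inverse
  because the orbit sums add up to 1, and a right inverse because they are orthogonal
  idempotents.\<close>

lemma block_decomposition_bij:
  "bij_betw block_decomposition (carrier (twisted \<beta>))
     (\<Pi>\<^sub>E C\<in>orb ` L. carrier (orbit_crossed_product \<iota> \<Gamma> G N \<mu> \<beta> C))"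
proof -
  let ?P = "\<Pi>\<^sub>E C\<in>orb ` L. carrier (orbit_crossed_product \<iota> \<Gamma> G N \<mu> \<beta> C)"
  \<comment> \<open>An element x of \<Gamma> lies over \<open>p x\<close> and has N-part
    \<open>x \<otimes> inv (\<mu> (p x))\<close>.\<close>
  define glue where "glue F x = (if x \<in> carrier \<Gamma> then (\<Sum>C\<in>orb ` L. F C (p x)) (x \<otimes> inv (\<mu> (p x))) else 0)"
    for F :: "('a \<Rightarrow> 'k) set \<Rightarrow> 'g \<Rightarrow> 'a \<Rightarrow> 'f" and x
  have glue_left: "glue (block_decomposition f) = f" if f: "f \<in> carrier (twisted \<beta>)" for f
  proof
    fix x
    show "glue (block_decomposition f) x = f x"
    proof (cases "x \<in> carrier \<Gamma>")
      case x: True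
      have "(\<Sum>C\<in>orb ` L. block_decomposition f C (p x)) = (\<Sum>C\<in>orb ` L. coset_coeffs f (p x) \<otimes>\<^bsub>A\<^esub> E C)"
        using x by (intro sum.cong refl) (simp add: block_decomposition_def)
      also have "\<dots> = coset_coeffs f (p x) \<otimes>\<^bsub>A\<^esub> (\<Sum>C\<in>orb ` L. E C)"
        by (rule N.FH_mult_sum[OF E_closed coset_coeffs_closed, symmetric])
      also have "\<dots> = coset_coeffs f (p x)"
        by (simp only: sum_E N.FH.r_one coset_coeffs_closed)
      finally show ?thesis
        using x by (simp add: glue_def coset_coeffs_def rep_closed rep_coset)
    qed (use f in \<open>simp add: glue_def carrier_twisted_group_algebra\<close>)
  qed
  have glue_right: "block_decomposition (glue F) = F" if F: "F \<in> ?P" for F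
  proof (rule extensionalityI[of _ "orb ` L"])
    show "block_decomposition (glue F) \<in> extensional (orb ` L)"
      by (simp add: block_decomposition_def)
    show "F \<in> extensional (orb ` L)"
      using F by (simp add: PiE_def)
    fix C assume C: "C \<in> orb ` L"
    have FC: "F D g \<otimes>\<^bsub>A\<^esub> E C = (if D = C then F C g else 0)" and FA: "F D g \<in> carrier A"
      if D: "D \<in> orb ` L" and g: "g \<in> carrier G" for D g
    proof -
      have "F D \<in> carrier (orbit_crossed_product \<iota> \<Gamma> G N \<mu> \<beta> D)"
        using F D by blast
      then obtain x where x: "x \<in> carrier A" "F D g = x \<otimes>\<^bsub>A\<^esub> E D"
        using g unfolding orbit_crossed_product_simps[OF D] by blast
      then show "F D g \<in> carrier A"
        using N.mult_closed_FH by simp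
      have "F D g \<otimes>\<^bsub>A\<^esub> E C = x \<otimes>\<^bsub>A\<^esub> (E D \<otimes>\<^bsub>A\<^esub> E C)"
        using x E_closed[OF C] E_closed[OF D] by (simp add: N.FH.m_assoc)
      also have "\<dots> = (if D = C then F C g else 0)"
        using E_idem[OF C] E_orthogonal[OF D C] x N.FH.r_null[OF x(1)] by (auto simp: N.FH_simps)
      finally show "F D g \<otimes>\<^bsub>A\<^esub> E C = (if D = C then F C g else 0)" .
    qed
    show "block_decomposition (glue F) C = F C"
    proof
      fix g
      show "block_decomposition (glue F) C g = F C g"
      proof (cases "g \<in> carrier G")
        case g: True
        have sum_closed: "(\<Sum>D\<in>orb ` L. F D g) \<in> carrier A"
          using FA[OF _ g] by (rule N.FH_sum_closed)
        have "coset_coeffs (glue F) g = (\<Sum>D\<in>orb ` L. F D g)"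
        proof
          fix n
          show "coset_coeffs (glue F) g n = (\<Sum>D\<in>orb ` L. F D g) n"
            using sum_closed unfolding N.carrier_FH
            by (cases "n \<in> N") (simp_all add: coset_coeffs_def glue_def coset_closed[OF g] p_coset[OF g] coset_rep[OF g])
        qed
        then have "block_decomposition (glue F) C g = (\<Sum>D\<in>orb ` L. F D g) \<otimes>\<^bsub>A\<^esub> E C"
          using C g by (simp add: block_decomposition_def)
        also have "\<dots> = (\<Sum>D\<in>orb ` L. F D g \<otimes>\<^bsub>A\<^esub> E C)"
          using FA[OF _ g] E_closed[OF C] by (rule N.FH_sum_mult)
        also have "\<dots> = (\<Sum>D\<in>orb ` L. if D = C then F C g else 0)"
          by (intro sum.cong refl FC g)
        also have "\<dots> = F C g"
          using C finite_L by simp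
        finally show ?thesis .
      next
        case False
        moreover have "F C \<in> carrier (orbit_crossed_product \<iota> \<Gamma> G N \<mu> \<beta> C)"
          using F C by blast
        ultimately show ?thesis
          using C unfolding orbit_crossed_product_simps[OF C] by (simp add: block_decomposition_def)
      qed
    qed
  qed
  have into: "block_decomposition f \<in> ?P" for f
    by (rule PiE_I) (auto simp: block_decomposition_def orbit_crossed_product_simps coset_coeffs_closed)
  have glue_closed: "glue F \<in> carrier (twisted \<beta>)" for F
    by (simp add: carrier_twisted_group_algebra glue_def)
  show ?thesis
    by (rule bij_betw_byWitness[where f' = glue])
      (intro ballI image_subsetI, simp only: glue_left glue_right into glue_closed)+
qed

text \<open>Skewing fixes the orbit sum by \<open>S_E\<close>, so each term of the product in the
  component is the term of \<open>coset_coeffs_mult\<close> with several copies of the orbit sum,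
  which \<open>idempotent_absorb\<close> reduces to one.\<close>

lemma block_decomposition_mult:
  "block_decomposition (f \<otimes>\<^bsub>twisted \<beta>\<^esub> f') =
     (\<lambda>C\<in>orb ` L. block_decomposition f C \<otimes>\<^bsub>orbit_crossed_product \<iota> \<Gamma> G N \<mu> \<beta> C\<^esub> block_decomposition f' C)"
proof (rule extensionalityI[of _ "orb ` L"])
  fix C assume C: "C \<in> orb ` L"
  show "block_decomposition (f \<otimes>\<^bsub>twisted \<beta>\<^esub> f') C =
      (\<lambda>C\<in>orb ` L. block_decomposition f C \<otimes>\<^bsub>orbit_crossed_product \<iota> \<Gamma> G N \<mu> \<beta> C\<^esub> block_decomposition f' C) C"
    unfolding restrict_apply'[OF C]
  proof
    fix z
    let ?w = "\<lambda>q. fun_scale (\<beta> (fst q) (snd q)) (basis_elem (\<alpha> (fst q) (snd q)))"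
    let ?t = "\<lambda>q. coset_coeffs f (fst q) \<otimes>\<^bsub>A\<^esub> S (fst q) (coset_coeffs f' (snd q)) \<otimes>\<^bsub>A\<^esub> ?w q"
    have "(block_decomposition f C \<otimes>\<^bsub>orbit_crossed_product \<iota> \<Gamma> G N \<mu> \<beta> C\<^esub> block_decomposition f' C) z =
        (\<Sum>q\<in>factors z. ?t q \<otimes>\<^bsub>A\<^esub> E C)"
      unfolding orbit_crossed_product_mult[OF C]
    proof (intro sum.cong refl)
      fix q assume "q \<in> factors z"
      then have q: "fst q \<in> carrier G" "snd q \<in> carrier G"
        by auto
      show "block_decomposition f C (fst q) \<otimes>\<^bsub>A\<^esub> S (fst q) (block_decomposition f' C (snd q)) \<otimes>\<^bsub>A\<^esub>
          (E C \<otimes>\<^bsub>A\<^esub> ?w q) = ?t q \<otimes>\<^bsub>A\<^esub> E C"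
        using C q N.idempotent_absorb[OF coset_coeffs_closed S_closed[OF q(1)] twist_closed[OF q]
            E_closed[OF C] E_idem[OF C]]
        by (simp add: block_decomposition_def S_mult S_E)
    qed
    also have "\<dots> = (\<Sum>q\<in>factors z. ?t q) \<otimes>\<^bsub>A\<^esub> E C"
      by (rule N.FH_sum_mult[OF N.mult_closed_FH E_closed[OF C], symmetric])
    also have "\<dots> = block_decomposition (f \<otimes>\<^bsub>twisted \<beta>\<^esub> f') C z"
    proof (cases "z \<in> carrier G")
      case True
      then show ?thesis
        using C by (simp only: coset_coeffs_mult block_decomposition_def restrict_apply' if_True)
    next
      case False
      then have "factors z = {}"
        by auto
      then have "(\<Sum>q\<in>factors z. ?t q) = 0"
        by (simp only: sum.empty)
      then show ?thesis
        using C False N.FH.l_null[OF E_closed[OF C]] by (simp add: block_decomposition_def N.FH_simps)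
    qed
    finally show "block_decomposition (f \<otimes>\<^bsub>twisted \<beta>\<^esub> f') C z =
        (block_decomposition f C \<otimes>\<^bsub>orbit_crossed_product \<iota> \<Gamma> G N \<mu> \<beta> C\<^esub> block_decomposition f' C) z"
      by simp
  qed
qed (simp_all add: block_decomposition_def)

lemma block_decomposition_one:
  "block_decomposition (basis_elem \<one>) =
     (\<lambda>C\<in>orb ` L. \<lambda>g. if g = \<one>\<^bsub>G\<^esub> then E C else 0)"
proof -
  have c: "coset_coeffs (basis_elem \<one>) g = (if g = \<one>\<^bsub>G\<^esub> then \<one>\<^bsub>A\<^esub> else 0)" if g: "g \<in> carrier G" for g
  proof
    fix n
    \<comment> \<open>Applying \<open>p\<close> forces g = 1, and then the normalization of the
      section at 1 forces n = 1. Thus the unit sits over g = 1 with coefficient the unit of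
      FN.\<close>
    have "n \<otimes> \<mu> g = \<one> \<longleftrightarrow> g = \<one>\<^bsub>G\<^esub> \<and> n = \<one>" if "n \<in> N"
      using p_coset[OF g that] that by (auto simp: \<mu>_one N_closed)
    then show "coset_coeffs (basis_elem \<one>) g n = (if g = \<one>\<^bsub>G\<^esub> then \<one>\<^bsub>A\<^esub> else 0) n"
      using N.one_closed by (auto simp: coset_coeffs_def basis_elem_def N.FH_simps)
  qed
  show ?thesis
    unfolding block_decomposition_def
  proof (rule restrict_ext)
    fix C assume C: "C \<in> orb ` L"
    show "(\<lambda>g. if g \<in> carrier G then coset_coeffs (basis_elem \<one>) g \<otimes>\<^bsub>A\<^esub> E C else 0) =
        (\<lambda>g. if g = \<one>\<^bsub>G\<^esub> then E C else 0)"
      using E_closed[OF C] N.FH.l_null[OF E_closed[OF C]] by (auto simp: c N.FH_simps(2) fun_eq_iff)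
  qed
qed

lemma twisted_group_algebra_decomposition:
  "algebra_isomorphic (twisted \<beta>)
     (external_direct_sum (orb ` L) (orbit_crossed_product \<iota> \<Gamma> G N \<mu> \<beta>))"
proof -
  have ext: "x = y" if "x \<in> extensional (orb ` L)" "y \<in> extensional (orb ` L)"
    "\<And>C g. C \<in> orb ` L \<Longrightarrow> x C g = y C g" for x y :: "('a \<Rightarrow> 'k) set \<Rightarrow> 'g \<Rightarrow> 'a \<Rightarrow> 'f"
    using that by (intro extensionalityI[of _ "orb ` L"]) auto
  have add: "block_decomposition (f + f') =
      (\<lambda>C\<in>orb ` L. \<lambda>g. block_decomposition f C g + block_decomposition f' C g)" for f f'
  proof (rule ext)
    fix C g assume C: "C \<in> orb ` L"
    have "(coset_coeffs f g + coset_coeffs f' g) \<otimes>\<^bsub>A\<^esub> E C =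
        coset_coeffs f g \<otimes>\<^bsub>A\<^esub> E C + coset_coeffs f' g \<otimes>\<^bsub>A\<^esub> E C"
      using N.FH.l_distr[OF coset_coeffs_closed coset_coeffs_closed E_closed[OF C]] by (simp only: N.FH_simps)
    then show "block_decomposition (f + f') C g =
        (\<lambda>C\<in>orb ` L. \<lambda>g. block_decomposition f C g + block_decomposition f' C g) C g"
      using C by (simp only: block_decomposition_def coset_coeffs_add restrict_apply' if_True if_False) simp
  qed (simp_all add: block_decomposition_def)
  have scale: "block_decomposition (\<lambda>x. c * f x) =
      (\<lambda>C\<in>orb ` L. \<lambda>g. fun_scale c (block_decomposition f C g))" for c f
  proof (rule ext)
    fix C g assume C: "C \<in> orb ` L"
    show "block_decomposition (\<lambda>x. c * f x) C g =
        (\<lambda>C\<in>orb ` L. \<lambda>g. fun_scale c (block_decomposition f C g)) C g"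
      using C by (simp add: block_decomposition_def coset_coeffs_scale N.fun_scale_mult)
  qed (simp_all add: block_decomposition_def)
  note bij = block_decomposition_bij[of \<beta>]
  have "block_decomposition \<in> ring_iso (twisted \<beta>)
      (external_direct_sum (orb ` L) (orbit_crossed_product \<iota> \<Gamma> G N \<mu> \<beta>))"
    using bij bij_betwE[OF bij]
    by (intro ring_iso_memI)
      (simp_all add: external_direct_sum_simps block_decomposition_mult twisted_group_algebra_simps
        block_decomposition_one add orbit_crossed_product_simps cong: restrict_cong)
  moreover have "block_decomposition (c \<odot>\<^bsub>twisted \<beta>\<^esub> f) =
      c \<odot>\<^bsub>external_direct_sum (orb ` L) (orbit_crossed_product \<iota> \<Gamma> G N \<mu> \<beta>)\<^esub> block_decomposition f" for c f
    by (simp add: external_direct_sum_simps twisted_group_algebra_simps scale orbit_crossed_product_simps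
        cong: restrict_cong)
  ultimately show ?thesis
    unfolding algebra_isomorphic_def algebra_iso_def by blast
qed

lemma orbit_algebra_decomposition:
  assumes "\<chi> \<in> L"
  shows "algebra_isomorphic (orbit_algebra \<iota> K (orb \<chi>)) (external_direct_sum (orb \<chi>) (character_field \<iota> K))"
  unfolding orbit_algebra_def N.orbit_idempotent_eq[OF Lin orb_subset]
  by (rule N.corner_block_sum_iso[OF Lin orb_subset])

abbreviation ev :: "('a \<Rightarrow> 'k) \<Rightarrow> ('a \<Rightarrow> 'f) \<Rightarrow> 'k" where "ev \<chi> x \<equiv> pairing \<iota> N x \<chi>"

section \<open>Invariant characters\<close>

context
  fixes \<chi> :: "'a \<Rightarrow> 'k"
  assumes \<chi>: "\<chi> \<in> L" and invariant: "\<And>g n. g \<in> carrier G \<Longrightarrow> n \<in> N \<Longrightarrow> \<chi> (\<sigma> g n) = \<chi> n"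
begin

text \<open>The conjugate idempotent belongs to the conjugate character, which agrees with
  \<open>\<chi>\<close> on \<open>N\<close>; a character has only one block idempotent.\<close>

lemma invariant_S_e:
  assumes g: "g \<in> carrier G"
  shows "S g (e \<chi>) = e \<chi>"
proof -
  note nz = N.is_Lin_linear[OF Lin \<chi>]
  note block = N.char_idempotent_block[OF nz]
  have g': "inv\<^bsub>G\<^esub> g \<in> carrier G"
    using g by simp
  have "N.block_idempotent (\<lambda>n. \<chi> (\<sigma> (inv\<^bsub>G\<^esub> g) n)) (S g (e \<chi>))"
    using g by (intro N.block_idempotent_linext[OF block]) (auto simp: \<sigma>_hom \<sigma>_comp \<sigma>_one)
  then have "N.block_idempotent \<chi> (S g (e \<chi>))"
    by (subst N.block_idempotent_cong[of \<chi> "\<lambda>n. \<chi> (\<sigma> (inv\<^bsub>G\<^esub> g) n)"]) (simp_all add: invariant[OF g'])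
  then show ?thesis
    by (rule N.block_idempotent_unique[OF nz _ block])
qed

lemma invariant_orb: "orb \<chi> = {\<chi>}"
proof
  show "orb \<chi> \<subseteq> {\<chi>}"
    using N.is_Lin_inj[OF Lin _ \<chi>] by (auto simp: orb_iff invariant_S_e)
  show "{\<chi>} \<subseteq> orb \<chi>"
    using orb_self[OF \<chi>] by simp
qed

lemma invariant_ev_S:
  assumes "g \<in> carrier G"
  shows "ev \<chi> (S g x) = ev \<chi> x"
proof -
  have "\<sigma> g \<in> N \<rightarrow> N"
    using assms \<sigma>_closed by blast
  then show ?thesis
    using N.ev_linext[of "\<sigma> g" x \<chi>] N.ev_cong[of "\<lambda>n. \<chi> (\<sigma> g n)" \<chi> x] invariant[OF assms] by simp
qed

lemma invariant_crossed_product_iso: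
  "algebra_isomorphic (orbit_crossed_product \<iota> \<Gamma> G N \<mu> \<beta> (orb \<chi>))
     (twisted_group_algebra (character_field \<iota> K \<chi>) G (\<lambda>g h. \<iota> (\<beta> g h) * \<chi> (\<alpha> g h)))"
proof -
  let ?R = "ev \<chi> ` carrier A" and ?\<gamma> = "\<lambda>g h. \<iota> (\<beta> g h) * \<chi> (\<alpha> g h)"
  let ?X = "orbit_crossed_product \<iota> \<Gamma> G N \<mu> \<beta> (orb \<chi>)"
  let ?Y = "twisted_group_algebra (scalar_algebra \<iota> ?R) G ?\<gamma>"
  let ?B = "(\<lambda>x. x \<otimes>\<^bsub>A\<^esub> E (orb \<chi>)) ` carrier A"
  let ?h = "\<lambda>f g. ev \<chi> (f g)"
  note nz = N.is_Lin_linear[OF Lin \<chi>]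
  have orb: "orb \<chi> \<in> orb ` L"
    using \<chi> by blast
  note X = orbit_crossed_product_simps[OF orb]
  have ev_E: "ev \<chi> (E (orb \<chi>)) = 1"
    by (rule N.ev_block_sum[OF Lin orb_subset orb_self[OF \<chi>]])
  have zero: "0 \<in> ?R"
    using N.ev_zero[of \<chi>] N.FH.zero_closed by (intro image_eqI[of _ _ 0]) (simp_all add: N.FH_simps)
  have add: "u + v \<in> ?R" if "u \<in> ?R" "v \<in> ?R" for u v
    using that N.FH_add_closed by (auto simp: N.ev_add[symmetric])
  \<comment> \<open>The scalar cocycle is the value of the twisting of FN. In particular it lies in
    F(\<chi>), as the product in \<open>?Y\<close> requires.\<close>
  have \<gamma>: "?\<gamma> g h = ev \<chi> (fun_scale (\<beta> g h) (basis_elem (\<alpha> g h)))" if "g \<in> carrier G" "h \<in> carrier G" for g h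
    using that by (simp add: N.ev_fun_scale N.ev_basis_elem \<alpha>_closed)
  have Y_carrier: "y \<in> carrier ?Y \<longleftrightarrow> (\<forall>g\<in>carrier G. y g \<in> ?R) \<and> (\<forall>g. g \<notin> carrier G \<longrightarrow> y g = 0)" for y
    by (simp add: twisted_group_algebra_def crossed_product_simps scalar_algebra_simps)
  have Y_mult: "(y \<otimes>\<^bsub>?Y\<^esub> y') z = (\<Sum>q\<in>factors z. y (fst q) * y' (snd q) * ?\<gamma> (fst q) (snd q))"
    if "y \<in> carrier ?Y" "y' \<in> carrier ?Y" for y y' z
  proof -
    let ?F = "scalar_algebra \<iota> ?R"
    have "(y \<otimes>\<^bsub>crossed_product ?F G (\<lambda>_ r. r) ?\<gamma>\<^esub> y') z =
        (\<Sum>q\<in>factors z. y (fst q) \<otimes>\<^bsub>?F\<^esub> y' (snd q) \<otimes>\<^bsub>?F\<^esub> ?\<gamma> (fst q) (snd q))"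
    proof (rule crossed_product_mult)
      show "abelian_monoid ?F"
        by (rule abelian_monoid_scalar_algebra[OF zero add])
      fix g h assume gh: "g \<in> carrier G" "h \<in> carrier G"
      have "y g * y' h * ?\<gamma> g h \<in> ?R"
        unfolding \<gamma>[OF gh] using that gh twist_closed[OF gh, of \<beta>]
        by (intro N.ev_image_mult[OF nz] imageI) (simp_all only: Y_carrier)
      then show "y g \<otimes>\<^bsub>?F\<^esub> y' h \<otimes>\<^bsub>?F\<^esub> ?\<gamma> g h \<in> carrier ?F"
        by (simp only: scalar_algebra_simps)
    qed (simp_all only: scalar_algebra_simps)
    then show ?thesis
      by (simp only: twisted_group_algebra_def scalar_algebra_simps)
  qed
  have X_closed: "f g \<in> carrier A" if "f \<in> carrier ?X" "g \<in> carrier G" for f g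
  proof -
    have "f g \<in> ?B"
      using that unfolding X by blast
    then show ?thesis
      by (rule subsetD[rotated]) (rule image_subsetI, rule N.mult_closed_FH)
  qed
  \<comment> \<open>The orbit is a singleton, so its sum is the single idempotent of
    \<open>\<chi>\<close> and the corner is the block already identified with F(\<chi>).\<close>
  have ev_bij: "bij_betw (ev \<chi>) ?B ?R"
    using N.ev_corner_iso[OF nz N.char_idempotent_block[OF nz]]
    unfolding algebra_iso_def ring_iso_def N.character_field_eq[OF nz]
    by (simp add: corner_simps scalar_algebra_simps invariant_orb)
  have bij: "bij_betw ?h (carrier ?X) (carrier ?Y)"
  \<comment> \<open>The block isomorphism is inverted coefficient by coefficient. Outside G the
    value 0 is set by hand, since elements of the crossed product vanish there.\<close>
  proof (rule bij_betw_byWitness[where f' = "\<lambda>y g. if g \<in> carrier G then inv_into ?B (ev \<chi>) (y g) else 0"])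
    have "inv_into ?B (ev \<chi>) (ev \<chi> b) = b" if "b \<in> ?B" for b
      using bij_betw_inv_into_left[OF ev_bij that] .
    then show "\<forall>f\<in>carrier ?X. (\<lambda>g. if g \<in> carrier G then inv_into ?B (ev \<chi>) (ev \<chi> (f g)) else 0) = f"
      by (auto simp: X fun_eq_iff)
    have right: "ev \<chi> (inv_into ?B (ev \<chi>) r) = r" and into: "inv_into ?B (ev \<chi>) r \<in> ?B" if "r \<in> ?R" for r
      using bij_betw_inv_into_right[OF ev_bij that] inv_into_into[of r "ev \<chi>" ?B] that ev_bij
      by (simp_all add: bij_betw_def)
    show "\<forall>y\<in>carrier ?Y. (\<lambda>g. ev \<chi> (if g \<in> carrier G then inv_into ?B (ev \<chi>) (y g) else 0)) = y"
    proof (intro ballI ext)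
      fix y g assume "y \<in> carrier ?Y"
      then show "ev \<chi> (if g \<in> carrier G then inv_into ?B (ev \<chi>) (y g) else 0) = y g"
        unfolding Y_carrier using right by (cases "g \<in> carrier G") (simp_all add: N.ev_zero)
    qed
    show "?h ` carrier ?X \<subseteq> carrier ?Y"
    proof (rule image_subsetI)
      fix f assume f: "f \<in> carrier ?X"
      have "f g = 0" if "g \<notin> carrier G" for g
        using f that unfolding X by blast
      then show "?h f \<in> carrier ?Y"
        unfolding Y_carrier using X_closed[OF f] by (auto simp: N.ev_zero)
    qed
    show "(\<lambda>y g. if g \<in> carrier G then inv_into ?B (ev \<chi>) (y g) else 0) ` carrier ?Y \<subseteq> carrier ?X"
    proof (rule image_subsetI)
      fix y assume "y \<in> carrier ?Y"
      then have "y g \<in> ?R" if "g \<in> carrier G" for g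
        using that unfolding Y_carrier by blast
      then show "(\<lambda>g. if g \<in> carrier G then inv_into ?B (ev \<chi>) (y g) else 0) \<in> carrier ?X"
        unfolding X using into by simp
    qed
  qed
  have into: "?h f \<in> carrier ?Y" if "f \<in> carrier ?X" for f
    using bij that by (rule bij_betwE[THEN bspec])
  have mult: "?h (f \<otimes>\<^bsub>?X\<^esub> f') = ?h f \<otimes>\<^bsub>?Y\<^esub> ?h f'" if f: "f \<in> carrier ?X" "f' \<in> carrier ?X" for f f'
  proof
    fix z
    have "ev \<chi> ((f \<otimes>\<^bsub>?X\<^esub> f') z) =
        (\<Sum>q\<in>factors z. ev \<chi> (f (fst q)) * ev \<chi> (f' (snd q)) * ?\<gamma> (fst q) (snd q))"
      unfolding orbit_crossed_product_mult[OF orb] N.ev_sum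
    proof (rule sum.cong[OF refl])
      fix q assume "q \<in> factors z"
      then have q: "fst q \<in> carrier G" "snd q \<in> carrier G"
        by auto
      show "ev \<chi> (f (fst q) \<otimes>\<^bsub>A\<^esub> S (fst q) (f' (snd q)) \<otimes>\<^bsub>A\<^esub>
          (E (orb \<chi>) \<otimes>\<^bsub>A\<^esub> fun_scale (\<beta> (fst q) (snd q)) (basis_elem (\<alpha> (fst q) (snd q))))) =
          ev \<chi> (f (fst q)) * ev \<chi> (f' (snd q)) * ?\<gamma> (fst q) (snd q)"
        \<comment> \<open>Evaluation is multiplicative, has value 1 at the orbit sum and ignores
          \<open>S\<close>, so only the coefficients and the scalar cocycle remain.\<close>
        by (simp only: N.ev_mult[OF nz] ev_E invariant_ev_S[OF q(1)] \<gamma>[OF q] mult_1_left)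
    qed
    then show "ev \<chi> ((f \<otimes>\<^bsub>?X\<^esub> f') z) = (?h f \<otimes>\<^bsub>?Y\<^esub> ?h f') z"
      by (simp only: Y_mult[OF into into] f)
  qed
  have "?h \<in> ring_iso ?X ?Y"
  proof (rule ring_iso_memI)
    show "?h \<one>\<^bsub>?X\<^esub> = \<one>\<^bsub>?Y\<^esub>"
      by (simp add: X twisted_group_algebra_def crossed_product_simps scalar_algebra_simps fun_eq_iff ev_E N.ev_zero)
    show "?h (f \<oplus>\<^bsub>?X\<^esub> f') = ?h f \<oplus>\<^bsub>?Y\<^esub> ?h f'" for f f'
      unfolding X by (simp only: N.ev_add twisted_group_algebra_def crossed_product_simps scalar_algebra_simps)
  qed (use into mult bij in blast)+
  moreover have "?h (c \<odot>\<^bsub>?X\<^esub> f) = c \<odot>\<^bsub>?Y\<^esub> ?h f" for c f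
    unfolding X by (simp only: N.ev_fun_scale twisted_group_algebra_def crossed_product_simps scalar_algebra_simps)
  ultimately have "?h \<in> algebra_iso ?X ?Y"
    by (simp add: algebra_iso_def)
  then show ?thesis
    unfolding algebra_isomorphic_def N.character_field_eq[OF nz] by blast
qed

end

end

theorem theorem4:
  fixes \<iota> :: "'f::field_char_0 \<Rightarrow> 'k::field"
    and \<Gamma> :: "('a, 'x) monoid_scheme" and G :: "('g, 'y) monoid_scheme"
    and p :: "'a \<Rightarrow> 'g" and N :: "'a set"
    and \<beta> :: "'g \<Rightarrow> 'g \<Rightarrow> 'f" and \<mu> :: "'g \<Rightarrow> 'a"
    and L :: "('a \<Rightarrow> 'k) set"
  assumes "number_field TYPE('f)"
    and "group \<Gamma>" and "finite (carrier \<Gamma>)"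
    and "group G" and "finite (carrier G)"
    and "p \<in> epi \<Gamma> G" and "N = kernel \<Gamma> G p"
    and "comm_group (\<Gamma>\<lparr>carrier := N\<rparr>)"
    and "normalized_2_cocycle G \<beta>"
    and "normalized_section \<Gamma> G p \<mu>"
    and "field_hom \<iota>"
    and "splitting_field TYPE('k) (\<Gamma>\<lparr>carrier := N\<rparr>)"
    and "is_Lin \<iota> (\<Gamma>\<lparr>carrier := N\<rparr>) L"
  shows
    "algebra_isomorphic
       (twisted_group_algebra base_algebra \<Gamma> (\<lambda>x y. \<beta> (p x) (p y)))
       (external_direct_sum (Lin_orbit \<iota> \<Gamma> G N \<mu> L ` L) (orbit_crossed_product \<iota> \<Gamma> G N \<mu> \<beta>))
     \<and> (\<forall>\<chi>\<in>L. algebra_isomorphic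
          (orbit_algebra \<iota> (\<Gamma>\<lparr>carrier := N\<rparr>) (Lin_orbit \<iota> \<Gamma> G N \<mu> L \<chi>))
          (external_direct_sum (Lin_orbit \<iota> \<Gamma> G N \<mu> L \<chi>) (character_field \<iota> (\<Gamma>\<lparr>carrier := N\<rparr>))))
     \<and> (\<forall>\<chi>\<in>L. (\<forall>g\<in>carrier G. \<forall>n\<in>N. \<chi> (section_conj \<Gamma> \<mu> g n) = \<chi> n) \<longrightarrow>
          algebra_isomorphic
            (orbit_crossed_product \<iota> \<Gamma> G N \<mu> \<beta> (Lin_orbit \<iota> \<Gamma> G N \<mu> L \<chi>))
            (twisted_group_algebra (character_field \<iota> (\<Gamma>\<lparr>carrier := N\<rparr>) \<chi>) G
               (\<lambda>g h. \<iota> (\<beta> g h) * \<chi> (section_cocycle \<Gamma> G \<mu> g h))))"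
proof -
  interpret finite_group_extension \<iota> \<Gamma> G p N \<mu> L
    using assms by (intro finite_group_extension.intro)
  show ?thesis
    using twisted_group_algebra_decomposition orbit_algebra_decomposition invariant_crossed_product_iso
    by blast
qed

end
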